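(* Let $q\in\mathbb{Q}$ with $q>0$ and let $m\in\mathbb{N}$ with $m>3$. Consider the decision problem whose instances are pairs $(n,X)$ with $n\in\mathbb{N}$, $n\ge 1$, and $X\in\mathrm{IS}$ such that $\mathrm{len}(X)\le L(n)+\lceil q\cdot n\rceil+m$, and which asks whether $X$ computes $\mathrm{tstnz}_n$. This problem is co-NP-complete.
   Context: Basic instructions: $\mathtt{in}{:}i.\mathtt{get}$ ($i\ge1$), $\mathtt{out}.\mathtt{set}{:}b$ ($b\in\{0,1\}$), $\mathtt{aux}{:}i.\mathtt{get}$ ($i\ge1$), $\mathtt{aux}{:}i.\mathtt{set}{:}b$ ($i\ge1$, $b\in\{0,1\}$). The part before the dot names a Boolean register ($\mathtt{in}{:}i$ is the $i$-th input register, $\mathtt{out}$ the output register, $\mathtt{aux}{:}i$ the $i$-th auxiliary register); the command $\mathtt{get}$ changes nothing and replies the register's content, $\mathtt{set}{:}b$ makes the content $b$ and replies $b$. Primitive instructions: for each basic instruction $a$, the plain instruction $a$, the positive test $+a$ and the negative test $-a$; forward jumps $\#l$ ($l\in\mathbb{N}$); termination $!$. $\mathrm{IS}$ is the set of finite sequences $X=u_1;\dots;u_k$ of primitive instructions, $\mathrm{len}(X)=k$. Execution starts at $u_1$: plain $a$ executes $a$ and proceeds with the next instruction; $+a$ executes $a$ and proceeds with the next instruction if the reply is $1$, otherwise skips the next instruction and proceeds with the one after it; $-a$ is the same with the roles of the replies reversed; $\#l$ proceeds with the $l$-th next instruction; $!$ terminates execution. If $l=0$ or there is no instruction to proceed with,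 inaction occurs (execution never terminates). For $f:\{0,1\}^n\to\{0,1\}$, $X$ computes $f$ if there is $k\in\mathbb{N}$ such that for all $b_1,\dots,b_n\in\{0,1\}$, when $X$ is executed with initial contents $b_i$ in $\mathtt{in}{:}i$ ($1\le i\le n$), $0$ in $\mathtt{out}$ and $0$ in $\mathtt{aux}{:}1,\dots,\mathtt{aux}{:}k$ (any other register used by $X$ having an arbitrary initial content), execution terminates and the final content of $\mathtt{out}$ is $f(b_1,\dots,b_n)$. $\mathrm{tstnz}_n:\{0,1\}^n\to\{0,1\}$ is defined by $\mathrm{tstnz}_n(b_1,\dots,b_n)=1$ iff $b_i=1$ for some $i$. $L(n)=3n/2+1$ if $n$ is even and $L(n)=3(n+1)/2$ if $n$ is odd (this is the length of the shortest instruction sequences computing $\mathrm{tstnz}_n$). Instruction sequences are encoded as lists of their primitive instructions, each represented by two integers (one encoding its form, the other the natural number it contains, or $-1$ if none). *)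

theory Defs
  imports Complex_Main "HOL-Computational_Algebra.Polynomial"
begin

section \<open>Polynomial time, NP and co-NP\<close>

datatype move = MoveLeft | Stay | MoveRight

text \<open>
  Deterministic multi-tape Turing machines. The tapes are infinite in both directions. The tape
  symbols are the numbers below \<open>tm_syms\<close>: 0 is the blank, 1 and 2 represent the bits 0 and 1.
  The states are the numbers up to and including \<open>tm_states\<close>: 0 is the initial state and
  \<open>tm_states\<close> itself is the halting state. \<open>tm_delta\<close> matters only on its finite domain, i.e. for
  non-halting states and lists of \<open>tm_tapes\<close> tape symbols.
\<close>

record tm =
  tm_tapes :: nat
  tm_states :: nat
  tm_syms :: nat
  tm_delta :: "nat \<Rightarrow> nat list \<Rightarrow> nat \<times> (nat \<times> move) list"

definition wf_tm :: "tm \<Rightarrow> bool" where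
  "wf_tm M \<longleftrightarrow> tm_tapes M \<ge> 1 \<and> tm_syms M \<ge> 3 \<and>
     (\<forall>st ss. st < tm_states M \<and> length ss = tm_tapes M \<and> set ss \<subseteq> {..<tm_syms M} \<longrightarrow>
        (case tm_delta M st ss of (st', as) \<Rightarrow>
           st' \<le> tm_states M \<and> length as = tm_tapes M \<and> fst ` set as \<subseteq> {..<tm_syms M}))"

type_synonym tape = "(int \<Rightarrow> nat) \<times> int"  \<comment> \<open>contents and head position\<close>
type_synonym tm_config = "nat \<times> tape list"

definition read_tape :: "tape \<Rightarrow> nat" where
  "read_tape t = fst t (snd t)"

fun act_tape :: "nat \<times> move \<Rightarrow> tape \<Rightarrow> tape" where
  "act_tape (s, d) (c, h) =
     (c(h := s), (case d of MoveLeft \<Rightarrow> h - 1 | Stay \<Rightarrow> h | MoveRight \<Rightarrow> h + 1))"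

fun tm_step :: "tm \<Rightarrow> tm_config \<Rightarrow> tm_config" where
  "tm_step M (st, ts) =
     (if st < tm_states M
      then (case tm_delta M st (map read_tape ts) of (st', as) \<Rightarrow> (st', map2 act_tape as ts))
      else (st, ts))"

definition bit_sym :: "bool \<Rightarrow> nat" where
  "bit_sym b = (if b then 2 else 1)"

definition blank_tape :: tape where
  "blank_tape = ((\<lambda>_. 0), 0)"

definition input_tape :: "bool list \<Rightarrow> tape" where
  "input_tape x =
     ((\<lambda>i. if 0 \<le> i \<and> i < int (length x) then bit_sym (x ! nat i) else 0), 0)"

definition tm_init :: "tm \<Rightarrow> bool list \<Rightarrow> tm_config" where
  "tm_init M x = (0, input_tape x # replicate (tm_tapes M - 1) blank_tape)"

text \<open>The output is the bit string from cell 0 of the last tape up to the first blank.\<close>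

definition tape_output :: "tape \<Rightarrow> bool list \<Rightarrow> bool" where
  "tape_output t y \<longleftrightarrow>
     (\<forall>i < length y. fst t (int i) = bit_sym (y ! i)) \<and> fst t (int (length y)) = 0"

definition tm_computes_within :: "tm \<Rightarrow> nat \<Rightarrow> bool list \<Rightarrow> bool list \<Rightarrow> bool" where
  "tm_computes_within M t x y \<longleftrightarrow>
     (\<exists>t' \<le> t. case (tm_step M ^^ t') (tm_init M x) of (st, ts) \<Rightarrow>
        st = tm_states M \<and> tape_output (last ts) y)"

definition polytime :: "(bool list \<Rightarrow> bool list) \<Rightarrow> bool" where
  "polytime f \<longleftrightarrow>
     (\<exists>M (p :: nat poly). wf_tm M \<and>
        (\<forall>x. tm_computes_within M (poly p (length x)) x (f x)))"

type_synonym language = "bool list set"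

definition class_P :: "language set" where
  "class_P = {A. polytime (\<lambda>x. [x \<in> A])}"

text \<open>Each bit of a string is preceded by True, so that False can mark the end of the string.\<close>

definition mark_bits :: "bool list \<Rightarrow> bool list" where
  "mark_bits x = concat (map (\<lambda>b. [True, b]) x)"

definition encode_pair :: "bool list \<Rightarrow> bool list \<Rightarrow> bool list" where
  "encode_pair x y = mark_bits x @ [False] @ y"

definition class_NP :: "language set" where
  "class_NP = {A. \<exists>V \<in> class_P. \<exists>p :: nat poly.
     \<forall>x. x \<in> A \<longleftrightarrow> (\<exists>y. length y \<le> poly p (length x) \<and> encode_pair x y \<in> V)}"

definition class_coNP :: "language set" where
  "class_coNP = {A. - A \<in> class_NP}"

definition poly_reducible :: "language \<Rightarrow> language \<Rightarrow> bool" where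
  "poly_reducible A B \<longleftrightarrow> (\<exists>f. polytime f \<and> (\<forall>x. x \<in> A \<longleftrightarrow> f x \<in> B))"

definition coNP_complete :: "language \<Rightarrow> bool" where
  "coNP_complete B \<longleftrightarrow> B \<in> class_coNP \<and> (\<forall>A \<in> class_coNP. poly_reducible A B)"


section \<open>Instruction sequences\<close>

datatype basic_instr = InGet nat | OutSet bool | AuxGet nat | AuxSet nat bool

datatype instr = Plain basic_instr | PosTest basic_instr | NegTest basic_instr | Jump nat | Halt

fun valid_basic :: "basic_instr \<Rightarrow> bool" where
  "valid_basic (InGet i) \<longleftrightarrow> i \<ge> 1"
| "valid_basic (OutSet b) \<longleftrightarrow> True"
| "valid_basic (AuxGet i) \<longleftrightarrow> i \<ge> 1"
| "valid_basic (AuxSet i b) \<longleftrightarrow> i \<ge> 1"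

fun valid_instr :: "instr \<Rightarrow> bool" where
  "valid_instr (Plain a) \<longleftrightarrow> valid_basic a"
| "valid_instr (PosTest a) \<longleftrightarrow> valid_basic a"
| "valid_instr (NegTest a) \<longleftrightarrow> valid_basic a"
| "valid_instr (Jump l) \<longleftrightarrow> True"
| "valid_instr Halt \<longleftrightarrow> True"

definition IS :: "instr list set" where
  "IS = {X. \<forall>u \<in> set X. valid_instr u}"

datatype register = In nat | Out | Aux nat

type_synonym reg_state = "register \<Rightarrow> bool"

fun reply :: "basic_instr \<Rightarrow> reg_state \<Rightarrow> bool" where
  "reply (InGet i) s = s (In i)"
| "reply (OutSet b) s = b"
| "reply (AuxGet i) s = s (Aux i)"
| "reply (AuxSet i b) s = b"

fun effect :: "basic_instr \<Rightarrow> reg_state \<Rightarrow> reg_state" where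
  "effect (InGet i) s = s"
| "effect (OutSet b) s = s(Out := b)"
| "effect (AuxGet i) s = s"
| "effect (AuxSet i b) s = s(Aux i := b)"

text \<open>
  \<open>exec X i s s'\<close>: execution of \<open>X\<close> from position \<open>i\<close> (counted from 0) in state \<open>s\<close> terminates in
  state \<open>s'\<close>. Inaction is the absence of such an \<open>s'\<close>.
\<close>

inductive exec :: "instr list \<Rightarrow> nat \<Rightarrow> reg_state \<Rightarrow> reg_state \<Rightarrow> bool" for X where
  exec_Halt: "i < length X \<Longrightarrow> X ! i = Halt \<Longrightarrow> exec X i s s"
| exec_Plain: "i < length X \<Longrightarrow> X ! i = Plain a \<Longrightarrow>
     exec X (i + 1) (effect a s) s' \<Longrightarrow> exec X i s s'"
| exec_PosTest: "i < length X \<Longrightarrow> X ! i = PosTest a \<Longrightarrow>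
     exec X (if reply a s then i + 1 else i + 2) (effect a s) s' \<Longrightarrow> exec X i s s'"
| exec_NegTest: "i < length X \<Longrightarrow> X ! i = NegTest a \<Longrightarrow>
     exec X (if reply a s then i + 2 else i + 1) (effect a s) s' \<Longrightarrow> exec X i s s'"
| exec_Jump: "i < length X \<Longrightarrow> X ! i = Jump l \<Longrightarrow> l > 0 \<Longrightarrow>
     exec X (i + l) s s' \<Longrightarrow> exec X i s s'"

lemma exec_deterministic:
  assumes "exec X i s s1" and "exec X i s s2"
  shows "s1 = s2"
  using assms
proof (induction arbitrary: s2 rule: exec.induct)
  case (exec_Halt i s)
  from exec_Halt.prems show ?case
    by cases (simp_all add: exec_Halt.hyps)
next
  case (exec_Plain i a s s')
  from exec_Plain.prems have "exec X (i + 1) (effect a s) s2"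
    by cases (simp_all add: exec_Plain.hyps(1,2))
  then show ?case by (rule exec_Plain.IH)
next
  case (exec_PosTest i a s s')
  from exec_PosTest.prems have "exec X (if reply a s then i + 1 else i + 2) (effect a s) s2"
    by cases (simp_all add: exec_PosTest.hyps(1,2))
  then show ?case by (rule exec_PosTest.IH)
next
  case (exec_NegTest i a s s')
  from exec_NegTest.prems have "exec X (if reply a s then i + 2 else i + 1) (effect a s) s2"
    by cases (simp_all add: exec_NegTest.hyps(1,2))
  then show ?case by (rule exec_NegTest.IH)
next
  case (exec_Jump i l s s')
  from exec_Jump.prems have "exec X (i + l) s s2"
    by cases (simp_all add: exec_Jump.hyps(1,2))
  then show ?case by (rule exec_Jump.IH)
qed

text \<open>An \<open>n\<close>-ary Boolean function is a function on lists, used only on lists of length \<open>n\<close>.\<close>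

definition computes :: "instr list \<Rightarrow> nat \<Rightarrow> (bool list \<Rightarrow> bool) \<Rightarrow> bool" where
  "computes X n f \<longleftrightarrow>
     (\<exists>k. \<forall>bs s. length bs = n \<and> (\<forall>i \<in> {1..n}. s (In i) = bs ! (i - 1)) \<and>
            s Out = False \<and> (\<forall>i \<in> {1..k}. s (Aux i) = False) \<longrightarrow>
        (\<exists>s'. exec X 0 s s' \<and> s' Out = f bs))"

definition tstnz :: "bool list \<Rightarrow> bool" where
  "tstnz bs \<longleftrightarrow> (\<exists>i < length bs. bs ! i = True)"

definition min_len :: "nat \<Rightarrow> nat" where
  "min_len n = (if even n then 3 * n div 2 + 1 else 3 * (n + 1) div 2)"


section \<open>Encoding of instances\<close>

fun basic_form :: "basic_instr \<Rightarrow> int" where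
  "basic_form (InGet i) = 0"
| "basic_form (OutSet b) = (if b then 2 else 1)"
| "basic_form (AuxGet i) = 3"
| "basic_form (AuxSet i b) = (if b then 5 else 4)"

fun basic_number :: "basic_instr \<Rightarrow> int" where
  "basic_number (InGet i) = int i"
| "basic_number (OutSet b) = -1"
| "basic_number (AuxGet i) = int i"
| "basic_number (AuxSet i b) = int i"

fun instr_code :: "instr \<Rightarrow> int list" where
  "instr_code (Plain a) = [basic_form a, basic_number a]"
| "instr_code (PosTest a) = [6 + basic_form a, basic_number a]"
| "instr_code (NegTest a) = [12 + basic_form a, basic_number a]"
| "instr_code (Jump l) = [18, int l]"
| "instr_code Halt = [19, -1]"

text \<open>Binary notation, least significant bit first, without leading zeros.\<close>

fun nat_bits :: "nat \<Rightarrow> bool list" where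
  "nat_bits n = (if n = 0 then [] else odd n # nat_bits (n div 2))"

declare nat_bits.simps [simp del]

text \<open>The minus sign is encoded as \<open>[False, True]\<close>, the end of an integer as \<open>[False, False]\<close>.\<close>

definition encode_int :: "int \<Rightarrow> bool list" where
  "encode_int z =
     (if z < 0 then [False, True] else []) @ mark_bits (nat_bits (nat \<bar>z\<bar>)) @ [False, False]"

definition encode_instance :: "nat \<times> instr list \<Rightarrow> bool list" where
  "encode_instance = (\<lambda>(n, X). concat (map encode_int (int n # concat (map instr_code X))))"

lemma nat_bits_inject: "nat_bits a = nat_bits b \<Longrightarrow> a = b"
proof (induction a arbitrary: b rule: less_induct)
  case (less a)
  show ?case
  proof (cases "a = 0 \<or> b = 0")
    case True
    with less.prems show ?thesis
      by (auto simp: nat_bits.simps[of a] nat_bits.simps[of b] nat_bits.simps[of 0] split: if_splits)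
  next
    case False
    with less.prems have par: "odd a = odd b" and "nat_bits (a div 2) = nat_bits (b div 2)"
      by (simp_all add: nat_bits.simps[of a] nat_bits.simps[of b])
    with less.IH[of "a div 2"] False have "a div 2 = b div 2" by simp
    with par show ?thesis by presburger
  qed
qed

lemma mark_bits_append_inject:
  "mark_bits x @ False # u = mark_bits y @ False # v \<Longrightarrow> x = y \<and> u = v"
proof (induction x arbitrary: y)
  case Nil
  then show ?case by (cases y) (auto simp: mark_bits_def)
next
  case (Cons b x)
  then show ?case by (cases y) (auto simp: mark_bits_def)
qed

lemma encode_pair_inject: "encode_pair x y = encode_pair x' y' \<longleftrightarrow> x = x' \<and> y = y'"
  by (auto simp: encode_pair_def dest: mark_bits_append_inject)

lemma mark_bits_neq_minus: "mark_bits x @ False # False # u \<noteq> False # True # v"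
  by (cases x) (auto simp: mark_bits_def)

lemma encode_int_append_inject:
  assumes "encode_int a @ u = encode_int b @ v"
  shows "a = b \<and> u = v"
proof -
  have sgn: "(a < 0) = (b < 0)"
    using assms by (auto simp: encode_int_def mark_bits_neq_minus mark_bits_neq_minus[symmetric]
        split: if_splits)
  with assms have "mark_bits (nat_bits (nat \<bar>a\<bar>)) @ False # False # u =
      mark_bits (nat_bits (nat \<bar>b\<bar>)) @ False # False # v"
    by (auto simp: encode_int_def split: if_splits)
  then have "nat_bits (nat \<bar>a\<bar>) = nat_bits (nat \<bar>b\<bar>)" and "u = v"
    using mark_bits_append_inject by blast+
  then show ?thesis using nat_bits_inject[of "nat \<bar>a\<bar>" "nat \<bar>b\<bar>"] sgn by auto
qed

lemma encode_int_nonempty: "encode_int z \<noteq> []"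
  by (simp add: encode_int_def)

lemma encode_ints_inject:
  "concat (map encode_int xs) = concat (map encode_int ys) \<Longrightarrow> xs = ys"
proof (induction xs arbitrary: ys)
  case Nil
  then show ?case using encode_int_nonempty by (cases ys) auto
next
  case (Cons x xs)
  then obtain y ys' where ys: "ys = y # ys'"
    using encode_int_nonempty by (cases ys) auto
  with Cons.prems have "encode_int x @ concat (map encode_int xs) =
      encode_int y @ concat (map encode_int ys')"
    by simp
  from encode_int_append_inject[OF this] Cons.IH ys show ?case by auto
qed

lemma basic_code_inject:
  "basic_form a = basic_form b \<Longrightarrow> basic_number a = basic_number b \<Longrightarrow> a = b"
  by (cases a; cases b) (auto split: if_splits)

lemma basic_form_bounds: "0 \<le> basic_form a \<and> basic_form a < 6"
  by (cases a) auto

lemma instr_code_inject: "instr_code u = instr_code v \<Longrightarrow> u = v"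
  apply (cases u; cases v)
  subgoal premises p for a b using p basic_code_inject[of a b] by auto
  subgoal premises p for a b using p basic_form_bounds[of a] basic_form_bounds[of b] by auto
  subgoal premises p for a b using p basic_form_bounds[of a] basic_form_bounds[of b] by auto
  subgoal premises p for a using p basic_form_bounds[of a] by auto
  subgoal premises p for a using p basic_form_bounds[of a] by auto
  subgoal premises p for a b using p basic_form_bounds[of a] basic_form_bounds[of b] by auto
  subgoal premises p for a b using p basic_code_inject[of a b] by auto
  subgoal premises p for a b using p basic_form_bounds[of a] basic_form_bounds[of b] by auto
  subgoal premises p for a using p basic_form_bounds[of a] by auto
  subgoal premises p for a using p basic_form_bounds[of a] by auto
  subgoal premises p for a b using p basic_form_bounds[of a] basic_form_bounds[of b] by auto
  subgoal premises p for a b using p basic_form_bounds[of a] basic_form_bounds[of b] by auto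
  subgoal premises p for a b using p basic_code_inject[of a b] by auto
  subgoal premises p for a using p basic_form_bounds[of a] by auto
  subgoal premises p for a using p basic_form_bounds[of a] by auto
  subgoal premises p for a b using p basic_form_bounds[of b] by auto
  subgoal premises p for a b using p basic_form_bounds[of b] by auto
  subgoal premises p for a b using p basic_form_bounds[of b] by auto
  subgoal by simp
  subgoal by simp
  subgoal premises p for b using p basic_form_bounds[of b] by auto
  subgoal premises p for b using p basic_form_bounds[of b] by auto
  subgoal premises p for b using p basic_form_bounds[of b] by auto
  subgoal by simp
  subgoal by simp
  done

lemma length_instr_code: "length (instr_code u) = 2"
  by (cases u) auto

lemma instr_codes_inject:
  "concat (map instr_code X) = concat (map instr_code Y) \<Longrightarrow> X = Y"
proof (induction X arbitrary: Y)
  case Nil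
  then show ?case
  proof (cases Y)
    case (Cons v Y')
    with Nil length_instr_code[of v] show ?thesis by auto
  qed simp
next
  case (Cons u X)
  then obtain v Y' where Y: "Y = v # Y'"
    using length_instr_code[of u] by (cases Y) auto
  with Cons.prems length_instr_code[of u] length_instr_code[of v]
  have "instr_code u = instr_code v" "concat (map instr_code X) = concat (map instr_code Y')"
    by auto
  with instr_code_inject Cons.IH Y show ?case by auto
qed

lemma inj_encode_instance: "inj encode_instance"
proof (rule injI)
  fix p p' :: "nat \<times> instr list"
  assume eq: "encode_instance p = encode_instance p'"
  obtain n X n' X' where p: "p = (n, X)" "p' = (n', X')" by (cases p; cases p')
  with eq have "int n # concat (map instr_code X) = int n' # concat (map instr_code X')"
    unfolding encode_instance_def prod.case by (intro encode_ints_inject) simp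
  with instr_codes_inject[of X X'] p show "p = p'" by simp
qed

definition tstnz_instances :: "rat \<Rightarrow> nat \<Rightarrow> (nat \<times> instr list) set" where
  "tstnz_instances q m =
     {(n, X). n \<ge> 1 \<and> X \<in> IS \<and>
        int (length X) \<le> int (min_len n) + \<lceil>q * of_nat n\<rceil> + int m}"

text \<open>
  The language of the encoded yes-instances. Its complement consists of the encoded no-instances
  and of the strings that do not encode an instance.
\<close>

definition tstnz_problem :: "rat \<Rightarrow> nat \<Rightarrow> language" where
  "tstnz_problem q m =
     encode_instance ` {(n, X) \<in> tstnz_instances q m. computes X n tstnz}"

end

theory Submission
  imports Defs "HOL-Library.Countable"
begin

text \<open>
  Membership. A sequence of fewer than \<open>n\<close> instructions misses an input register and cannot compute
  \<open>tstnz\<close>, so \<open>n\<close> may be taken to be at most the length of the input. A witness that \<open>X\<close> is wrong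
  is the list of the input registers with content 1; as all jumps are forward, \<open>X\<close> is run in one pass.

  Hardness. Let \<open>V\<close> be a verifier for the complement of \<open>A\<close>. The \<open>n\<close> inputs are first tested for 0
  with three instructions for every two inputs; if all are 0, execution terminates with output 0.
  Otherwise straight-line code simulates \<open>V\<close> on \<open>x\<close> and a witness read from the inputs, and outputs 0
  iff \<open>V\<close> accepts. This computes \<open>tstnz\<close> iff no witness is accepted. The simulation has polynomial
  length independent of \<open>n\<close>, so it fits into the slack \<open>q * n\<close> for a suitable polynomial \<open>n\<close>.

  Polynomial time. Stack programs on four tapes evaluate a small functional language on binary trees,
  whose only recursion is a loop with polynomially bounded data; both the verifier and the reduction
  are written in it.
\<close>

text \<open>The slack \<open>q * n\<close> may be a tiny multiple of \<open>n\<close>, so the zero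
  test may exceed \<open>min_len n\<close> by a constant only. This is why it works at the rate of
  three instructions per two inputs, and why \<open>n\<close> is then made large compared with the
  simulation. Only non-zero inputs reach the simulation. In order that every witness, even the empty
  one, can be offered by a non-zero input, one input register carries no information about the
  witness. Numbers in an instance are binary, numbers of the functional language are unary. The
  verifier therefore keeps register numbers as digit strings and converts only \<open>n\<close> and
  the jump lengths, cut off at the length of \<open>X\<close>: longer jumps lead to inaction, and
  larger \<open>n\<close> cannot belong to a yes-instance. The quantifier over \<open>k\<close> in
  \<open>computes\<close> is harmless on both sides. With \<open>k\<close> above all numbers in
  \<open>X\<close>, the auxiliary registers mentioned in a counterexample are 0; and the code that
  the reduction builds initialises its registers itself.\<close>

lemma poly_nat_mono: "x \<le> y \<Longrightarrow> poly (p :: nat poly) x \<le> poly p y"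
  by (induction p) (auto intro!: add_mono mult_mono)

section \<open>Compiling a small while language to five-tape Turing machines\<close>

section \<open>Structured tape programs\<close>

datatype cmd =
    Skip
  | Act nat "nat option" move
  | Seq cmd cmd
  | If nat "nat list" cmd cmd
  | While nat "nat list" cmd

text \<open>Control decisions take a step of their own without a tape action, so one step acts on at
  most one tape and depends only on the command and the symbols read.\<close>

fun nxt :: "cmd \<Rightarrow> nat list \<Rightarrow> cmd \<times> (nat \<times> nat option \<times> move) option" where
  "nxt Skip ss = (Skip, None)"
| "nxt (Act i w d) ss = (Skip, Some (i, w, d))"
| "nxt (Seq c1 c2) ss =
     (if c1 = Skip then (c2, None) else (case nxt c1 ss of (c, a) \<Rightarrow> (Seq c c2, a)))"
| "nxt (If i L c1 c2) ss = (if ss ! i \<in> set L then c1 else c2, None)"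
| "nxt (While i L c) ss = (if ss ! i \<in> set L then Seq c (While i L c) else Skip, None)"

fun acts :: "(nat \<times> nat option \<times> move) option \<Rightarrow> nat list \<Rightarrow> (nat \<times> move) list" where
  "acts None ss = map (\<lambda>s. (s, Stay)) ss"
| "acts (Some (i, w, d)) ss =
     (map (\<lambda>s. (s, Stay)) ss)[i := (case w of None \<Rightarrow> ss ! i | Some s \<Rightarrow> s, d)]"

fun cstep :: "cmd \<times> tape list \<Rightarrow> cmd \<times> tape list" where
  "cstep (c, ts) = (case nxt c (map read_tape ts) of
     (c', a) \<Rightarrow> (c', map2 act_tape (acts a (map read_tape ts)) ts))"

fun wfc :: "cmd \<Rightarrow> bool" where
  "wfc Skip \<longleftrightarrow> True"
| "wfc (Act i w d) \<longleftrightarrow> (case w of None \<Rightarrow> True | Some s \<Rightarrow> s < 4)"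
| "wfc (Seq c1 c2) \<longleftrightarrow> wfc c1 \<and> wfc c2"
| "wfc (If i L c1 c2) \<longleftrightarrow> wfc c1 \<and> wfc c2"
| "wfc (While i L c) \<longleftrightarrow> wfc c"

text \<open>A finite set closed under \<open>nxt\<close>, in the spirit of the partial derivatives
  of a regular expression; it becomes the state set of the machine.\<close>

fun residuals :: "cmd \<Rightarrow> cmd set" where
  "residuals Skip = {Skip}"
| "residuals (Act i w d) = {Act i w d, Skip}"
| "residuals (Seq c1 c2) = (\<lambda>c. Seq c c2) ` residuals c1 \<union> residuals c2"
| "residuals (If i L c1 c2) = {If i L c1 c2} \<union> residuals c1 \<union> residuals c2"
| "residuals (While i L c) =
     {While i L c, Skip} \<union> (\<lambda>c'. Seq c' (While i L c)) ` residuals c"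

lemma finite_residuals: "finite (residuals c)"
  by (induction c) auto

lemma self_in_residuals: "c \<in> residuals c"
  by (induction c) auto

lemma Skip_in_residuals: "Skip \<in> residuals c"
  by (induction c) auto

lemma residuals_nxt: "r \<in> residuals c \<Longrightarrow> fst (nxt r ss) \<in> residuals c"
proof (induction c arbitrary: r)
  case (Seq c1 c2)
  have "fst (nxt (Seq r' c2) ss) \<in> residuals (Seq c1 c2)" if "r' \<in> residuals c1" for r'
    using Seq.IH(1)[OF that] self_in_residuals[of c2] by (auto split: prod.splits)
  then show ?case using Seq.IH(2) Seq.prems by (auto simp del: nxt.simps)
next
  case (If i L c1 c2)
  then show ?case
    using self_in_residuals[of c1] self_in_residuals[of c2] by auto
next
  case (While i L c)
  have "fst (nxt (Seq r' (While i L c)) ss) \<in> residuals (While i L c)" if "r' \<in> residuals c" for r'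
    using While.IH[OF that] by (auto split: prod.splits)
  then show ?case using While.prems self_in_residuals[of c] by (auto simp del: nxt.simps(3))
qed auto

lemma wfc_residuals: "wfc c \<Longrightarrow> residuals c \<subseteq> Collect wfc"
proof (induction c)
  case (Seq c1 c2)
  then have "residuals c1 \<subseteq> Collect wfc" "residuals c2 \<subseteq> Collect wfc" "wfc c2" by simp_all
  then show ?case by fastforce
next
  case (If i L c1 c2)
  then have "residuals c1 \<subseteq> Collect wfc" "residuals c2 \<subseteq> Collect wfc" by simp_all
  then show ?case using If.prems by fastforce
next
  case (While i L c)
  then have "residuals c \<subseteq> Collect wfc" "wfc c" by simp_all
  then show ?case by fastforce
qed auto

lemma wfc_nxt: "wfc c \<Longrightarrow> nxt c ss = (c', Some (i, w, d)) \<Longrightarrow> case w of None \<Rightarrow> True | Some s \<Rightarrow> s < 4"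
  by (induction c arbitrary: c') (auto split: if_splits prod.splits)

text \<open>The machine model fixes 0 as the initial state and the largest number as the halting
  state. The program and \<open>Skip\<close> thus have to sit at the two ends of the numbering,
  which forces them to be distinct.\<close>

lemma finite_index_ends:
  assumes "finite A" "a \<in> A" "b \<in> A" "a \<noteq> b"
  obtains f :: "'a \<Rightarrow> nat" and N where "inj_on f A" "f a = 0" "f b = N" "\<forall>x \<in> A. f x \<le> N"
proof -
  obtain xs where xs: "set xs = A - {a, b}" "distinct xs"
    using finite_distinct_list[of "A - {a, b}"] assms(1) by auto
  let ?L = "a # xs @ [b]"
  have L: "distinct ?L" "set ?L = A" using xs assms by auto
  have bij: "bij_betw (nth ?L) {..<length ?L} A"
    using bij_betw_nth[OF L(1) refl] L(2) by metis
  let ?f = "inv_into {..<length ?L} (nth ?L)"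
  have bij': "bij_betw ?f A {..<length ?L}" by (rule bij_betw_inv_into[OF bij])
  have inv: "?f (?L ! i) = i" if "i < length ?L" for i
    using inv_into_f_f[of "nth ?L" "{..<length ?L}" i] bij that by (auto simp: bij_betw_def)
  show thesis
  proof
    show "inj_on ?f A" using bij' by (simp add: bij_betw_def)
    show "?f a = 0" using inv[of 0] by (simp only: nth_Cons_0 length_Cons zero_less_Suc)
    have "?L ! (length xs + 1) = b" by (simp add: nth_append)
    then show "?f b = length xs + 1" using inv[of "length xs + 1"]
      by (simp only: length_Cons length_append list.size)
    show "\<forall>x \<in> A. ?f x \<le> length xs + 1"
    proof
      fix x assume "x \<in> A"
      then have "?f x \<in> {..<length ?L}" using bij' by (auto simp: bij_betw_def)
      then show "?f x \<le> length xs + 1"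
        by (simp only: lessThan_iff length_Cons length_append list.size)
    qed
  qed
qed

lemma set_acts:
  assumes "set ss \<subseteq> {..<4}" "case a of None \<Rightarrow> True | Some (i, w, d) \<Rightarrow> (case w of None \<Rightarrow> True | Some s \<Rightarrow> s < 4)"
  shows "fst ` set (acts a ss) \<subseteq> {..<4}"
proof (cases a)
  case None
  then show ?thesis using assms(1) by auto
next
  case (Some iwd)
  obtain i w d where iwd: "iwd = (i, w, d)" by (cases iwd) auto
  show ?thesis
  proof (cases "i < length ss")
    case True
    then have "(case w of None \<Rightarrow> ss ! i | Some s \<Rightarrow> s) < 4"
      using assms Some iwd subsetD[OF assms(1) nth_mem[OF True]] by (auto split: option.splits)
    then show ?thesis
      using assms(1) Some iwd by (auto dest!: subsetD[OF set_update_subset_insert])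
  next
    case False
    then show ?thesis using assms(1) Some iwd by (auto simp: list_update_beyond)
  qed
qed

text \<open>The states of the machine are the residual commands; one machine step is one \<open>cstep\<close>.\<close>

lemma cmd_tm:
  assumes "wfc c" "c \<noteq> Skip"
  obtains M where "wf_tm M" "tm_tapes M = 5"
    "\<And>n ts ts'. (cstep ^^ n) (c, ts) = (Skip, ts') \<Longrightarrow> length ts = 5 \<Longrightarrow>
       (tm_step M ^^ n) (0, ts) = (tm_states M, ts')"
proof -
  obtain f :: "cmd \<Rightarrow> nat" and N where f: "inj_on f (residuals c)" "f c = 0" "f Skip = N"
      "\<forall>x \<in> residuals c. f x \<le> N"
    using finite_index_ends[OF finite_residuals self_in_residuals Skip_in_residuals assms(2)]
    by metis
  define g where "g = inv_into (residuals c) f"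
  have g: "g (f r) = r" if "r \<in> residuals c" for r
    unfolding g_def using that f(1) by (rule inv_into_f_f[rotated])
  \<comment> \<open>Only \<open>f x \<le> N\<close> is known, not that every number up to
    \<open>N\<close> is a value of \<open>f\<close>; the \<open>else\<close> branch keeps the
    machine well formed on the other numbers.\<close>
  define M where "M = \<lparr>tm_tapes = 5, tm_states = N, tm_syms = 4,
    tm_delta = (\<lambda>q ss. if q \<in> f ` residuals c
      then (case nxt (g q) ss of (c', a) \<Rightarrow> (f c', acts a ss)) else (0, map (\<lambda>s. (s, Stay)) ss))\<rparr>"
  have len: "length (acts a ss) = length ss" for a ss
    by (cases "(a, ss)" rule: acts.cases) auto
  have "wf_tm M"
    unfolding wf_tm_def
  proof (intro conjI allI impI)
    fix q ss assume q: "q < tm_states M \<and> length ss = tm_tapes M \<and> set ss \<subseteq> {..<tm_syms M}"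
    show "case tm_delta M q ss of (st', as) \<Rightarrow>
       st' \<le> tm_states M \<and> length as = tm_tapes M \<and> fst ` set as \<subseteq> {..<tm_syms M}"
    proof (cases "q \<in> f ` residuals c")
      case True
      then obtain r where r: "r \<in> residuals c" "q = f r" by auto
      obtain c' a where ca: "nxt r ss = (c', a)" by (cases "nxt r ss")
      have "c' \<in> residuals c" using residuals_nxt[OF r(1), of ss] ca by simp
      moreover have "case a of None \<Rightarrow> True | Some (i, w, d) \<Rightarrow> (case w of None \<Rightarrow> True | Some s \<Rightarrow> s < 4)"
        using wfc_nxt[OF CollectD[OF subsetD[OF wfc_residuals[OF assms(1)] r(1)]]] ca by (cases a) auto
      ultimately show ?thesis
        using q True r ca f(4) set_acts[of ss a] by (auto simp: M_def g len)
    next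
      case False
      then show ?thesis using q by (auto simp: M_def)
    qed
  qed (auto simp: M_def)
  have step: "tm_step M (f r, ts) = (f r', ts')"
    if "cstep (r, ts) = (r', ts')" "r \<in> residuals c" "length ts = 5" for r r' ts ts'
  proof (cases "f r < N")
    case True
    then show ?thesis using that by (auto simp: M_def g split: prod.splits)
  next
    \<comment> \<open>The number \<open>N\<close> belongs to \<open>Skip\<close> alone, and
      \<open>cstep\<close> idles on \<open>Skip\<close> just as the machine does in its halting
      state.\<close>
    case False
    then have "f r = f Skip" using f(3,4) that(2) by (metis le_neq_implies_less)
    then have "r = Skip" using f(1) that(2) Skip_in_residuals by (metis inj_onD)
    moreover have "map2 act_tape (map (\<lambda>s. (s, Stay)) (map read_tape ts)) ts = ts" for ts
      by (induction ts) (auto simp: read_tape_def)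
    ultimately show ?thesis using that by (auto simp: M_def f)
  qed
  have main: "(tm_step M ^^ n) (f r, ts) = (f r', ts') \<and> r' \<in> residuals c \<and> length ts' = 5"
    if "(cstep ^^ n) (r, ts) = (r', ts')" "r \<in> residuals c" "length ts = 5" for n r r' ts ts'
    using that
  proof (induction n arbitrary: r' ts')
    case (Suc n)
    obtain r1 ts1 where 1: "(cstep ^^ n) (r, ts) = (r1, ts1)" by fastforce
    then have 2: "cstep (r1, ts1) = (r', ts')" using Suc.prems(1) by simp
    note IH = Suc.IH[OF 1 Suc.prems(2,3)]
    have "r' \<in> residuals c" using residuals_nxt[of r1 c "map read_tape ts1"] 2 IH
      by (auto split: prod.splits)
    moreover have "length ts' = 5" using 2 IH by (auto simp: len split: prod.splits)
    ultimately show ?case using step[OF 2] IH by simp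
  qed simp
  show thesis
  proof
    show "wf_tm M" by fact
    show "tm_tapes M = 5" by (simp add: M_def)
    show "(tm_step M ^^ n) (0, ts) = (tm_states M, ts')"
      if "(cstep ^^ n) (c, ts) = (Skip, ts')" "length ts = 5" for n ts ts'
      using main[OF that(1) self_in_residuals that(2)] f by (simp add: M_def)
  qed
qed

definition runs :: "cmd \<Rightarrow> tape list \<Rightarrow> nat \<Rightarrow> tape list \<Rightarrow> bool" where
  "runs c ts n ts' \<longleftrightarrow> (cstep ^^ n) (c, ts) = (Skip, ts')"

lemma map2_acts_None: "map2 act_tape (acts None (map read_tape ts)) ts = ts"
  by (induction ts) (auto simp: read_tape_def)

lemma act_tape_Stay: "act_tape (read_tape t, Stay) t = t"
  by (cases t) (auto simp: read_tape_def)

lemma map2_acts_Some: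
  assumes "i < length ts"
  shows "map2 act_tape (acts (Some (i, w, d)) (map read_tape ts)) ts =
    ts[i := act_tape (case w of None \<Rightarrow> read_tape (ts ! i) | Some s \<Rightarrow> s, d) (ts ! i)]"
  using assms by (intro nth_equalityI) (auto simp: nth_list_update act_tape_Stay split: option.split)

lemma runs_Skip: "runs Skip ts 0 ts"
  by (simp add: runs_def)

lemma runs_Act: "i < length ts \<Longrightarrow> runs (Act i w d) ts 1
    (ts[i := act_tape (case w of None \<Rightarrow> read_tape (ts ! i) | Some s \<Rightarrow> s, d) (ts ! i)])"
  using map2_acts_Some[of i ts w d] by (simp add: runs_def del: acts.simps)

lemma runs_step:
  assumes "cstep (c, ts) = (c', ts1)" "runs c' ts1 n ts'"
  shows "runs c ts (Suc n) ts'"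
  using assms by (simp add: runs_def funpow_Suc_right del: funpow.simps cstep.simps)

text \<open>The extra 1 is the control step that discards a finished \<open>Skip\<close>. The bound
  is an inequality because \<open>n1\<close> may include idle steps on \<open>Skip\<close>, which
  the sequence does not make.\<close>

lemma runs_Seq:
  assumes "runs c1 ts n1 ts1" "runs c2 ts1 n2 ts2"
  shows "\<exists>m \<le> n1 + n2 + 1. runs (Seq c1 c2) ts m ts2"
  using assms(1)
proof (induction n1 arbitrary: c1 ts)
  case 0
  then have "cstep (Seq c1 c2, ts) = (c2, ts1)"
    using map2_acts_None[of ts] by (simp add: runs_def del: acts.simps)
  from runs_step[OF this assms(2)] show ?case by (intro exI[of _ "Suc n2"]) simp
next
  case (Suc n)
  show ?case
  proof (cases "c1 = Skip")
    case True
    have skip: "cstep (Skip, ts) = (Skip, ts)" using map2_acts_None[of ts] by (simp del: acts.simps)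
    have "(cstep ^^ n) (Skip, ts) = (Skip, ts)" for n
      by (induction n) (use skip in \<open>simp_all del: cstep.simps\<close>)
    then have "ts1 = ts" using Suc.prems True by (simp add: runs_def del: funpow.simps cstep.simps)
    then have "cstep (Seq c1 c2, ts) = (c2, ts1)"
      using map2_acts_None[of ts] True by (simp del: acts.simps)
    from runs_step[OF this assms(2)] show ?thesis by (intro exI[of _ "Suc n2"]) simp
  next
    case False
    obtain c1' ts' where 1: "cstep (c1, ts) = (c1', ts')" by fastforce
    then have "runs c1' ts' n ts1"
      using Suc.prems by (simp add: runs_def funpow_Suc_right del: funpow.simps cstep.simps)
    from Suc.IH[OF this] obtain m where m: "m \<le> n + n2 + 1" "runs (Seq c1' c2) ts' m ts2" by blast
    have "cstep (Seq c1 c2, ts) = (Seq c1' c2, ts')"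
      using 1 False by (auto split: prod.splits)
    from runs_step[OF this m(2)] m(1) show ?thesis by (intro exI[of _ "Suc m"]) simp
  qed
qed

lemma runs_If:
  assumes "i < length ts" "runs (if read_tape (ts ! i) \<in> set L then c1 else c2) ts n ts'"
  shows "runs (If i L c1 c2) ts (Suc n) ts'"
  using assms map2_acts_None[of ts] by (intro runs_step[OF _ assms(2)]) (simp del: acts.simps)

lemma runs_While:
  assumes "i < length ts"
    "runs (if read_tape (ts ! i) \<in> set L then Seq c (While i L c) else Skip) ts n ts'"
  shows "runs (While i L c) ts (Suc n) ts'"
  using assms map2_acts_None[of ts] by (intro runs_step[OF _ assms(2)]) (simp del: acts.simps)

section \<open>The memory model: four work stacks and one write-once output tape\<close>

section \<open>Stacks on tapes\<close>

text \<open>A stack extends to the right from the head, which is on its top, and ends with a blank.\<close>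

definition stk :: "tape \<Rightarrow> nat list \<Rightarrow> bool" where
  "stk t xs \<longleftrightarrow> (\<forall>i < length xs. fst t (snd t + int i) = xs ! i) \<and> fst t (snd t + int (length xs)) = 0"

text \<open>Popped symbols stay on a stack tape as garbage left of the head. The output has to start
  at cell 0 and to end at a blank, so it gets a tape of its own that is written from left to right
  and is blank elsewhere.\<close>

definition out_tape :: "tape \<Rightarrow> nat list \<Rightarrow> bool" where
  "out_tape t xs \<longleftrightarrow> snd t = int (length xs) \<and>
     (\<forall>i. fst t i = (if 0 \<le> i \<and> i < int (length xs) then xs ! nat i else 0))"

type_synonym stacks = "nat list list"

definition rep :: "tape list \<Rightarrow> stacks \<Rightarrow> bool" where
  "rep ts S \<longleftrightarrow> length ts = 5 \<and> length S = 5 \<and> (\<forall>i<4. stk (ts ! i) (S ! i)) \<and> out_tape (ts ! 4) (S ! 4)"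

text \<open>Quantifying over all tapes that represent \<open>S\<close> hides the garbage outside the
  stacks. The step count is only an upper bound, so it can be weakened freely.\<close>

definition runS :: "cmd \<Rightarrow> stacks \<Rightarrow> nat \<Rightarrow> stacks \<Rightarrow> bool" where
  "runS c S n S' \<longleftrightarrow> (\<forall>ts. rep ts S \<longrightarrow> (\<exists>m \<le> n. \<exists>ts'. runs c ts m ts' \<and> rep ts' S'))"

definition top_sym :: "nat list \<Rightarrow> nat" where
  "top_sym xs = (case xs of [] \<Rightarrow> 0 | x # _ \<Rightarrow> x)"

lemma top_sym_simps [simp]: "top_sym [] = 0" "top_sym (x # xs) = x"
  by (simp_all add: top_sym_def)

lemma stk_top: "stk t xs \<Longrightarrow> read_tape t = top_sym xs"
  by (cases xs) (auto simp: stk_def read_tape_def)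

lemma stk_push:
  assumes "stk (c, h) xs"
  shows "stk (c(h - 1 := s), h - 1) (s # xs)"
  using assms by (auto simp: stk_def nth_Cons split: nat.splits)

lemma stk_pop:
  assumes "stk (c, h) (x # xs)"
  shows "stk (c, h + 1) xs"
proof -
  have *: "fst (c, h) (h + int (Suc i)) = (x # xs) ! Suc i" if "i < length xs" for i
    using assms that unfolding stk_def by (metis Suc_less_eq length_Cons snd_conv)
  show ?thesis using assms * by (auto simp: stk_def algebra_simps)
qed

lemma runS_mono: "runS c S n S' \<Longrightarrow> n \<le> n' \<Longrightarrow> runS c S n' S'"
  unfolding runS_def by (meson order_trans)

lemma runS_Skip: "runS Skip S 0 S"
  unfolding runS_def using runs_Skip by blast

lemma runS_Seq:
  assumes "runS c1 S n1 S1" "runS c2 S1 n2 S2"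
  shows "runS (Seq c1 c2) S (n1 + n2 + 1) S2"
  unfolding runS_def
proof (intro allI impI)
  fix ts assume "rep ts S"
  with assms(1) obtain m1 ts1 where 1: "m1 \<le> n1" "runs c1 ts m1 ts1" "rep ts1 S1"
    unfolding runS_def by blast
  with assms(2) obtain m2 ts2 where 2: "m2 \<le> n2" "runs c2 ts1 m2 ts2" "rep ts2 S2"
    unfolding runS_def by blast
  from runs_Seq[OF 1(2) 2(2)] obtain m where "m \<le> m1 + m2 + 1" "runs (Seq c1 c2) ts m ts2" by blast
  with 1(1) 2(1,3) show "\<exists>m \<le> n1 + n2 + 1. \<exists>ts'. runs (Seq c1 c2) ts m ts' \<and> rep ts' S2"
    by (intro exI[of _ m]) (auto intro!: exI[of _ ts2])
qed

lemma runS_If: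
  assumes "i < 4" "runS (if top_sym (S ! i) \<in> set L then c1 else c2) S n S'"
  shows "runS (If i L c1 c2) S (Suc n) S'"
  unfolding runS_def
proof (intro allI impI)
  fix ts assume ts: "rep ts S"
  with assms(2) obtain m ts' where m: "m \<le> n"
      "runs (if top_sym (S ! i) \<in> set L then c1 else c2) ts m ts'" "rep ts' S'"
    unfolding runS_def by blast
  moreover have "read_tape (ts ! i) = top_sym (S ! i)"
    using ts assms(1) stk_top by (auto simp: rep_def)
  ultimately have "runs (If i L c1 c2) ts (Suc m) ts'"
    using runs_If[of i ts L c1 c2 m ts'] ts assms(1) by (simp add: rep_def)
  with m show "\<exists>m \<le> Suc n. \<exists>ts'. runs (If i L c1 c2) ts m ts' \<and> rep ts' S'" by blast
qed

lemma runS_While: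
  assumes "i < 4" "runS (if top_sym (S ! i) \<in> set L then Seq c (While i L c) else Skip) S n S'"
  shows "runS (While i L c) S (Suc n) S'"
  unfolding runS_def
proof (intro allI impI)
  fix ts assume ts: "rep ts S"
  with assms(2) obtain m ts' where m: "m \<le> n"
      "runs (if top_sym (S ! i) \<in> set L then Seq c (While i L c) else Skip) ts m ts'" "rep ts' S'"
    unfolding runS_def by blast
  moreover have "read_tape (ts ! i) = top_sym (S ! i)"
    using ts assms(1) stk_top by (auto simp: rep_def)
  ultimately have "runs (While i L c) ts (Suc m) ts'"
    using runs_While[of i ts L c m ts'] ts assms(1) by (simp add: rep_def)
  with m show "\<exists>m \<le> Suc n. \<exists>ts'. runs (While i L c) ts m ts' \<and> rep ts' S'" by blast
qed

lemma runS_While_end: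
  assumes "i < 4" "top_sym (S ! i) \<notin> set L"
  shows "runS (While i L c) S 1 S"
  using runS_While[OF assms(1), of S L c 0 S] assms(2) runS_Skip by simp

lemma runS_While_step:
  assumes "i < 4" "top_sym (S ! i) \<in> set L" "runS c S n S1" "runS (While i L c) S1 m S2"
  shows "runS (While i L c) S (n + m + 2) S2"
  using runS_While[OF assms(1), of S L c "n + m + 1" S2] runS_Seq[OF assms(3,4)] assms(2) by simp

definition Push :: "nat \<Rightarrow> nat \<Rightarrow> cmd" where
  "Push i s = Seq (Act i None MoveLeft) (Act i (Some s) Stay)"

definition Pop :: "nat \<Rightarrow> cmd" where
  "Pop i = Act i None MoveRight"

definition Emit :: "nat \<Rightarrow> cmd" where
  "Emit s = Act 4 (Some s) MoveRight"

lemma wfc_prims [simp]: "wfc (Push i s) \<longleftrightarrow> s < 4" "wfc (Pop i)" "wfc (Emit s) \<longleftrightarrow> s < 4"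
  by (simp_all add: Push_def Pop_def Emit_def)

lemma runS_Push:
  assumes "i < 4"
  shows "runS (Push i s) S 3 (S[i := s # S ! i])"
  unfolding runS_def
proof (intro allI impI)
  fix ts assume ts: "rep ts S"
  obtain c h where ch: "ts ! i = (c, h)" by fastforce
  let ?t1 = "ts[i := (c, h - 1)]" and ?t2 = "ts[i := (c(h - 1 := s), h - 1)]"
  have 1: "runs (Act i None MoveLeft) ts 1 ?t1"
    using runs_Act[of i ts None MoveLeft] ts assms ch by (auto simp: rep_def read_tape_def)
  have 2: "runs (Act i (Some s) Stay) ?t1 1 ?t2"
    using runs_Act[of i ?t1 "Some s" Stay] ts assms ch by (auto simp: rep_def)
  have "stk (c, h) (S ! i)" using ts assms ch by (auto simp: rep_def dest: spec[of _ i])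
  then have "rep ?t2 (S[i := s # S ! i])"
    using ts assms stk_push[of c h "S ! i" s] by (auto simp: rep_def nth_list_update)
  moreover obtain m where "m \<le> 1 + 1 + 1" "runs (Push i s) ts m ?t2"
    using runs_Seq[OF 1 2] unfolding Push_def by blast
  ultimately show "\<exists>m \<le> 3. \<exists>ts'. runs (Push i s) ts m ts' \<and> rep ts' (S[i := s # S ! i])"
    by (intro exI[of _ m]) auto
qed

lemma runS_Pop:
  assumes "i < 4" "S ! i = x # xs"
  shows "runS (Pop i) S 1 (S[i := xs])"
  unfolding runS_def
proof (intro allI impI)
  fix ts assume ts: "rep ts S"
  obtain c h where ch: "ts ! i = (c, h)" by fastforce
  have 1: "runs (Pop i) ts 1 (ts[i := (c, h + 1)])"
    using runs_Act[of i ts None MoveRight] ts assms ch by (auto simp: rep_def read_tape_def Pop_def)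
  have "stk (c, h) (x # xs)" using ts assms ch by (auto simp: rep_def dest: spec[of _ i])
  then have "rep (ts[i := (c, h + 1)]) (S[i := xs])"
    using ts assms stk_pop[of c h x xs] by (auto simp: rep_def nth_list_update)
  with 1 show "\<exists>m \<le> 1. \<exists>ts'. runs (Pop i) ts m ts' \<and> rep ts' (S[i := xs])" by blast
qed

lemma runS_Emit: "runS (Emit s) S 1 (S[4 := S ! 4 @ [s]])"
  unfolding runS_def
proof (intro allI impI)
  fix ts assume ts: "rep ts S"
  obtain c h where ch: "ts ! 4 = (c, h)" by fastforce
  have 1: "runs (Emit s) ts 1 (ts[4 := (c(h := s), h + 1)])"
    using runs_Act[of 4 ts "Some s" MoveRight] ts ch by (auto simp: rep_def Emit_def)
  have "out_tape (c, h) (S ! 4)" using ts ch by (auto simp: rep_def)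
  then have "out_tape (c(h := s), h + 1) (S ! 4 @ [s])"
    by (auto simp: out_tape_def nth_append)
  then have "rep (ts[4 := (c(h := s), h + 1)]) (S[4 := S ! 4 @ [s]])"
    using ts by (auto simp: rep_def nth_list_update)
  with 1 show "\<exists>m \<le> 1. \<exists>ts'. runs (Emit s) ts m ts' \<and> rep ts' (S[4 := S ! 4 @ [s]])" by blast
qed

section \<open>Skipping, copying and moving serialized trees\<close>

section \<open>Trees on stacks\<close>

declare One_nat_def [simp del]

lemma runS_prims:
  "runS (Push 0 s) [a, b, c, d, e] 3 [s # a, b, c, d, e]"
  "runS (Push 1 s) [a, b, c, d, e] 3 [a, s # b, c, d, e]"
  "runS (Push 2 s) [a, b, c, d, e] 3 [a, b, s # c, d, e]"
  "runS (Push 3 s) [a, b, c, d, e] 3 [a, b, c, s # d, e]"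
  "runS (Pop 0) [s # a, b, c, d, e] 1 [a, b, c, d, e]"
  "runS (Pop 1) [a, s # b, c, d, e] 1 [a, b, c, d, e]"
  "runS (Pop 2) [a, b, s # c, d, e] 1 [a, b, c, d, e]"
  "runS (Pop 3) [a, b, c, s # d, e] 1 [a, b, c, d, e]"
  "runS (Emit s) [a, b, c, d, e] 1 [a, b, c, d, e @ [s]]"
  using runS_Push[of 0 s "[a, b, c, d, e]"] runS_Push[of 1 s "[a, b, c, d, e]"]
    runS_Push[of 2 s "[a, b, c, d, e]"] runS_Push[of 3 s "[a, b, c, d, e]"]
    runS_Pop[of 0 "[s # a, b, c, d, e]" s a] runS_Pop[of 1 "[a, s # b, c, d, e]" s b]
    runS_Pop[of 2 "[a, b, s # c, d, e]" s c] runS_Pop[of 3 "[a, b, c, s # d, e]" s d]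
    runS_Emit[of s "[a, b, c, d, e]"]
  by (simp_all add: numeral_eq_Suc One_nat_def)

lemmas runS_straight = runS_Seq runS_prims runS_Skip

lemma runS_If_True:
  "i < 4 \<Longrightarrow> top_sym (S ! i) \<in> set L \<Longrightarrow> runS c1 S n S' \<Longrightarrow> runS (If i L c1 c2) S (Suc n) S'"
  by (rule runS_If) simp_all

lemma runS_If_False:
  "i < 4 \<Longrightarrow> top_sym (S ! i) \<notin> set L \<Longrightarrow> runS c2 S n S' \<Longrightarrow> runS (If i L c1 c2) S (Suc n) S'"
  by (rule runS_If) simp_all

datatype tree = Lf | Nd tree tree

text \<open>Preorder code. It is self-delimiting, so a tree on top of a stack needs no end mark; the
  symbols 0 (blank) and 3 (marker on the auxiliary stacks) stay free.\<close>

fun ser :: "tree \<Rightarrow> nat list" where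
  "ser Lf = [1]"
| "ser (Nd l r) = 2 # ser l @ ser r"

lemma set_ser: "set (ser t) \<subseteq> {1, 2}"
  by (induction t) auto

lemma length_ser_pos: "length (ser t) \<ge> 1"
  by (induction t) auto

definition wr :: "bool \<Rightarrow> bool \<Rightarrow> nat \<Rightarrow> cmd" where
  "wr p q s = Seq (if p then Push 1 s else Skip) (if q then Push 2 s else Skip)"

definition app_rev :: "bool \<Rightarrow> nat list \<Rightarrow> nat list \<Rightarrow> nat list" where
  "app_rev p xs a = (if p then rev xs @ a else a)"

lemma runS_wr: "runS (wr p q s) [d, a, b, c, e] 7 [d, app_rev p [s] a, app_rev q [s] b, c, e]"
  unfolding wr_def app_rev_def
  by (cases p; cases q; simp only: if_True if_False rev.simps append.simps;
      rule runS_mono, (rule runS_straight)+, simp)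

text \<open>Parsing by counting: reading a 2 replaces one pending tree by two, reading a 1 completes
  one. The counter is a unary block of 2s on stack 3 above a 1 that stops the loop.\<close>

definition skim_loop :: "bool \<Rightarrow> bool \<Rightarrow> cmd" where
  "skim_loop p q = While 3 [2] (If 0 [2]
     (Seq (Pop 0) (Seq (wr p q 2) (Push 3 2))) (Seq (Pop 0) (Seq (wr p q 1) (Pop 3))))"

text \<open>Stack 3 counts the trees that are still to be read.\<close>

lemma skim_loop_tree:
  assumes "runS (skim_loop p q) [r, app_rev p (ser t) a, app_rev q (ser t) b, c, e] n S"
  shows "runS (skim_loop p q) [ser t @ r, a, b, 2 # c, e] (n + 20 * length (ser t)) S"
  using assms
\<comment> \<open>The hypothesis is the run of the loop from the situation behind the tree. In this
  continuation form, the run on the right subtree serves as the continuation of the run on the left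
  one.\<close>
proof (induction t arbitrary: r a b c n)
  case Lf
  have "runS (If 0 [2] (Seq (Pop 0) (Seq (wr p q 2) (Push 3 2))) (Seq (Pop 0) (Seq (wr p q 1) (Pop 3))))
     [1 # r, a, b, 2 # c, e] 14 [r, app_rev p [1] a, app_rev q [1] b, c, e]"
    by (rule runS_mono, rule runS_If_False, simp, simp, (rule runS_straight runS_wr)+, simp)
  from runS_While_step[of 3 _ "[2]", OF _ _ this Lf[unfolded skim_loop_def ser.simps]]
  show ?case by (auto simp: skim_loop_def intro: runS_mono)
next
  case (Nd l u)
  have 1: "runS (If 0 [2] (Seq (Pop 0) (Seq (wr p q 2) (Push 3 2))) (Seq (Pop 0) (Seq (wr p q 1) (Pop 3))))
     [2 # ser l @ ser u @ r, a, b, 2 # c, e] 16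
     [ser l @ ser u @ r, app_rev p [2] a, app_rev q [2] b, 2 # 2 # c, e]"
    by (rule runS_mono, rule runS_If_True, simp, simp, (rule runS_straight runS_wr)+, simp)
  have "runS (skim_loop p q) [r, app_rev p (ser u) (app_rev p (ser l) (app_rev p [2] a)),
     app_rev q (ser u) (app_rev q (ser l) (app_rev q [2] b)), c, e] n S"
    using Nd.prems by (simp add: app_rev_def split: if_splits)
  from Nd.IH(1)[OF Nd.IH(2)[OF this]]
  have 2: "runS (skim_loop p q) [ser l @ ser u @ r, app_rev p [2] a, app_rev q [2] b, 2 # 2 # c, e]
     (n + 20 * length (ser u) + 20 * length (ser l)) S" by simp
  from runS_While_step[of 3 _ "[2]", OF _ _ 1 2[unfolded skim_loop_def]]
  show ?case by (auto simp: skim_loop_def intro: runS_mono)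
qed

definition skim :: "bool \<Rightarrow> bool \<Rightarrow> cmd" where
  "skim p q = Seq (Push 3 1) (Seq (Push 3 2) (Seq (skim_loop p q) (Pop 3)))"

lemma runS_skim: "runS (skim p q) [ser t @ r, a, b, c, e] (40 * length (ser t))
    [r, app_rev p (ser t) a, app_rev q (ser t) b, c, e]"
proof -
  have "runS (skim_loop p q) [r, app_rev p (ser t) a, app_rev q (ser t) b, 1 # c, e] 1
     [r, app_rev p (ser t) a, app_rev q (ser t) b, 1 # c, e]"
    unfolding skim_loop_def by (rule runS_While_end) auto
  note 1 = skim_loop_tree[OF this]
  show ?thesis
    unfolding skim_def
    by (rule runS_mono, rule runS_Seq, rule runS_prims, rule runS_Seq, rule runS_prims, rule runS_Seq,
      rule 1, rule runS_prims, use length_ser_pos[of t] in simp)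
qed

text \<open>Copying a tree to another stack reverses its code, and moving it back restores the
  order. The marker 3 separates it from what already lay there.\<close>

definition unstash :: "nat \<Rightarrow> cmd" where
  "unstash i = Seq (While i [1, 2] (If i [1] (Seq (Pop i) (Push 0 1)) (Seq (Pop i) (Push 0 2)))) (Pop i)"

lemma runS_unstash1:
  assumes "set xs \<subseteq> {1, 2}"
  shows "runS (unstash 1) [r, rev xs @ 3 # a, b, c, e] (10 * length xs + 10) [xs @ r, a, b, c, e]"
proof -
  let ?W = "While 1 [1, 2] (If 1 [1] (Seq (Pop 1) (Push 0 1)) (Seq (Pop 1) (Push 0 2)))"
  have "set xs \<subseteq> {1, 2} \<Longrightarrow>
    runS ?W [r, xs @ 3 # a, b, c, e] (10 * length xs + 1) [rev xs @ r, 3 # a, b, c, e]" for xs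
  proof (induction xs arbitrary: r)
    case Nil
    then show ?case by (auto intro: runS_mono[OF runS_While_end])
  next
    case (Cons x xs)
    have "runS (If 1 [1] (Seq (Pop 1) (Push 0 1)) (Seq (Pop 1) (Push 0 2)))
       [r, 1 # xs @ 3 # a, b, c, e] 6 [1 # r, xs @ 3 # a, b, c, e]"
      by (rule runS_mono, rule runS_If_True, simp, simp, (rule runS_straight)+, simp)
    moreover have "runS (If 1 [1] (Seq (Pop 1) (Push 0 1)) (Seq (Pop 1) (Push 0 2)))
       [r, 2 # xs @ 3 # a, b, c, e] 6 [2 # r, xs @ 3 # a, b, c, e]"
      by (rule runS_mono, rule runS_If_False, simp, simp, (rule runS_straight)+, simp)
    ultimately have "runS (If 1 [1] (Seq (Pop 1) (Push 0 1)) (Seq (Pop 1) (Push 0 2)))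
       [r, x # xs @ 3 # a, b, c, e] 6 [x # r, xs @ 3 # a, b, c, e]"
      using Cons.prems by auto
    from runS_While_step[of 1 _ "[1, 2]", OF _ _ this Cons.IH] Cons.prems
    show ?case by (auto intro: runS_mono)
  qed
  from this[of "rev xs"] assms have 1: "runS ?W [r, rev xs @ 3 # a, b, c, e] (10 * length xs + 1) [xs @ r, 3 # a, b, c, e]"
    by simp
  show ?thesis unfolding unstash_def by (rule runS_mono, rule runS_Seq, rule 1, rule runS_prims, simp)
qed

lemma runS_unstash2:
  assumes "set xs \<subseteq> {1, 2}"
  shows "runS (unstash 2) [r, a, rev xs @ 3 # b, c, e] (10 * length xs + 10) [xs @ r, a, b, c, e]"
proof -
  let ?W = "While 2 [1, 2] (If 2 [1] (Seq (Pop 2) (Push 0 1)) (Seq (Pop 2) (Push 0 2)))"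
  have "set xs \<subseteq> {1, 2} \<Longrightarrow>
    runS ?W [r, a, xs @ 3 # b, c, e] (10 * length xs + 1) [rev xs @ r, a, 3 # b, c, e]" for xs
  proof (induction xs arbitrary: r)
    case Nil
    then show ?case by (auto intro: runS_mono[OF runS_While_end])
  next
    case (Cons x xs)
    have "runS (If 2 [1] (Seq (Pop 2) (Push 0 1)) (Seq (Pop 2) (Push 0 2)))
       [r, a, 1 # xs @ 3 # b, c, e] 6 [1 # r, a, xs @ 3 # b, c, e]"
      by (rule runS_mono, rule runS_If_True, simp, simp, (rule runS_straight)+, simp)
    moreover have "runS (If 2 [1] (Seq (Pop 2) (Push 0 1)) (Seq (Pop 2) (Push 0 2)))
       [r, a, 2 # xs @ 3 # b, c, e] 6 [2 # r, a, xs @ 3 # b, c, e]"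
      by (rule runS_mono, rule runS_If_False, simp, simp, (rule runS_straight)+, simp)
    ultimately have "runS (If 2 [1] (Seq (Pop 2) (Push 0 1)) (Seq (Pop 2) (Push 0 2)))
       [r, a, x # xs @ 3 # b, c, e] 6 [x # r, a, xs @ 3 # b, c, e]"
      using Cons.prems by auto
    from runS_While_step[of 2 _ "[1, 2]", OF _ _ this Cons.IH] Cons.prems
    show ?case by (auto intro: runS_mono)
  qed
  from this[of "rev xs"] assms have 1: "runS ?W [r, a, rev xs @ 3 # b, c, e] (10 * length xs + 1) [xs @ r, a, 3 # b, c, e]"
    by simp
  show ?thesis unfolding unstash_def by (rule runS_mono, rule runS_Seq, rule 1, rule runS_prims, simp)
qed

definition dup :: cmd where
  "dup = Seq (Push 1 3) (Seq (Push 2 3) (Seq (skim True True) (Seq (unstash 1) (unstash 2))))"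

lemma runS_dup: "runS dup [ser t @ r, a, b, c, e] (100 * length (ser t)) [ser t @ ser t @ r, a, b, c, e]"
proof -
  note s = runS_skim[of True True t r "3 # a" "3 # b" c e, unfolded app_rev_def if_True]
  show ?thesis
    unfolding dup_def
    by (rule runS_mono, rule runS_Seq, rule runS_prims, rule runS_Seq, rule runS_prims, rule runS_Seq,
        rule s, rule runS_Seq, rule runS_unstash1, rule set_ser, rule runS_unstash2, rule set_ser)
      (use length_ser_pos[of t] in simp)
qed

definition drop_tree :: cmd where "drop_tree = skim False False"

lemma runS_drop: "runS drop_tree [ser t @ r, a, b, c, e] (40 * length (ser t)) [r, a, b, c, e]"
  using runS_skim[of False False t r a b c e] by (simp add: app_rev_def drop_tree_def)

definition stash :: cmd where "stash = Seq (Push 1 3) (skim True False)"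

lemma runS_stash:
  "runS stash [ser t @ r, a, b, c, e] (50 * length (ser t)) [r, rev (ser t) @ 3 # a, b, c, e]"
proof -
  note s = runS_skim[of True False t r "3 # a" b c e, unfolded app_rev_def if_True if_False]
  show ?thesis
    unfolding stash_def
    by (rule runS_mono, rule runS_Seq, rule runS_prims, rule s) (use length_ser_pos[of t] in simp)
qed

lemma wfc_tree_cmds [simp]: "wfc (skim p q)" "wfc (unstash i)" "wfc dup" "wfc drop_tree" "wfc stash"
  by (simp_all add: skim_def skim_loop_def wr_def unstash_def dup_def drop_tree_def stash_def)

section \<open>A calling convention, with pairing, branching and bounded iteration as
  combinators\<close>

section \<open>Polynomial-time functions on encodable types\<close>

class enc =
  fixes enc :: "'a \<Rightarrow> tree"

instantiation unit :: enc begin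
definition "enc_unit (u :: unit) = Lf"
instance ..
end

instantiation bool :: enc begin
definition "enc_bool b = (if b then Nd Lf Lf else Lf)"
instance ..
end

text \<open>Unary, so that the size of a number is proportional to its value.\<close>

instantiation nat :: enc begin
primrec enc_nat :: "nat \<Rightarrow> tree" where
  "enc_nat 0 = Lf"
| "enc_nat (Suc n) = Nd Lf (enc_nat n)"
instance ..
end

instantiation prod :: (enc, enc) enc begin
definition "enc_prod p = Nd (enc (fst p)) (enc (snd p))"
instance ..
end

instantiation list :: (enc) enc begin
primrec enc_list :: "'a list \<Rightarrow> tree" where
  "enc_list [] = Lf"
| "enc_list (x # xs) = Nd (enc x) (enc_list xs)"
instance ..
end

definition sz :: "'a::enc \<Rightarrow> nat" where
  "sz x = length (ser (enc x))"

lemma sz_simps [simp]: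
  "sz (u :: unit) = 1"
  "sz (b :: bool) = (if b then 3 else 1)"
  "sz (a, c) = 1 + sz a + sz c"
  "sz [] = 1"
  "sz (x # xs) = 1 + sz x + sz xs"
  by (simp_all add: sz_def enc_unit_def enc_bool_def enc_prod_def One_nat_def)

lemma sz_nat [simp]: "sz (n :: nat) = 2 * n + 1"
  by (induction n) (simp_all add: sz_def)

text \<open>A calling convention: argument and result lie on top of stack 0, and all else is left as
  found. The polynomial also bounds the size of the result, since the time of a program that runs
  afterwards depends on it.\<close>

definition impl :: "cmd \<Rightarrow> nat poly \<Rightarrow> ('a::enc \<Rightarrow> 'b::enc) \<Rightarrow> bool" where
  "impl c p f \<longleftrightarrow> wfc c \<and> (\<forall>x. sz (f x) \<le> poly p (sz x) \<and>
     (\<forall>r a b d e. runS c [ser (enc x) @ r, a, b, d, e] (poly p (sz x)) [ser (enc (f x)) @ r, a, b, d, e]))"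

definition pt :: "('a::enc \<Rightarrow> 'b::enc) \<Rightarrow> bool" where
  "pt f \<longleftrightarrow> (\<exists>c p. impl c p f)"

lemma implI:
  assumes "wfc c" "\<And>x. sz (f x) \<le> poly p (sz x)"
    "\<And>x r a b d e. runS c [ser (enc x) @ r, a, b, d, e] (poly p (sz x)) [ser (enc (f x)) @ r, a, b, d, e]"
  shows "pt f"
  using assms unfolding pt_def impl_def by blast

text \<open>Programs see only tree codes, so functions with equal codes share a program.
  Constructors come for free in this way: \<open>Cons\<close> is pairing, and \<open>Suc\<close> is
  pairing with a unit.\<close>

lemma pt_recast:
  fixes f :: "'a::enc \<Rightarrow> 'b::enc" and g :: "'a \<Rightarrow> 'c::enc"
  assumes "pt g" "\<And>x. enc (f x) = enc (g x)"
  shows "pt f"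
  using assms by (simp add: pt_def impl_def sz_def)

lemma pt_id: "pt (\<lambda>x. x)"
  by (rule implI[of Skip _ "[:0, 1:]"]) (auto intro: runS_mono[OF runS_Skip])

lemma pt_comp:
  assumes "pt f" "pt g"
  shows "pt (\<lambda>x. f (g x))"
proof -
  from assms obtain c1 p1 c2 p2 where 1: "impl c1 p1 g" and 2: "impl c2 p2 f" unfolding pt_def by blast
  have le: "poly p2 (sz (g x)) \<le> poly p2 (poly p1 (sz x))" for x
    using 1 by (auto simp: impl_def intro: poly_nat_mono)
  show ?thesis
  proof (rule implI[of "Seq c1 c2" _ "p1 + pcompose p2 p1 + 1"])
    show "sz (f (g x)) \<le> poly (p1 + pcompose p2 p1 + 1) (sz x)" for x
      using 2 le[of x] by (auto simp: impl_def poly_pcompose intro: order_trans[OF _ le_add2] order_trans)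
    show "runS (Seq c1 c2) [ser (enc x) @ r, a, b, d, e] (poly (p1 + pcompose p2 p1 + 1) (sz x))
      [ser (enc (f (g x))) @ r, a, b, d, e]" for x r a b d e
    proof (rule runS_mono, rule runS_Seq)
      show "runS c1 [ser (enc x) @ r, a, b, d, e] (poly p1 (sz x)) [ser (enc (g x)) @ r, a, b, d, e]"
        using 1 by (simp add: impl_def)
      show "runS c2 [ser (enc (g x)) @ r, a, b, d, e] (poly p2 (sz (g x))) [ser (enc (f (g x))) @ r, a, b, d, e]"
        using 2 by (simp add: impl_def)
    qed (use le[of x] in \<open>simp add: poly_pcompose\<close>)
  qed (use 1 2 in \<open>simp add: impl_def\<close>)
qed

text \<open>\<open>f x\<close> waits on stack 1 while \<open>g\<close> runs, which is safe because
  \<open>impl\<close> preserves arbitrary contents of the other stacks. The final 2 is the node that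
  joins the two codes.\<close>

lemma pt_Pair:
  assumes "pt f" "pt g"
  shows "pt (\<lambda>x. (f x, g x))"
proof -
  from assms obtain c1 p1 c2 p2 where 1: "impl c1 p1 f" and 2: "impl c2 p2 g" unfolding pt_def by blast
  let ?c = "Seq dup (Seq c1 (Seq stash (Seq c2 (Seq (unstash 1) (Push 0 2)))))"
  let ?p = "[:200, 200:] + [:200:] * p1 + p2"
  have le: "sz (f x) \<le> poly p1 (sz x)" "sz (g x) \<le> poly p2 (sz x)" for x
    using 1 2 by (auto simp: impl_def)
  show ?thesis
  proof (rule implI[of ?c _ ?p])
    show "sz (f x, g x) \<le> poly ?p (sz x)" for x
      using le[of x] by simp
    show "runS ?c [ser (enc x) @ r, a, b, d, e] (poly ?p (sz x)) [ser (enc (f x, g x)) @ r, a, b, d, e]"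
      for x r a b d e
    proof (rule runS_mono)
      have 3: "runS c1 [ser (enc x) @ ser (enc x) @ r, a, b, d, e] (poly p1 (sz x))
          [ser (enc (f x)) @ ser (enc x) @ r, a, b, d, e]"
        using 1 by (simp add: impl_def)
      have 4: "runS c2 [ser (enc x) @ r, a', b, d, e] (poly p2 (sz x)) [ser (enc (g x)) @ r, a', b, d, e]" for a'
        using 2 by (simp add: impl_def)
      show "runS ?c [ser (enc x) @ r, a, b, d, e] (100 * sz x + (poly p1 (sz x) + (50 * sz (f x) +
         (poly p2 (sz x) + ((10 * sz (f x) + 10) + 3 + 1) + 1) + 1) + 1) + 1) [ser (enc (f x, g x)) @ r, a, b, d, e]"
        unfolding enc_prod_def fst_conv snd_conv ser.simps append_Cons append_assoc sz_def
        by (rule runS_Seq, rule runS_dup, rule runS_Seq, rule 3[unfolded sz_def], rule runS_Seq, rule runS_stash,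
            rule runS_Seq, rule 4[unfolded sz_def], rule runS_Seq, rule runS_unstash1, rule set_ser, rule runS_prims)
    qed (use le[of x] in simp)
  qed (use 1 2 in \<open>simp add: impl_def\<close>)
qed

definition fst_cmd :: cmd where
  "fst_cmd = Seq (Pop 0) (Seq stash (Seq drop_tree (unstash 1)))"

definition snd_cmd :: cmd where
  "snd_cmd = Seq (Pop 0) drop_tree"

lemma pt_fst: "pt fst"
proof (rule implI[of fst_cmd _ "[:100, 200:]"])
  show "sz (fst x) \<le> poly [:100, 200:] (sz x)" for x :: "'a \<times> 'b"
    by (cases x) auto
  show "runS fst_cmd [ser (enc x) @ r, a, b, d, e] (poly [:100, 200:] (sz x)) [ser (enc (fst x)) @ r, a, b, d, e]"
    for x :: "'a \<times> 'b" and r a b d e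
    unfolding fst_cmd_def enc_prod_def ser.simps append_Cons append_assoc
    by (rule runS_mono, rule runS_Seq, rule runS_prims, rule runS_Seq, rule runS_stash, rule runS_Seq, rule runS_drop,
        rule runS_unstash1, rule set_ser) (cases x, auto simp: sz_def enc_prod_def)
qed (simp add: fst_cmd_def)

lemma pt_snd: "pt snd"
proof (rule implI[of snd_cmd _ "[:100, 200:]"])
  show "sz (snd x) \<le> poly [:100, 200:] (sz x)" for x :: "'a \<times> 'b"
    by (cases x) auto
  show "runS snd_cmd [ser (enc x) @ r, a, b, d, e] (poly [:100, 200:] (sz x)) [ser (enc (snd x)) @ r, a, b, d, e]"
    for x :: "'a \<times> 'b" and r a b d e
    unfolding snd_cmd_def enc_prod_def ser.simps append_Cons append_assoc
    by (rule runS_mono, rule runS_Seq, rule runS_prims, rule runS_drop) (cases x, auto simp: sz_def enc_prod_def)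
qed (simp add: snd_cmd_def)

lemma pt_unit: "pt (\<lambda>x. ())"
proof (rule implI[of "Seq drop_tree (Push 0 1)" _ "[:100, 200:]"])
  show "runS (Seq drop_tree (Push 0 1)) [ser (enc x) @ r, a, b, d, e] (poly [:100, 200:] (sz x))
    [ser (enc ()) @ r, a, b, d, e]" for x :: "'a" and r a b d e
    unfolding enc_unit_def ser.simps append_Cons append_Nil
    by (rule runS_mono, rule runS_Seq, rule runS_drop, rule runS_prims) (auto simp: sz_def)
qed simp_all

text \<open>The common source of conditionals and of case distinctions on lists and numbers. Only
  the root of \<open>enc (d x)\<close> is inspected; a node is handed to \<open>k\<close> as the
  code of a value \<open>u\<close> of another type, for instance of the pair of head and
  tail.\<close>

lemma pt_branch:
  fixes d :: "'a::enc \<Rightarrow> 'b::enc" and k :: "'u::enc \<times> 'a \<Rightarrow> 'c::enc"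
  assumes "pt d" "pt g" "pt k"
    and f: "\<And>x. enc (d x) = Lf \<and> f x = g x \<or> (\<exists>u. enc (d x) = enc u \<and> enc u \<noteq> Lf \<and> f x = k (u, x))"
  shows "pt f"
proof -
  from assms(1-3) obtain c0 p0 c1 p1 c2 p2 where 0: "impl c0 p0 d" and 1: "impl c1 p1 g" and 2: "impl c2 p2 k"
    unfolding pt_def by blast
  let ?c = "Seq dup (Seq c0 (If 0 [1] (Seq drop_tree c1) (Seq (Push 0 2) c2)))"
  let ?p = "[:200, 200:] + [:200:] * p0 + p1 + pcompose p2 ([:1, 1:] + p0)"
  have le0: "sz (d x) \<le> poly p0 (sz x)" for x using 0 by (auto simp: impl_def)
  have le2: "poly p2 (sz (u, x)) \<le> poly p2 (1 + sz x + poly p0 (sz x))" if "enc (d x) = enc u" for u x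
    using le0[of x] that by (intro poly_nat_mono) (simp add: sz_def[of u] sz_def[of "d x"])
  show ?thesis
  proof (rule implI[of ?c _ ?p])
    fix x
    from f[of x] show "sz (f x) \<le> poly ?p (sz x)"
    proof (elim disjE exE conjE)
      assume "f x = g x"
      moreover have "sz (g x) \<le> poly p1 (sz x)" using 1 by (auto simp: impl_def)
      ultimately show ?thesis by simp
    next
      fix u assume "enc (d x) = enc u" "f x = k (u, x)"
      moreover have "sz (k (u, x)) \<le> poly p2 (sz (u, x))" using 2 by (auto simp: impl_def)
      ultimately show ?thesis using le2[of x u] by (simp add: poly_pcompose)
    qed
    fix r a b h e
    have 3: "runS c0 [ser (enc x) @ ser (enc x) @ r, a, b, h, e] (poly p0 (sz x))
        [ser (enc (d x)) @ ser (enc x) @ r, a, b, h, e]"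
      using 0 by (simp add: impl_def)
    from f[of x] show "runS ?c [ser (enc x) @ r, a, b, h, e] (poly ?p (sz x)) [ser (enc (f x)) @ r, a, b, h, e]"
    proof (elim disjE exE conjE)
      assume *: "f x = g x" "enc (d x) = Lf"
      have 4: "runS c1 [ser (enc x) @ r, a, b, h, e] (poly p1 (sz x)) [ser (enc (g x)) @ r, a, b, h, e]"
        using 1 by (simp add: impl_def)
      have 5: "runS (If 0 [1] (Seq drop_tree c1) (Seq (Push 0 2) c2)) [ser (enc (d x)) @ ser (enc x) @ r, a, b, h, e]
          (Suc (40 * length (ser (enc (d x))) + poly p1 (sz x) + 1)) [ser (enc (g x)) @ r, a, b, h, e]"
        by (rule runS_If_True[OF _ _ runS_Seq[OF runS_drop 4]]) (simp_all add: *)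
      show ?thesis unfolding *
        by (rule runS_mono, rule runS_Seq, rule runS_dup, rule runS_Seq, rule 3, rule 5)
          (use * in \<open>simp add: sz_def\<close>)
    next
      fix u assume *: "enc (d x) = enc u" "enc u \<noteq> Lf" "f x = k (u, x)"
      have 4: "runS c2 [2 # ser (enc u) @ ser (enc x) @ r, a, b, h, e] (poly p2 (sz (u, x)))
         [ser (enc (k (u, x))) @ r, a, b, h, e]"
        using 2[unfolded impl_def] by (auto simp: enc_prod_def dest!: spec[of _ u] spec[of _ x])
      obtain t1 t2 where u: "enc u = Nd t1 t2" using *(2) by (cases "enc u") auto
      have 5: "runS (If 0 [1] (Seq drop_tree c1) (Seq (Push 0 2) c2)) [ser (enc (d x)) @ ser (enc x) @ r, a, b, h, e]
          (Suc (3 + poly p2 (sz (u, x)) + 1)) [ser (enc (k (u, x))) @ r, a, b, h, e]"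
        by (rule runS_If_False, simp, simp add: u *(1), unfold *(1), rule runS_Seq, rule runS_prims, rule 4)
      show ?thesis unfolding *(3)
        by (rule runS_mono, rule runS_Seq, rule runS_dup, rule runS_Seq, rule 3, rule 5)
          (use le2[OF *(1)] in \<open>simp add: sz_def poly_pcompose\<close>)
    qed
  qed (use 0 1 2 in \<open>simp add: impl_def\<close>)
qed

text \<open>Composing size bounds once per round could outgrow every polynomial. Hence the
  hypothesis bounds the number of rounds and the size of every iterate by one polynomial in the size
  of the initial argument.\<close>

lemma pt_while:
  fixes t :: "'a::enc \<Rightarrow> bool" and f :: "'a \<Rightarrow> 'a"
  assumes "pt t" "pt f"
    and g: "\<And>x. \<exists>n \<le> poly p (sz x). g x = (f ^^ n) x \<and> \<not> t ((f ^^ n) x) \<and>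
      (\<forall>i<n. t ((f ^^ i) x)) \<and> (\<forall>i\<le>n. sz ((f ^^ i) x) \<le> poly p (sz x))"
  shows "pt g"
proof -
  from assms(1-2) obtain c0 p0 c1 p1 where 0: "impl c0 p0 t" and 1: "impl c1 p1 f"
    unfolding pt_def by blast
  let ?pre = "Seq dup c0"
  let ?W = "While 0 [2] (Seq drop_tree (Seq c1 ?pre))"
  let ?c = "Seq ?pre (Seq ?W drop_tree)"
  let ?q = "[:300, 100:] + p0 + p1"
  have pre: "runS ?pre [ser (enc x) @ r, a, b, h, e] (100 * sz x + poly p0 (sz x) + 1)
      [ser (enc (t x)) @ ser (enc x) @ r, a, b, h, e]" for x r a b h e
    by (rule runS_Seq, unfold sz_def, rule runS_dup) (use 0 in \<open>simp add: impl_def sz_def\<close>)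
  have loop: "runS ?W [ser (enc (t x)) @ ser (enc x) @ r, a, b, h, e] (n * (poly ?q B + poly ?q B) + 1)
      [ser (enc (t ((f ^^ n) x))) @ ser (enc ((f ^^ n) x)) @ r, a, b, h, e]"
    if "\<forall>i<n. t ((f ^^ i) x)" "\<not> t ((f ^^ n) x)" "\<forall>i\<le>n. sz ((f ^^ i) x) \<le> B" for n x r a b h e B
    using that
  proof (induction n arbitrary: x)
    case 0
    then show ?case by (auto simp: enc_bool_def intro: runS_mono[OF runS_While_end])
  next
    case (Suc n)
    have tx: "t x" using Suc.prems(1) by (auto dest: spec[of _ 0])
    have IH: "runS ?W [ser (enc (t (f x))) @ ser (enc (f x)) @ r, a, b, h, e] (n * (poly ?q B + poly ?q B) + 1)
      [ser (enc (t ((f ^^ Suc n) x))) @ ser (enc ((f ^^ Suc n) x)) @ r, a, b, h, e]"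
      using Suc.IH[of "f x"] Suc.prems
      by (simp add: funpow_swap1[symmetric]) (metis Suc_le_mono Suc_less_eq comp_apply funpow.simps(2))
    have 2: "runS c1 [ser (enc x) @ r, a, b, h, e] (poly p1 (sz x)) [ser (enc (f x)) @ r, a, b, h, e]"
      using 1 by (simp add: impl_def)
    have body: "runS (Seq drop_tree (Seq c1 ?pre)) [ser (enc (t x)) @ ser (enc x) @ r, a, b, h, e]
       (40 * length (ser (enc (t x))) + (poly p1 (sz x) + (100 * sz (f x) + poly p0 (sz (f x)) + 1) + 1) + 1)
       [ser (enc (t (f x))) @ ser (enc (f x)) @ r, a, b, h, e]"
      by (rule runS_Seq, rule runS_drop, rule runS_Seq, rule 2, rule pre)
    have B: "sz x \<le> B" "sz (f x) \<le> B"
      using Suc.prems(3) by (auto dest: spec[of _ 0] spec[of _ "Suc 0"])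
    have B': "poly p1 (sz x) \<le> poly p1 B" "poly p0 (sz (f x)) \<le> poly p0 B"
      using B by (auto intro: poly_nat_mono)
    have "runS ?W [ser (enc (t x)) @ ser (enc x) @ r, a, b, h, e]
       ((40 * length (ser (enc (t x))) + (poly p1 (sz x) + (100 * sz (f x) + poly p0 (sz (f x)) + 1) + 1) + 1) +
         (n * (poly ?q B + poly ?q B) + 1) + 2)
       [ser (enc (t ((f ^^ Suc n) x))) @ ser (enc ((f ^^ Suc n) x)) @ r, a, b, h, e]"
      by (rule runS_While_step[OF _ _ body IH]) (use tx in \<open>auto simp: enc_bool_def\<close>)
    then show ?case
      by (rule runS_mono) (use B B' tx in \<open>simp add: enc_bool_def\<close>)
  qed
  \<comment> \<open>At most \<open>p\<close> rounds, each of cost at most twice \<open>?q\<close> at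
    \<open>p\<close>, as all iterates have size at most \<open>p\<close>. The other terms pay for
    the first test and for dropping the last truth value.\<close>
  let ?P = "p * (?q \<circ>\<^sub>p p + ?q \<circ>\<^sub>p p) + ?q + p + [:100:]"
  show ?thesis
  proof (rule implI[of ?c _ ?P])
    fix x
    from g[of x] obtain n where n: "n \<le> poly p (sz x)" "g x = (f ^^ n) x" "\<not> t ((f ^^ n) x)"
      "\<forall>i<n. t ((f ^^ i) x)" "\<forall>i\<le>n. sz ((f ^^ i) x) \<le> poly p (sz x)" by blast
    then have "sz (g x) \<le> poly p (sz x)" by simp
    then show "sz (g x) \<le> poly ?P (sz x)" by simp
    fix r a b h e
    have 1: "runS ?W [ser (enc (t x)) @ ser (enc x) @ r, a, b, h, e]
       (n * (poly ?q (poly p (sz x)) + poly ?q (poly p (sz x))) + 1)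
       [ser (enc (t ((f ^^ n) x))) @ ser (enc (g x)) @ r, a, b, h, e]"
      using loop[OF n(4,3,5)] n(2) by simp
    have "n * (poly ?q (poly p (sz x)) + poly ?q (poly p (sz x)))
        \<le> poly p (sz x) * (poly ?q (poly p (sz x)) + poly ?q (poly p (sz x)))"
      using n(1) by (rule mult_le_mono1)
    then show "runS ?c [ser (enc x) @ r, a, b, h, e] (poly ?P (sz x)) [ser (enc (g x)) @ r, a, b, h, e]"
      by (intro runS_mono[OF runS_Seq[OF pre runS_Seq[OF 1 runS_drop]]])
        (use n(3) in \<open>simp add: enc_bool_def poly_pcompose algebra_simps\<close>)
  qed (use 0 1 in \<open>simp add: impl_def\<close>)
qed

section \<open>Conversion between bit strings on tapes and tree codes of Boolean lists\<close>

section \<open>Input and output\<close>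

text \<open>On a stack, the code of a list has to be built from its last element, so the input is
  first reversed onto stack 1. An element \<open>False\<close> contributes the symbols 2 1 and an
  element \<open>True\<close> the symbols 2 2 1 1, pushed in reverse order.\<close>

definition in_cmd :: cmd where
  "in_cmd = Seq (While 0 [1, 2] (If 0 [1] (Seq (Pop 0) (Push 1 1)) (Seq (Pop 0) (Push 1 2))))
    (Seq (Push 0 1) (While 1 [1, 2] (If 1 [1] (Seq (Pop 1) (Seq (Push 0 1) (Push 0 2)))
      (Seq (Pop 1) (Seq (Push 0 1) (Seq (Push 0 1) (Seq (Push 0 2) (Push 0 2))))))))"

lemma runS_in_cmd: "runS in_cmd [map bit_sym x, [], b, d, e] (40 * length x + 20) [ser (enc x), [], b, d, e]"
proof -
  let ?b1 = "If 0 [1] (Seq (Pop 0) (Push 1 1)) (Seq (Pop 0) (Push 1 2))"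
  let ?b2 = "If 1 [1] (Seq (Pop 1) (Seq (Push 0 1) (Push 0 2)))
      (Seq (Pop 1) (Seq (Push 0 1) (Seq (Push 0 1) (Seq (Push 0 2) (Push 0 2)))))"
  have 1: "runS (While 0 [1, 2] ?b1) [map bit_sym x, a, b, d, e] (10 * length x + 1) [[], rev (map bit_sym x) @ a, b, d, e]"
    for a
  proof (induction x arbitrary: a)
    case Nil
    then show ?case by (auto intro: runS_mono[OF runS_While_end])
  next
    case (Cons v x)
    have "runS ?b1 [1 # map bit_sym x, a, b, d, e] 6 [map bit_sym x, 1 # a, b, d, e]"
      by (rule runS_mono, rule runS_If_True, simp, simp, (rule runS_straight)+, simp)
    moreover have "runS ?b1 [2 # map bit_sym x, a, b, d, e] 6 [map bit_sym x, 2 # a, b, d, e]"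
      by (rule runS_mono, rule runS_If_False, simp, simp, (rule runS_straight)+, simp)
    ultimately have "runS ?b1 [bit_sym v # map bit_sym x, a, b, d, e] 6 [map bit_sym x, bit_sym v # a, b, d, e]"
      by (simp add: bit_sym_def)
    from runS_While_step[of 0 _ "[1, 2]", OF _ _ this Cons.IH] show ?case
      by (cases v) (auto simp: bit_sym_def[of True] bit_sym_def[of False] intro: runS_mono)
  qed
  have 2: "runS (While 1 [1, 2] ?b2) [ser (enc y), map bit_sym x, b, d, e] (30 * length x + 1)
      [ser (enc (rev x @ y)), [], b, d, e]" for x y :: "bool list"
  proof (induction x arbitrary: y)
    case Nil
    then show ?case by (auto intro: runS_mono[OF runS_While_end])
  next
    case (Cons v x)
    have "runS ?b2 [ser (enc y), 1 # map bit_sym x, b, d, e] 20 [2 # 1 # ser (enc y), map bit_sym x, b, d, e]"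
      by (rule runS_mono, rule runS_If_True, simp, simp, (rule runS_straight)+, simp)
    moreover have "runS ?b2 [ser (enc y), 2 # map bit_sym x, b, d, e] 20 [2 # 2 # 1 # 1 # ser (enc y), map bit_sym x, b, d, e]"
      by (rule runS_mono, rule runS_If_False, simp, simp, (rule runS_straight)+, simp)
    ultimately have "runS ?b2 [ser (enc y), bit_sym v # map bit_sym x, b, d, e] 20 [ser (enc (v # y)), map bit_sym x, b, d, e]"
      by (simp add: bit_sym_def enc_bool_def)
    from runS_While_step[of 1 _ "[1, 2]", OF _ _ this Cons.IH] show ?case
      by (cases v) (auto simp: bit_sym_def[of True] bit_sym_def[of False] intro: runS_mono)
  qed
  have 3: "runS (Push 0 1) [[], xs, b, d, e] 3 [ser (enc ([] :: bool list)), xs, b, d, e]" for xs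
    using runS_prims(1)[of 1 "[]"] by simp
  show ?thesis
    unfolding in_cmd_def
    using runS_Seq[OF 1[of "[]", unfolded append_Nil2] runS_Seq[OF 3, OF 2[of "[]" "rev x", unfolded rev_map[symmetric]]]]
    by (auto simp: rev_map intro: runS_mono)
qed

definition out_cmd :: cmd where
  "out_cmd = While 0 [2] (Seq (Pop 0) (If 0 [1] (Seq (Pop 0) (Emit 1))
     (Seq (Pop 0) (Seq (Pop 0) (Seq (Pop 0) (Emit 2))))))"

lemma runS_out_cmd:
  "runS out_cmd [ser (enc (y :: bool list)), a, b, d, e] (20 * length y + 1) [[1], a, b, d, e @ map bit_sym y]"
proof (induction y arbitrary: e)
  case Nil
  then show ?case unfolding out_cmd_def by (auto intro: runS_mono[OF runS_While_end])
next
  case (Cons v y)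
  let ?i = "If 0 [1] (Seq (Pop 0) (Emit 1)) (Seq (Pop 0) (Seq (Pop 0) (Seq (Pop 0) (Emit 2))))"
  have "runS ?i [1 # ser (enc y), a, b, d, e] 10 [ser (enc y), a, b, d, e @ [1]]"
    by (rule runS_mono, rule runS_If_True, simp, simp, (rule runS_straight)+, simp)
  moreover have "runS ?i [2 # 1 # 1 # ser (enc y), a, b, d, e] 10 [ser (enc y), a, b, d, e @ [2]]"
    by (rule runS_mono, rule runS_If_False, simp, simp, (rule runS_straight)+, simp)
  note 0 = calculation this
  have 1: "runS ?i [ser (enc v) @ ser (enc y), a, b, d, e] 10 [ser (enc y), a, b, d, e @ [bit_sym v]]"
    using 0 by (simp add: bit_sym_def enc_bool_def)
  have "runS (Seq (Pop 0) ?i) [ser (enc (v # y)), a, b, d, e] 12 [ser (enc y), a, b, d, e @ [bit_sym v]]"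
    using runS_Seq[OF runS_prims(5) 1] by simp
  from runS_While_step[of 0 _ "[2]", OF _ _ this Cons.IH[unfolded out_cmd_def]] show ?case
    unfolding out_cmd_def by (auto intro: runS_mono)
qed

lemma sz_bools: "sz (x :: bool list) \<le> 4 * length x + 1" "length x \<le> sz x"
  by (induction x) auto

theorem pt_polytime:
  fixes f :: "bool list \<Rightarrow> bool list"
  assumes "pt f"
  shows "polytime f"
proof -
  from assms obtain c p where c: "impl c p f" unfolding pt_def by blast
  let ?c = "Seq in_cmd (Seq c out_cmd)"
  have "wfc ?c" using c by (simp add: impl_def in_cmd_def out_cmd_def)
  then obtain M where M: "wf_tm M" "tm_tapes M = 5"
    "\<And>n ts ts'. (cstep ^^ n) (?c, ts) = (Skip, ts') \<Longrightarrow> length ts = 5 \<Longrightarrow>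
       (tm_step M ^^ n) (0, ts) = (tm_states M, ts')"
    using cmd_tm[of ?c] by auto
  \<comment> \<open>A list element costs at most 4 symbols, one node and up to 3 symbols of its own,
    whence \<open>sz x \<le> 4 * length x + 1\<close>.\<close>
  let ?q = "[:1, 4:]"
  let ?P = "[:100, 40:] + p \<circ>\<^sub>p ?q + [:20:] * (p \<circ>\<^sub>p ?q)"
  have "tm_computes_within M (poly ?P (length x)) x (f x)" for x
  proof -
    let ?ts = "input_tape x # replicate 4 blank_tape"
    have "rep ?ts [map bit_sym x, [], [], [], []]"
      by (auto simp: rep_def stk_def out_tape_def input_tape_def blank_tape_def nth_Cons numeral_eq_Suc less_Suc_eq
          split: nat.splits)
    moreover have "runS ?c [map bit_sym x, [], [], [], []] (40 * length x + 20 + (poly p (sz x) +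
        (20 * length (f x) + 1) + 1) + 1) [[1], [], [], [], map bit_sym (f x)]"
    proof (rule runS_Seq[OF runS_in_cmd], rule runS_Seq)
      show "runS c [ser (enc x), [], [], [], []] (poly p (sz x)) [ser (enc (f x)), [], [], [], []]"
        using c unfolding impl_def by (metis append_Nil2)
      show "runS out_cmd [ser (enc (f x)), [], [], [], []] (20 * length (f x) + 1) [[1], [], [], [], map bit_sym (f x)]"
        using runS_out_cmd[of "f x" "[]" "[]" "[]" "[]"] by simp
    qed
    ultimately obtain m ts' where m: "m \<le> 40 * length x + 20 + (poly p (sz x) + (20 * length (f x) + 1) + 1) + 1"
      "runs ?c ?ts m ts'" "rep ts' [[1], [], [], [], map bit_sym (f x)]"
      unfolding runS_def by blast
    have "poly p (sz x) \<le> poly p (1 + 4 * length x)" using sz_bools(1)[of x] by (intro poly_nat_mono) simp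
    moreover have "length (f x) \<le> poly p (sz x)"
      using c sz_bools(2)[of "f x"] unfolding impl_def by (meson order_trans)
    ultimately have "m \<le> poly ?P (length x)"
      using m(1) by (simp add: poly_pcompose algebra_simps)
    moreover have "(tm_step M ^^ m) (tm_init M x) = (tm_states M, ts')"
      using M(3)[OF m(2)[unfolded runs_def]] M(2) by (simp add: tm_init_def)
    moreover have "last ts' = ts' ! 4" using m(3) by (subst last_conv_nth) (auto simp: rep_def)
    then have "tape_output (last ts') (f x)"
      using m(3) by (auto simp: rep_def out_tape_def tape_output_def)
    ultimately show ?thesis unfolding tm_computes_within_def by auto
  qed
  with M(1) show ?thesis unfolding polytime_def by blast
qed

declare One_nat_def [simp]

section \<open>Polynomial-time list functions and arithmetic derived from the combinators\<close>

section \<open>Closure properties\<close>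

lemma push_string:
  "set xs \<subseteq> {..<4} \<Longrightarrow>
    \<exists>w. wfc w \<and> (\<exists>n. \<forall>r a b d e. runS w [r, a, b, d, e] n [xs @ r, a, b, d, e])"
proof (induction xs)
  case Nil
  then show ?case using runS_Skip by (auto intro!: exI[of _ Skip])
next
  case (Cons s xs)
  then obtain w n where w: "wfc w" "\<And>r a b d e. runS w [r, a, b, d, e] n [xs @ r, a, b, d, e]"
    by auto
  have "runS (Seq w (Push 0 s)) [r, a, b, d, e] (n + 3 + 1) [(s # xs) @ r, a, b, d, e]" for r a b d e
    using runS_Seq[OF w(2) runS_prims(1)] by simp
  with w(1) Cons.prems show ?case
    by (intro exI[of _ "Seq w (Push 0 s)"]) (auto intro!: exI[of _ "n + 3 + 1"])
qed

lemma pt_const: "pt (\<lambda>x :: 'a::enc. k :: 'b::enc)"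
proof -
  have "set (ser (enc k)) \<subseteq> {..<4}" using set_ser by fastforce
  from push_string[OF this] obtain w n where w: "wfc w"
    "\<And>r a b d e. runS w [r, a, b, d, e] n [ser (enc k) @ r, a, b, d, e]" by blast
  show ?thesis
  proof (rule implI[of "Seq drop_tree w" _ "[:n + 1 + sz k, 40:]"])
    show "runS (Seq drop_tree w) [ser (enc x) @ r, a, b, d, e] (poly [:n + 1 + sz k, 40:] (sz x))
       [ser (enc k) @ r, a, b, d, e]" for x :: 'a and r a b d e
      by (rule runS_mono[OF runS_Seq[OF runS_drop w(2)]]) (simp add: sz_def)
  qed (use w(1) in auto)
qed

lemma pt_bound:
  assumes "pt f"
  obtains p where "\<And>x. sz (f x) \<le> poly p (sz x)"
  using assms unfolding pt_def impl_def by blast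

lemma pt_fstI: "pt f \<Longrightarrow> pt (\<lambda>x. fst (f x))"
  by (rule pt_comp[OF pt_fst])

lemma pt_sndI: "pt f \<Longrightarrow> pt (\<lambda>x. snd (f x))"
  by (rule pt_comp[OF pt_snd])

lemma pt_if: "pt b \<Longrightarrow> pt f \<Longrightarrow> pt g \<Longrightarrow> pt (\<lambda>x. if b x then f x else g x)"
  by (rule pt_branch[where d = b and k = "\<lambda>z :: bool \<times> _. f (snd z)" and g = g])
    (auto simp: enc_bool_def intro!: pt_comp[of f snd] pt_snd)

lemma pt_cong: "pt f \<Longrightarrow> (\<And>x. f x = g x) \<Longrightarrow> pt g"
  by (metis ext)

lemma pt_not: "pt b \<Longrightarrow> pt (\<lambda>x. \<not> b x)"
  by (rule pt_cong[OF pt_if[of b "\<lambda>x. False" "\<lambda>x. True"]]) (auto intro: pt_const)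

lemma pt_conj: "pt b \<Longrightarrow> pt c \<Longrightarrow> pt (\<lambda>x. b x \<and> c x)"
  by (rule pt_cong[OF pt_if[of b c "\<lambda>x. False"]]) (auto intro: pt_const)

lemma pt_disj: "pt b \<Longrightarrow> pt c \<Longrightarrow> pt (\<lambda>x. b x \<or> c x)"
  by (rule pt_cong[OF pt_if[of b "\<lambda>x. True" c]]) (auto intro: pt_const)

lemma pt_iff: "pt b \<Longrightarrow> pt c \<Longrightarrow> pt (\<lambda>x. (b x :: bool) = c x)"
  by (rule pt_cong[OF pt_if[of b c "\<lambda>x. \<not> c x"]]) (auto intro: pt_not)

lemma pt_Cons: "pt f \<Longrightarrow> pt g \<Longrightarrow> pt (\<lambda>x. f x # g x)"
  by (rule pt_recast[OF pt_Pair[of f g]]) (auto simp: enc_prod_def)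

lemma pt_Suc: "pt f \<Longrightarrow> pt (\<lambda>x. Suc (f x))"
  by (rule pt_recast[OF pt_Pair[of "\<lambda>x. ()" f]]) (auto simp: enc_prod_def enc_unit_def pt_unit)

lemma pt_case_list:
  assumes "pt l" "pt g" "pt (\<lambda>z. k (snd z) (fst (fst z)) (snd (fst z)))"
  shows "pt (\<lambda>x. case l x of [] \<Rightarrow> g x | h # t \<Rightarrow> k x h t)"
  by (rule pt_branch[OF assms]) (auto simp: enc_prod_def split: list.splits)

lemma pt_case_nat:
  fixes l :: "'a::enc \<Rightarrow> nat"
  assumes "pt l" "pt g" "pt (\<lambda>z :: (unit \<times> nat) \<times> 'a. k (snd z) (snd (fst z)))"
  shows "pt (\<lambda>x. case l x of 0 \<Rightarrow> g x | Suc n \<Rightarrow> k x n)"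
  by (rule pt_branch[OF assms]) (auto simp: enc_prod_def enc_unit_def split: nat.splits)

lemma pt_comp2:
  assumes "pt (\<lambda>z. f (snd z) (fst z))" "pt A" "pt B"
  shows "pt (\<lambda>w. f (A w) (B w))"
  using pt_comp[OF assms(1) pt_Pair[OF assms(3,2)]] by simp

lemma pt_comp3:
  assumes "pt (\<lambda>z. f (snd z) (snd (fst z)) (fst (fst z)))" "pt A" "pt B" "pt C"
  shows "pt (\<lambda>w. f (A w) (B w) (C w))"
  using pt_comp[OF assms(1) pt_Pair[OF pt_Pair[OF assms(4,3)] assms(2)]] by simp

lemma sz_member: "e \<in> set l \<Longrightarrow> sz e \<le> sz l"
  by (induction l) auto

lemma length_le_sz: "length l \<le> sz l"
  by (induction l) auto

text \<open>The increment allowed by \<open>grow\<close> does not depend on the accumulator. Growth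
  is thus additive, and the accumulator stays polynomial over as many steps as the list has
  elements; repeated doubling is excluded.\<close>

lemma pt_foldl:
  fixes S :: "'x::enc \<Rightarrow> 'a::enc \<Rightarrow> 'e::enc \<Rightarrow> 'a"
  assumes "pt L" "pt I" "pt (\<lambda>z. S (snd z) (snd (fst z)) (fst (fst z)))"
    and grow: "\<And>x acc e. sz (S x acc e) \<le> sz acc + poly p (sz x + sz e)"
  shows "pt (\<lambda>x. foldl (S x) (I x) (L x))"
proof -
  define f where "f = (\<lambda>st :: 'e list \<times> ('a \<times> 'x). case fst st of [] \<Rightarrow> st |
     e # es \<Rightarrow> (es, (S (snd (snd st)) (fst (snd st)) e, snd (snd st))))"
  define g where "g = (\<lambda>st :: 'e list \<times> ('a \<times> 'x).
     ([] :: 'e list, (foldl (S (snd (snd st))) (fst (snd st)) (fst st), snd (snd st))))"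
  have ptf: "pt f"
    unfolding f_def
    by (intro pt_case_list pt_comp3[OF assms(3)] pt_fstI pt_sndI pt_id pt_Pair)
  have "pt (\<lambda>st :: 'e list \<times> ('a \<times> 'x). fst st \<noteq> [])"
    by (rule pt_cong[OF pt_case_list[of "\<lambda>st :: 'e list \<times> ('a \<times> 'x). fst st" "\<lambda>x. False" "\<lambda>x h t. True"]])
      (auto simp: pt_const pt_fst split: list.splits)
  moreover note ptf
  moreover have "\<exists>n \<le> poly ([:0, 1:] + [:0, 1:] * p) (sz st). g st = (f ^^ n) st \<and>
      \<not> fst ((f ^^ n) st) \<noteq> [] \<and> (\<forall>i<n. fst ((f ^^ i) st) \<noteq> []) \<and>
      (\<forall>i\<le>n. sz ((f ^^ i) st) \<le> poly ([:0, 1:] + [:0, 1:] * p) (sz st))" for st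
  proof -
    obtain l acc x where st: "st = (l, (acc, x))" by (metis surj_pair)
    have it: "(f ^^ i) (l, (acc, x)) = (drop i l, (foldl (S x) acc (take i l), x))" if "i \<le> length l" for i
      using that
    proof (induction i)
      case (Suc i)
      then have "drop i l = l ! i # drop (Suc i) l" "take (Suc i) l = take i l @ [l ! i]"
        by (simp_all add: Cons_nth_drop_Suc take_Suc_conv_app_nth)
      then show ?case using Suc by (simp add: f_def)
    qed simp
    have acc: "sz (foldl (S x) acc (take i l)) \<le> sz acc + i * poly p (sz st)" if "i \<le> length l" for i
      using that
    proof (induction i)
      case (Suc i)
      then have t: "take (Suc i) l = take i l @ [l ! i]" by (simp add: take_Suc_conv_app_nth)
      have "sz (l ! i) \<le> sz l" using Suc.prems by (intro sz_member) simp
      then have "poly p (sz x + sz (l ! i)) \<le> poly p (sz st)" by (intro poly_nat_mono) (simp add: st)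
      moreover have "sz (foldl (S x) acc (take (Suc i) l)) \<le> sz (foldl (S x) acc (take i l)) + poly p (sz x + sz (l ! i))"
        using grow by (simp add: t)
      ultimately show ?case using Suc by simp
    qed simp
    have drop: "sz (drop i l) \<le> sz l" for i
    proof (induction l arbitrary: i)
      case (Cons a l)
      then show ?case by (cases i) (auto intro: order_trans[OF Cons.IH])
    qed simp
    have "sz ((f ^^ i) st) \<le> poly ([:0, 1:] + [:0, 1:] * p) (sz st)" if "i \<le> length l" for i
    proof -
      have "i \<le> sz st" using that length_le_sz[of l] by (simp add: st)
      then have "i * poly p (sz st) \<le> sz st * poly p (sz st)" by simp
      moreover have "sz (foldl (S x) acc (take i l)) \<le> sz acc + i * poly p (sz st)" using acc that by simp
      ultimately have "sz (foldl (S x) acc (take i l)) \<le> sz acc + sz st * poly p (sz st)" by linarith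
      then have "sz (drop i l) + sz (foldl (S x) acc (take i l)) + sz x + 2 \<le> sz st + sz st * poly p (sz st)"
        using drop[of i] unfolding st by simp
      then show ?thesis using it[OF that] by (simp add: st)
    qed
    then show ?thesis
      using it length_le_sz[of l]
      by (intro exI[of _ "length l"]) (auto simp: st g_def)
  qed
  ultimately have g: "pt g" by (rule pt_while)
  have "pt (\<lambda>x. fst (snd (g (L x, (I x, x)))))"
    by (rule pt_fstI, rule pt_sndI, rule pt_comp[OF g]) (intro pt_Pair assms(1,2) pt_id)
  then show ?thesis by (simp add: g_def)
qed

text \<open>A unary number has the same tree code as a list of that many units, so iteration is a
  fold over such a list.\<close>

lemma pt_funpow:
  fixes S :: "'x::enc \<Rightarrow> 'a::enc \<Rightarrow> 'a"
  assumes "pt n" "pt I" "pt (\<lambda>z. S (snd z) (fst z))"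
    and grow: "\<And>x acc. sz (S x acc) \<le> sz acc + poly p (sz x)"
  shows "pt (\<lambda>x. (S x ^^ n x) (I x))"
proof -
  have "enc (replicate m ()) = enc m" for m
    by (induction m) (auto simp: enc_unit_def)
  then have 1: "pt (\<lambda>x. replicate (n x) ())"
    by (intro pt_recast[OF assms(1)]) simp
  have "pt (\<lambda>x. foldl (\<lambda>acc u. S x acc) (I x) (replicate (n x) ()))"
  proof (rule pt_foldl[OF 1 assms(2)])
    show "pt (\<lambda>z :: (unit \<times> 'a) \<times> 'x. S (snd z) (snd (fst z)))"
      by (intro pt_comp2[OF assms(3)] pt_sndI pt_fstI pt_id)
    show "sz (S x acc) \<le> sz acc + poly p (sz x + sz u)" for x acc and u :: unit
      using grow[of x acc] poly_nat_mono[of "sz x" "sz x + sz u" p] by linarith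
  qed
  moreover have "foldl (\<lambda>acc u. S x acc) b (replicate m ()) = (S x ^^ m) b" for x m b
    by (induction m arbitrary: b) (auto simp: funpow_swap1)
  ultimately show ?thesis by simp
qed

lemmas pt_basic = pt_const pt_id pt_fstI pt_sndI pt_Pair pt_if pt_not pt_conj pt_disj pt_iff pt_Cons
  pt_Suc pt_case_list pt_case_nat

lemma pt_rev:
  assumes "pt l" shows "pt (\<lambda>x. rev (l x))"
proof -
  have "pt (\<lambda>x. foldl (\<lambda>acc e. e # acc) [] (l x))"
    by (rule pt_foldl[where p = "[:1, 1:]"]) (auto intro!: pt_basic assms)
  moreover have "foldl (\<lambda>acc e. e # acc) a xs = rev xs @ a" for a and xs :: "'b list"
    by (induction xs arbitrary: a) auto
  ultimately show ?thesis by simp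
qed

lemma pt_append:
  assumes "pt f" "pt g" shows "pt (\<lambda>x. f x @ g x)"
proof -
  have "pt (\<lambda>x. foldl (\<lambda>acc e. e # acc) (g x) (rev (f x)))"
    by (rule pt_foldl[where p = "[:1, 1:]"]) (auto intro!: pt_basic pt_rev assms)
  moreover have "foldl (\<lambda>acc e. e # acc) a xs = rev xs @ a" for a and xs :: "'b list"
    by (induction xs arbitrary: a) auto
  ultimately show ?thesis by simp
qed

lemma pt_map:
  assumes "pt l" "pt (\<lambda>z. f (snd z) (fst z))"
  shows "pt (\<lambda>x. map (f x) (l x))"
proof -
  from pt_bound[OF assms(2)] obtain p where p: "\<And>x e. sz (f x e) \<le> poly p (sz (e, x))"
    by (metis fst_conv snd_conv)
  have "pt (\<lambda>x. rev (foldl (\<lambda>acc e. f x e # acc) [] (l x)))"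
  proof (rule pt_rev, rule pt_foldl[where p = "[:1:] + p \<circ>\<^sub>p [:1, 1:]"])
    show "sz (f x e # acc) \<le> sz acc + poly ([:1:] + p \<circ>\<^sub>p [:1, 1:]) (sz x + sz e)" for x e acc
      using p[of x e] by (simp add: poly_pcompose add_ac)
    show "pt (\<lambda>z. f (snd z) (fst (fst z)) # snd (fst z))"
      by (intro pt_comp2[OF assms(2)] pt_basic)
  qed (auto intro: pt_basic assms)
  moreover have "foldl (\<lambda>acc e. f x e # acc) a xs = rev (map (f x) xs) @ a" for x a xs
    by (induction xs arbitrary: a) auto
  ultimately show ?thesis by simp
qed

lemma sz_append: "sz (xs @ ys) \<le> sz xs + sz ys"
  by (induction xs) auto

lemma pt_concat:
  assumes "pt l" shows "pt (\<lambda>x. concat (l x))"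
proof -
  have "pt (\<lambda>x. foldl (\<lambda>acc e. acc @ e) [] (l x))"
    by (rule pt_foldl[where p = "[:0, 1:]"])
      (auto intro!: pt_basic pt_append assms intro: order_trans[OF sz_append])
  moreover have "foldl (\<lambda>acc e. acc @ e) a xs = a @ concat xs" for a and xs :: "'b list list"
    by (induction xs arbitrary: a) auto
  ultimately show ?thesis by simp
qed

lemma pt_filter:
  assumes "pt l" "pt (\<lambda>z. P (snd z) (fst z))"
  shows "pt (\<lambda>x. filter (P x) (l x))"
proof -
  have "filter (P x) xs = concat (map (\<lambda>e. if P x e then [e] else []) xs)" for x xs
    by (induction xs) auto
  then show ?thesis using assms by (auto intro!: pt_concat pt_map pt_basic)
qed

lemma pt_list_ex:
  assumes "pt l" "pt (\<lambda>z. P (snd z) (fst z))"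
  shows "pt (\<lambda>x. list_ex (P x) (l x))"
proof -
  have "pt (\<lambda>x. foldl (\<lambda>b e. b \<or> P x e) False (l x))"
  proof (rule pt_foldl[where p = "[:3:]"])
    show "pt (\<lambda>z. snd (fst z) \<or> P (snd z) (fst (fst z)))"
      by (intro pt_comp2[OF assms(2)] pt_basic)
  qed (auto intro: pt_basic assms)
  moreover have "foldl (\<lambda>b e. b \<or> P x e) b xs = (b \<or> list_ex (P x) xs)" for x b xs
    by (induction xs arbitrary: b) auto
  ultimately show ?thesis by simp
qed

lemma pt_list_all:
  assumes "pt l" "pt (\<lambda>z. P (snd z) (fst z))"
  shows "pt (\<lambda>x. list_all (P x) (l x))"
  by (rule pt_cong[OF pt_not[OF pt_list_ex[OF assms(1) pt_not[OF assms(2)]]]])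
    (simp add: list_ex_iff list_all_iff)

lemma pt_length:
  assumes "pt l" shows "pt (\<lambda>x. length (l x))"
proof -
  have "pt (\<lambda>x. foldl (\<lambda>n e. Suc n) 0 (l x))"
    by (rule pt_foldl[where p = "[:2:]"]) (auto intro!: pt_basic assms)
  moreover have "foldl (\<lambda>n e. Suc n) m xs = m + length xs" for m and xs :: "'b list"
    by (induction xs arbitrary: m) auto
  ultimately show ?thesis by simp
qed

lemma pt_add:
  assumes "pt f" "pt g" shows "pt (\<lambda>x. f x + g x :: nat)"
proof -
  have "pt (\<lambda>x. (Suc ^^ g x) (f x))"
    by (rule pt_funpow[where p = "[:2:]"]) (auto intro!: pt_basic assms)
  moreover have "(Suc ^^ n) m = m + n" for m n
    by (induction n) auto
  ultimately show ?thesis by (auto intro: pt_cong)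
qed

lemma pt_mult:
  assumes "pt f" "pt g" shows "pt (\<lambda>x. f x * g x :: nat)"
proof -
  obtain p where p: "\<And>x. sz (f x) \<le> poly p (sz x)" using pt_bound[OF assms(1)] by blast
  have "pt (\<lambda>x. ((\<lambda>a. a + f x) ^^ g x) 0)"
  proof (rule pt_funpow[where p = p])
    show "sz (acc + f x) \<le> sz acc + poly p (sz x)" for x acc
      using p[of x] by simp
  qed (auto intro!: pt_basic pt_add assms pt_comp[OF assms(1)])
  moreover have "((\<lambda>a. a + k) ^^ n) 0 = k * n" for k n :: nat
    by (induction n) auto
  ultimately show ?thesis by simp
qed

lemma pt_diff:
  assumes "pt f" "pt g" shows "pt (\<lambda>x. f x - g x :: nat)"
proof -
  have "pt (\<lambda>x. ((\<lambda>m. case m of 0 \<Rightarrow> 0 | Suc k \<Rightarrow> k) ^^ g x) (f x))"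
    by (rule pt_funpow[where p = "[:2:]"]) (auto intro!: pt_basic assms split: nat.splits)
  moreover have "((\<lambda>m. case m of 0 \<Rightarrow> 0 | Suc k \<Rightarrow> k) ^^ n) m = m - n" for m n :: nat
    by (induction n) (auto split: nat.splits)
  ultimately show ?thesis by simp
qed

lemma pt_le:
  assumes "pt f" "pt g" shows "pt (\<lambda>x. (f x :: nat) \<le> g x)"
proof -
  have "pt (\<lambda>x. case f x - g x of 0 \<Rightarrow> True | Suc n \<Rightarrow> False)"
    by (intro pt_basic pt_diff assms)
  then show ?thesis by (rule pt_cong) (auto split: nat.splits)
qed

lemma pt_less: "pt f \<Longrightarrow> pt g \<Longrightarrow> pt (\<lambda>x. (f x :: nat) < g x)"
  using pt_le[of "\<lambda>x. Suc (f x)" g] by (simp add: pt_Suc Suc_le_eq)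

lemma pt_eq_nat: "pt f \<Longrightarrow> pt g \<Longrightarrow> pt (\<lambda>x. (f x :: nat) = g x)"
  using pt_conj[OF pt_le[of f g] pt_le[of g f]] by (simp add: eq_iff)

lemma pt_upt:
  assumes "pt n" shows "pt (\<lambda>x. [0..<n x])"
proof -
  obtain p where p: "\<And>x. sz (n x) \<le> poly p (sz x)" using pt_bound[OF assms] by blast
  \<comment> \<open>The guard is true in each of the \<open>n x\<close> rounds. It makes the growth
    bound valid for arbitrary accumulators, as \<open>pt_funpow\<close> demands.\<close>
  let ?S = "\<lambda>x acc. if length acc < n x then length acc # acc else acc"
  have "pt (\<lambda>x. rev ((?S x ^^ n x) []))"
  proof (rule pt_rev, rule pt_funpow[where p = "[:3:] + p"])
    show "sz (?S x acc) \<le> sz acc + poly ([:3:] + p) (sz x)" for x acc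
      using p[of x] by auto
  qed (auto intro!: pt_basic pt_less pt_length assms pt_comp[OF assms])
  moreover have "(?S x ^^ i) [] = rev [0..<i]" if "i \<le> n x" for x i
    using that by (induction i) auto
  ultimately show ?thesis by simp
qed

lemma pt_replicate:
  assumes "pt n" "pt v" shows "pt (\<lambda>x. replicate (n x) (v x))"
  using pt_map[of "\<lambda>x. [0..<n x]" "\<lambda>x i. v x"] pt_upt[OF assms(1)] pt_comp[OF assms(2) pt_snd]
  by (simp add: map_replicate_const)

lemma pt_poly: "pt n \<Longrightarrow> pt (\<lambda>x. poly (p :: nat poly) (n x))"
  by (induction p) (auto intro!: pt_basic pt_add pt_mult)

lemma pt_bools_eq:
  fixes f g :: "'a::enc \<Rightarrow> bool list"
  assumes "pt f" "pt g" shows "pt (\<lambda>x. f x = g x)"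
proof -
  \<comment> \<open>The state is the verdict so far with the rest of the second list. A second list
    that is too short turns the verdict to \<open>False\<close>; one that is too long is noticed at
    the end.\<close>
  let ?S = "\<lambda>(st :: bool \<times> bool list) (e :: bool). case snd st of [] \<Rightarrow> (False, []) | r # rs \<Rightarrow> (fst st \<and> r = e, rs)"
  have "pt (\<lambda>x. foldl ?S (True, g x) (f x))"
    by (rule pt_foldl[where p = "[:3:]"]) (auto intro!: pt_basic assms split: list.splits)
  then have "pt (\<lambda>x. fst (foldl ?S (True, g x) (f x)) \<and> (case snd (foldl ?S (True, g x) (f x)) of [] \<Rightarrow> True | r # rs \<Rightarrow> False))"
    by (intro pt_basic)
  moreover have "(fst (foldl ?S (b, ys) xs) \<and> (case snd (foldl ?S (b, ys) xs) of [] \<Rightarrow> True | r # rs \<Rightarrow> False)) = (b \<and> xs = ys)"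
    for b xs ys
  proof (induction xs arbitrary: b ys)
    case Nil
    then show ?case by (auto split: list.splits)
  next
    case (Cons a xs)
    then show ?case by (cases ys) auto
  qed
  ultimately show ?thesis by simp
qed

fun inc_bits :: "bool list \<Rightarrow> bool list" where
  "inc_bits [] = [True]"
| "inc_bits (False # r) = True # r"
| "inc_bits (True # r) = False # inc_bits r"

lemma nat_bits_Suc: "nat_bits (Suc n) = inc_bits (nat_bits n)"
proof (induction n rule: less_induct)
  case (less n)
  show ?case
  proof (cases "even n")
    case True
    show ?thesis
    proof (cases "n = 0")
      case True
      then show ?thesis by (simp add: nat_bits.simps)
    next
      case False
      then show ?thesis using True nat_bits.simps[of n] nat_bits.simps[of "Suc n"] by simp
    qed
  next
    case False
    then have "n div 2 < n" "Suc n div 2 = Suc (n div 2)" by presburger+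
    then show ?thesis using less.IH[of "n div 2"] False nat_bits.simps[of n] nat_bits.simps[of "Suc n"]
      by (cases "n = 0") simp_all
  qed
qed

lemma pt_inc_bits:
  assumes "pt f" shows "pt (\<lambda>x. inc_bits (f x))"
proof -
  define S where "S = (\<lambda>(st :: bool \<times> bool list) e. (fst st \<and> e, (fst st \<noteq> e) # snd st))"
  let ?F = "\<lambda>x. foldl S (True, []) (f x)"
  have "pt ?F"
    by (rule pt_foldl[where p = "[:10:]"]) (auto simp: S_def intro!: pt_basic assms)
  then have "pt (\<lambda>x. rev (if fst (?F x) then True # snd (?F x) else snd (?F x)))"
    by (intro pt_basic pt_rev)
  moreover have "rev (if fst (foldl S (b, a) l) then True # snd (foldl S (b, a) l) else snd (foldl S (b, a) l))
      = rev a @ (if b then inc_bits l else l)" for b a l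
  proof (induction l arbitrary: a b)
    case (Cons e l)
    have "S (b, a) e = (b \<and> e, (b \<noteq> e) # a)" by (simp add: S_def)
    then show ?case using Cons.IH[of "b \<and> e" "(b \<noteq> e) # a"] by (cases e; cases b) (simp_all cong del: if_weak_cong)
  qed auto
  ultimately show ?thesis by simp
qed

text \<open>Counting up from 0 in binary; \<open>n\<close> rounds are affordable because
  \<open>n\<close> is given in unary.\<close>

lemma pt_nat_bits:
  assumes "pt n" shows "pt (\<lambda>x. nat_bits (n x))"
proof -
  have inc: "sz (inc_bits l) \<le> sz l + 4" for l
    by (induction l rule: inc_bits.induct) auto
  have "pt (\<lambda>x. (inc_bits ^^ n x) [])"
    by (rule pt_funpow[where p = "[:4:]"]) (auto intro!: pt_basic pt_inc_bits assms inc)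
  moreover have "(inc_bits ^^ m) [] = nat_bits m" for m
    by (induction m) (auto simp: nat_bits_Suc nat_bits.simps[of 0])
  ultimately show ?thesis by simp
qed

lemma pt_mark_bits:
  assumes "pt f" shows "pt (\<lambda>x. mark_bits (f x))"
  unfolding mark_bits_def by (intro pt_concat pt_map assms pt_basic)

lemma pt_encode_nat:
  assumes "pt n" shows "pt (\<lambda>x. encode_int (int (n x)))"
proof -
  have "pt (\<lambda>x. mark_bits (nat_bits (n x)) @ [False, False])"
    by (intro pt_append pt_mark_bits pt_nat_bits pt_basic assms)
  then show ?thesis by (simp add: encode_int_def)
qed

lemmas pt_intros = pt_basic pt_rev pt_append pt_map pt_filter pt_concat pt_list_ex pt_list_all pt_length pt_add pt_mult
  pt_diff pt_le pt_less pt_eq_nat pt_bools_eq pt_upt pt_replicate pt_poly pt_nat_bits pt_mark_bits pt_encode_nat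

section \<open>A polynomial-time verifier for the complement of the problem\<close>

section \<open>Membership in co-NP\<close>

subsection \<open>Parsing\<close>

type_synonym token = "bool \<times> bool list"  \<comment> \<open>sign and binary digits\<close>

definition tok_of :: "int \<Rightarrow> token" where
  "tok_of z = (z < 0, nat_bits (nat \<bar>z\<bar>))"

definition enc_tok :: "token \<Rightarrow> bool list" where
  "enc_tok t = (if fst t then [False, True] else []) @ mark_bits (snd t) @ [False, False]"

lemma enc_tok_of: "enc_tok (tok_of z) = encode_int z"
  by (simp add: enc_tok_def tok_of_def encode_int_def)

text \<open>Bits are read in twos: \<open>[True, b]\<close> is a digit, \<open>[False, True]\<close>
  the sign, \<open>[False, False]\<close> the end of a number. The state holds a pending first bit,
  the current token with reversed digits, and the finished tokens, latest first.\<close>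

definition tok_step :: "bool list \<times> token \<times> token list \<Rightarrow> bool \<Rightarrow> bool list \<times> token \<times> token list" where
  "tok_step st e = (case fst st of
     [] \<Rightarrow> ([e], snd st)
   | h # _ \<Rightarrow> (if h then ([], (fst (fst (snd st)), e # snd (fst (snd st))), snd (snd st))
      else if e then ([], (True, snd (fst (snd st))), snd (snd st))
      else ([], (False, []), fst (snd st) # snd (snd st))))"

definition tokens :: "bool list \<Rightarrow> token list" where
  "tokens x = rev (map (\<lambda>t. (fst t, rev (snd t))) (snd (snd (foldl tok_step ([], (False, []), []) x))))"

lemma tok_step_mark: "foldl tok_step ([], (s, c), d) (mark_bits b) = ([], (s, rev b @ c), d)"
  by (induction b arbitrary: c) (auto simp: mark_bits_def tok_step_def)

lemma tok_step_enc_tok: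
  "foldl tok_step ([], (False, []), d) (enc_tok t) = ([], (False, []), (fst t, rev (snd t)) # d)"
  by (auto simp: enc_tok_def tok_step_mark) (auto simp: tok_step_def tok_step_mark)

lemma tokens_enc: "tokens (concat (map enc_tok ts)) = ts"
proof -
  have "foldl tok_step ([], (False, []), d) (concat (map enc_tok ts)) =
     ([], (False, []), rev (map (\<lambda>t. (fst t, rev (snd t))) ts) @ d)" for d
    by (induction ts arbitrary: d) (auto simp: tok_step_enc_tok)
  then show ?thesis by (simp add: tokens_def comp_def rev_map)
qed

lemma pt_tokens: "pt tokens"
proof -
  have "pt (\<lambda>x. foldl tok_step ([], (False, []), []) x)"
    by (rule pt_foldl[where p = "[:20:]"]) (unfold tok_step_def, auto intro!: pt_basic split: list.splits)
  then show ?thesis unfolding tokens_def by (intro pt_intros)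
qed

text \<open>The first flag says that the separator has been passed, the second that the next bit is
  the one announced by a mark.\<close>

definition unpair_step :: "(bool \<times> bool) \<times> bool list \<times> bool list \<Rightarrow> bool \<Rightarrow> (bool \<times> bool) \<times> bool list \<times> bool list" where
  "unpair_step st e = (if fst (fst st) then (fst st, fst (snd st), e # snd (snd st))
     else if snd (fst st) then ((False, False), e # fst (snd st), snd (snd st))
     else if e then ((False, True), snd st) else ((True, False), snd st))"

definition unpair :: "bool list \<Rightarrow> bool list \<times> bool list" where
  "unpair z = (rev (fst (snd (foldl unpair_step ((False, False), [], []) z))),
     rev (snd (snd (foldl unpair_step ((False, False), [], []) z))))"

lemma unpair_encode_pair: "unpair (encode_pair x y) = (x, y)"
proof -
  have 1: "foldl unpair_step ((False, False), a, b) (mark_bits x) = ((False, False), rev x @ a, b)" for a b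
    by (induction x arbitrary: a) (auto simp: mark_bits_def unpair_step_def)
  have 2: "foldl unpair_step ((True, False), a, b) y = ((True, False), a, rev y @ b)" for a b
    by (induction y arbitrary: b) (auto simp: unpair_step_def)
  have 3: "unpair_step ((False, False), a, b) False = ((True, False), a, b)" for a b
    by (simp add: unpair_step_def)
  show ?thesis by (simp add: unpair_def encode_pair_def 1 2 3)
qed

lemma pt_unpair: "pt unpair"
proof -
  have "pt (\<lambda>x. foldl unpair_step ((False, False), [], []) x)"
    by (rule pt_foldl[where p = "[:20:]"]) (unfold unpair_step_def, auto intro!: pt_basic)
  then show ?thesis unfolding unpair_def by (intro pt_intros)
qed

definition pair_step :: "token list \<times> (token \<times> token) list \<Rightarrow> token \<Rightarrow> token list \<times> (token \<times> token) list" where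
  "pair_step st e = (case fst st of [] \<Rightarrow> ([e], snd st) | h # _ \<Rightarrow> ([], (h, e) # snd st))"

definition pair_up :: "token list \<Rightarrow> (token \<times> token) list" where
  "pair_up ts = rev (snd (foldl pair_step ([], []) ts))"

definition unpair_up :: "(token \<times> token) list \<Rightarrow> token list" where
  "unpair_up ps = concat (map (\<lambda>p. [fst p, snd p]) ps)"

lemma pair_up_unpair_up: "pair_up (unpair_up ps) = ps"
proof -
  have "foldl pair_step ([], d) (unpair_up ps) = ([], rev ps @ d)" for d
    by (induction ps arbitrary: d) (auto simp: unpair_up_def pair_step_def)
  then show ?thesis by (simp add: pair_up_def)
qed

lemma pt_pair_up: "pt pair_up"
proof -
  have "pt (\<lambda>x. foldl pair_step ([], []) x)"
    by (rule pt_foldl[where p = "[:20, 1:]"]) (unfold pair_step_def, auto intro!: pt_basic split: list.splits)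
  then show ?thesis unfolding pair_up_def by (intro pt_intros)
qed

lemma pt_unpair_up: "pt unpair_up"
  unfolding unpair_up_def by (intro pt_intros)

subsection \<open>Instances as token lists\<close>

definition itok :: "instr \<Rightarrow> token \<times> token" where
  "itok u = (tok_of (instr_code u ! 0), tok_of (instr_code u ! 1))"

definition form :: "instr \<Rightarrow> nat" where
  "form u = nat (instr_code u ! 0)"

definition num :: "instr \<Rightarrow> nat" where
  "num u = nat (instr_code u ! 1)"

text \<open>The most significant digit comes last, so this excludes leading zeros.\<close>

definition canon :: "bool list \<Rightarrow> bool" where
  "canon b \<longleftrightarrow> (case rev b of [] \<Rightarrow> True | h # _ \<Rightarrow> h)"

definition isf :: "token \<times> token \<Rightarrow> nat list \<Rightarrow> bool" where
  "isf p ks \<longleftrightarrow> \<not> fst (fst p) \<and> list_ex (\<lambda>k. snd (fst p) = nat_bits k) ks"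

text \<open>The three lines are the instructions with a register number, which must be positive;
  those without a number, whose second integer is -1; and the jumps, which admit any natural
  number.\<close>

definition valid_pair :: "token \<times> token \<Rightarrow> bool" where
  "valid_pair p \<longleftrightarrow>
     isf p [0, 3, 4, 5, 6, 9, 10, 11, 12, 15, 16, 17] \<and> \<not> fst (snd p) \<and> canon (snd (snd p)) \<and> snd (snd p) \<noteq> [] \<or>
     isf p [1, 2, 7, 8, 13, 14, 19] \<and> fst (snd p) \<and> snd (snd p) = [True] \<or>
     isf p [18] \<and> \<not> fst (snd p) \<and> canon (snd (snd p))"

lemma pt_canon: "pt canon"
  unfolding canon_def by (intro pt_intros)

lemma pt_isf: "pt p \<Longrightarrow> pt (\<lambda>x. isf (p x) ks)"
proof -
  have "pt (\<lambda>p. isf p ks)" unfolding isf_def by (intro pt_intros)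
  then show "pt p \<Longrightarrow> pt (\<lambda>x. isf (p x) ks)" by (rule pt_comp)
qed

lemma pt_valid_pair: "pt valid_pair"
  unfolding valid_pair_def by (intro pt_intros pt_isf pt_comp[OF pt_canon])

lemma nat_bits_0: "nat_bits 0 = []"
  by (simp add: nat_bits.simps)

lemma nat_bits_eq: "nat_bits a = nat_bits b \<longleftrightarrow> a = b"
  using nat_bits_inject by blast

lemma nat_bits_1: "nat_bits 1 = [True]"
  by (simp add: nat_bits.simps)

lemma canon_nat_bits: "canon (nat_bits n)"
proof (induction n rule: less_induct)
  case (less n)
  show ?case
  proof (cases "n \<le> 1")
    case True
    then have "n = 0 \<or> n = 1" by auto
    then show ?thesis by (auto simp: canon_def nat_bits_0 nat_bits_1[simplified])
  next
    case False
    then have "nat_bits (n div 2) \<noteq> []" using nat_bits_eq[of "n div 2" 0] by (auto simp: nat_bits_0)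
    moreover have "canon (nat_bits (n div 2))" using False by (intro less.IH) simp
    moreover have "nat_bits n = odd n # nat_bits (n div 2)" using False by (simp add: nat_bits.simps[of n])
    ultimately show ?thesis by (auto simp: canon_def split: list.splits)
  qed
qed

lemma canon_imp_nat_bits: "canon b \<Longrightarrow> \<exists>n. b = nat_bits n"
proof (induction b)
  case Nil
  then show ?case using nat_bits_0 by metis
next
  case (Cons a b)
  show ?case
  proof (cases "b = []")
    case True
    then have "a" using Cons.prems by (simp add: canon_def)
    then show ?thesis using True nat_bits_1 by (metis (full_types))
  next
    case False
    then have "canon b" using Cons.prems by (cases "rev b") (auto simp: canon_def)
    then obtain n where n: "b = nat_bits n" using Cons.IH by blast
    with False have "n \<noteq> 0" by (cases n) (auto simp: nat_bits_0)
    then have "a # b = nat_bits (2 * n + (if a then 1 else 0))"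
      using n by (simp add: nat_bits.simps[of "2 * n"] nat_bits.simps[of "Suc (2 * n)"])
    then show ?thesis by blast
  qed
qed

lemma isf_itok: "isf (itok u) ks \<longleftrightarrow> form u \<in> set ks"
proof -
  have "instr_code u ! 0 \<ge> 0" using basic_form_bounds by (cases u) (auto intro: add_nonneg_nonneg)
  then show ?thesis by (auto simp: isf_def itok_def tok_of_def form_def nat_bits_eq list_ex_iff)
qed

lemma valid_pair_itok: "valid_instr u \<Longrightarrow> valid_pair (itok u)"
proof -
  assume v: "valid_instr u"
  note simps = form_def itok_def tok_of_def canon_nat_bits nat_bits_1[simplified] nat_bits_eq[of _ 0, unfolded nat_bits_0]
  show ?thesis
  proof (cases u)
    case (Plain a)
    then show ?thesis using v unfolding valid_pair_def isf_itok by (cases a) (auto simp: simps)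
  next
    case (PosTest a)
    then show ?thesis using v unfolding valid_pair_def isf_itok by (cases a) (auto simp: simps)
  next
    case (NegTest a)
    then show ?thesis using v unfolding valid_pair_def isf_itok by (cases a) (auto simp: simps)
  qed (unfold valid_pair_def isf_itok, auto simp: simps)
qed

lemma valid_pair_imp_itok:
  assumes "valid_pair p" shows "\<exists>u. valid_instr u \<and> p = itok u"
proof -
  have p: "p = ((fst (fst p), snd (fst p)), (fst (snd p), snd (snd p)))" by simp
  consider k n where "k \<in> set [0, 3, 4, 5, 6, 9, 10, 11, 12, 15, 16, 17]" "p = ((False, nat_bits k), (False, nat_bits n))" "n \<ge> 1"
    | k where "k \<in> set [1, 2, 7, 8, 13, 14, 19]" "p = ((False, nat_bits k), (True, [True]))"
    | n where "p = ((False, nat_bits 18), (False, nat_bits n))"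
  proof -
    from assms[unfolded valid_pair_def] show thesis
    proof (elim disjE conjE)
      assume 1: "isf p [0, 3, 4, 5, 6, 9, 10, 11, 12, 15, 16, 17]" "\<not> fst (snd p)" "canon (snd (snd p))" "snd (snd p) \<noteq> []"
      obtain n where "snd (snd p) = nat_bits n" using canon_imp_nat_bits[OF 1(3)] by blast
      moreover obtain k where "k \<in> set [0, 3, 4, 5, 6, 9, 10, 11, 12, 15, 16, 17]" "snd (fst p) = nat_bits k" "\<not> fst (fst p)"
        using 1(1) unfolding isf_def list_ex_iff by blast
      moreover from calculation 1 have "n \<ge> 1" by (cases n) (auto simp: nat_bits_0)
      ultimately show thesis using p 1(2) that(1) by metis
    next
      assume 1: "isf p [1, 2, 7, 8, 13, 14, 19]" "fst (snd p)" "snd (snd p) = [True]"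
      obtain k where "k \<in> set [1, 2, 7, 8, 13, 14, 19]" "snd (fst p) = nat_bits k" "\<not> fst (fst p)"
        using 1(1) unfolding isf_def list_ex_iff by blast
      then show thesis using p 1(2,3) that(2) by metis
    next
      assume 1: "isf p [18]" "\<not> fst (snd p)" "canon (snd (snd p))"
      obtain n where "snd (snd p) = nat_bits n" using canon_imp_nat_bits[OF 1(3)] by blast
      then show thesis using p 1(1,2) that(3) unfolding isf_def list_ex_iff by auto
    qed
  qed
  then show ?thesis
  proof cases
    case (1 k n)
    let ?U = "{Plain (InGet n), Plain (AuxGet n), Plain (AuxSet n False), Plain (AuxSet n True),
        PosTest (InGet n), PosTest (AuxGet n), PosTest (AuxSet n False), PosTest (AuxSet n True),
        NegTest (InGet n), NegTest (AuxGet n), NegTest (AuxSet n False), NegTest (AuxSet n True)}"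
    have "\<exists>u \<in> ?U.
        instr_code u = [int k, int n]"
      using 1(1) by auto
    moreover have "valid_instr u" if "u \<in> ?U" for u
      using that 1(3) by auto
    ultimately obtain u where u: "instr_code u = [int k, int n]" "valid_instr u" by blast
    then have "p = itok u" using 1(2) by (simp add: itok_def tok_of_def)
    with u show ?thesis by blast
  next
    case (2 k)
    let ?U = "{Plain (OutSet False), Plain (OutSet True), PosTest (OutSet False), PosTest (OutSet True),
        NegTest (OutSet False), NegTest (OutSet True), Halt}"
    have "\<exists>u \<in> ?U. instr_code u = [int k, -1]"
      using 2(1) by auto
    moreover have "valid_instr u" if "u \<in> ?U" for u
      using that by auto
    ultimately obtain u where u: "instr_code u = [int k, -1]" "valid_instr u" by blast
    then have "p = itok u" using 2(2) by (simp add: itok_def tok_of_def nat_bits_1[simplified])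
    with u show ?thesis by blast
  next
    case (3 n)
    then have "p = itok (Jump n)" by (simp add: itok_def tok_of_def)
    then show ?thesis by (intro exI[of _ "Jump n"]) simp
  qed
qed

text \<open>The parser never fails, so malformed strings are detected by encoding what was parsed
  and comparing the result with \<open>x\<close>.\<close>

definition wf_input :: "bool list \<Rightarrow> bool" where
  "wf_input x \<longleftrightarrow> (case tokens x of [] \<Rightarrow> False | t # ts \<Rightarrow>
     \<not> fst t \<and> snd t \<noteq> [] \<and> canon (snd t) \<and> list_all valid_pair (pair_up ts) \<and>
     x = concat (map enc_tok (t # unpair_up (pair_up ts))))"

definition input_n :: "bool list \<Rightarrow> bool list" where
  "input_n x = (case tokens x of [] \<Rightarrow> [] | t # ts \<Rightarrow> snd t)"

definition input_X :: "bool list \<Rightarrow> (token \<times> token) list" where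
  "input_X x = (case tokens x of [] \<Rightarrow> [] | t # ts \<Rightarrow> pair_up ts)"

lemma encode_instance_tok:
  "encode_instance (n, X) = concat (map enc_tok (tok_of (int n) # unpair_up (map itok X)))"
proof -
  have "map encode_int (instr_code u) = [enc_tok (fst (itok u)), enc_tok (snd (itok u))]" for u
    by (cases u) (simp_all add: itok_def enc_tok_of)
  then have "map encode_int (concat (map instr_code X)) = map enc_tok (unpair_up (map itok X))"
    by (induction X) (simp_all add: unpair_up_def)
  then show ?thesis by (simp add: encode_instance_def enc_tok_of)
qed

lemma tokens_encode_instance: "tokens (encode_instance (n, X)) = tok_of (int n) # unpair_up (map itok X)"
  unfolding encode_instance_tok by (rule tokens_enc)

lemma input_encode_instance:
  "input_n (encode_instance (n, X)) = nat_bits n" "input_X (encode_instance (n, X)) = map itok X"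
  unfolding input_n_def input_X_def tokens_encode_instance by (simp_all add: tok_of_def pair_up_unpair_up)

lemma wf_input_iff: "wf_input x \<longleftrightarrow> (\<exists>n X. n \<ge> 1 \<and> X \<in> IS \<and> x = encode_instance (n, X))"
proof
  assume "wf_input x"
  then obtain t ts where *: "\<not> fst t" "snd t \<noteq> []" "canon (snd t)" "list_all valid_pair (pair_up ts)"
    "x = concat (map enc_tok (t # unpair_up (pair_up ts)))"
    unfolding wf_input_def by (auto split: list.splits)
  obtain n where n: "snd t = nat_bits n" using canon_imp_nat_bits[OF *(3)] by blast
  have "\<exists>X. set X \<subseteq> Collect valid_instr \<and> map itok X = ps" if "list_all valid_pair ps" for ps
    using that
  proof (induction ps)
    case (Cons p ps)
    then obtain X where "set X \<subseteq> Collect valid_instr" "map itok X = ps" by auto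
    moreover obtain u where "valid_instr u" "p = itok u" using valid_pair_imp_itok[of p] Cons.prems by auto
    ultimately show ?case by (intro exI[of _ "u # X"]) auto
  qed simp
  from this[OF *(4)] obtain X where X: "set X \<subseteq> Collect valid_instr" "map itok X = pair_up ts" by blast
  have "t = tok_of (int n)" using *(1) n by (cases t) (simp add: tok_of_def)
  moreover have "n \<ge> 1" using *(2) n by (cases n) (auto simp: nat_bits_0)
  ultimately show "\<exists>n X. n \<ge> 1 \<and> X \<in> IS \<and> x = encode_instance (n, X)"
    using X *(5) by (intro exI[of _ n] exI[of _ X]) (auto simp: encode_instance_tok IS_def)
next
  assume "\<exists>n X. n \<ge> 1 \<and> X \<in> IS \<and> x = encode_instance (n, X)"
  then obtain n X where *: "n \<ge> 1" "X \<in> IS" "x = encode_instance (n, X)" by blast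
  then show "wf_input x"
    unfolding wf_input_def *(3) tokens_encode_instance
    using valid_pair_itok nat_bits_eq[of n 0]
    by (auto simp: pair_up_unpair_up encode_instance_tok canon_nat_bits tok_of_def list_all_iff IS_def nat_bits_0)
qed

lemma pt_enc_tok: "pt enc_tok"
  unfolding enc_tok_def by (intro pt_intros)

lemma pt_wf_input: "pt wf_input"
  unfolding wf_input_def
  by (intro pt_intros pt_comp[OF pt_tokens] pt_comp[OF pt_canon] pt_comp[OF pt_valid_pair]
      pt_comp[OF pt_pair_up] pt_comp[OF pt_unpair_up] pt_comp[OF pt_enc_tok])

lemma pt_input_n: "pt input_n"
  unfolding input_n_def by (intro pt_intros pt_comp[OF pt_tokens])

lemma pt_input_X: "pt input_X"
  unfolding input_X_def by (intro pt_intros pt_comp[OF pt_tokens] pt_comp[OF pt_pair_up])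

subsection \<open>Executing an instruction sequence\<close>

text \<open>Converts binary to unary by search below a cutoff, since the number denoted may be
  exponential. Values above \<open>L\<close> become 0, which callers treat as the exceptional
  case.\<close>

definition lookup :: "nat \<Rightarrow> bool list \<Rightarrow> nat" where
  "lookup L b = foldl (\<lambda>acc i. if nat_bits i = b then i else acc) 0 [0..<Suc L]"

lemma lookup_nat_bits: "lookup L (nat_bits m) = (if m \<le> L then m else 0)"
proof -
  have "foldl (\<lambda>acc i. if nat_bits i = nat_bits m then i else acc) a is = (if m \<in> set is then m else a)" for a "is"
    by (induction "is" arbitrary: a) (auto simp: nat_bits_eq)
  then show ?thesis unfolding lookup_def by (simp del: upt_Suc add: less_Suc_eq_le)
qed

lemma lookup_le: "lookup L b \<le> L"
proof -
  have "foldl (\<lambda>acc i. if nat_bits i = b then i else acc) a is \<le> L"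
    if "a \<le> L" "\<forall>i \<in> set is. i \<le> L" for a "is"
    using that by (induction "is" arbitrary: a) auto
  then show ?thesis unfolding lookup_def by (auto simp del: upt_Suc)
qed

lemma pt_lookup0: "pt (\<lambda>z. lookup (snd z) (fst z))"
  unfolding lookup_def by (rule pt_foldl[where p = "[:0, 1:]"]) (auto intro!: pt_intros simp del: upt_Suc)

lemmas pt_lookup = pt_comp2[OF pt_lookup0]

definition has :: "bool list list \<Rightarrow> bool list \<Rightarrow> bool" where
  "has T b \<longleftrightarrow> list_ex (\<lambda>t. t = b) T"

lemma has_iff: "has T b \<longleftrightarrow> b \<in> set T"
  by (auto simp: has_def list_ex_iff)

lemma pt_has0: "pt (\<lambda>z. has (snd z) (fst z))"
  unfolding has_def by (intro pt_intros)

lemmas pt_has = pt_comp2[OF pt_has0]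

text \<open>
  The state consists of a termination flag, the number of instructions to be skipped, the content of
  the output register, and the auxiliary registers with content 1. Since all jumps are forward, one
  pass over the instruction sequence suffices. The context consists of the input registers with
  content 1 and the length of the instruction sequence.
\<close>

type_synonym istate = "bool \<times> nat \<times> bool \<times> bool list list"

definition irep :: "bool list list \<times> nat \<Rightarrow> istate \<Rightarrow> token \<times> token \<Rightarrow> bool" where
  "irep c st p \<longleftrightarrow> isf p [0, 6, 12] \<and> has (fst c) (snd (snd p)) \<or> isf p [2, 8, 14] \<or>
     isf p [3, 9, 15] \<and> has (snd (snd (snd st))) (snd (snd p)) \<or> isf p [5, 11, 17]"

text \<open>Skipping \<open>Suc (snd c)\<close> instructions passes the end of the sequence. This
  stands for inaction and for termination, which the flag of the state tells apart. A jump length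
  above the cutoff is read as 0, rightly so, because both lead to inaction.\<close>

definition iskip :: "bool list list \<times> nat \<Rightarrow> istate \<Rightarrow> token \<times> token \<Rightarrow> nat" where
  "iskip c st p =
     (if isf p [6, 7, 8, 9, 10, 11] then (if irep c st p then 0 else 1)
      else if isf p [12, 13, 14, 15, 16, 17] then (if irep c st p then 1 else 0)
      else if isf p [18] then (if lookup (snd c) (snd (snd p)) = 0 then Suc (snd c) else lookup (snd c) (snd (snd p)) - 1)
      else if isf p [19] then Suc (snd c) else 0)"

definition iout :: "istate \<Rightarrow> token \<times> token \<Rightarrow> bool" where
  "iout st p = (if isf p [2, 8, 14] then True else if isf p [1, 7, 13] then False else fst (snd (snd st)))"

definition iaux :: "istate \<Rightarrow> token \<times> token \<Rightarrow> bool list list" where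
  "iaux st p = (if isf p [5, 11, 17] then snd (snd p) # snd (snd (snd st))
     else if isf p [4, 10, 16] then filter (\<lambda>b. b \<noteq> snd (snd p)) (snd (snd (snd st)))
     else snd (snd (snd st)))"

definition istep :: "bool list list \<times> nat \<Rightarrow> istate \<Rightarrow> token \<times> token \<Rightarrow> istate" where
  "istep c st p = (if 0 < fst (snd st) then (fst st, fst (snd st) - 1, snd (snd st))
     else (fst st \<or> isf p [19], iskip c st p, iout st p, iaux st p))"

definition isim :: "bool list list \<times> nat \<Rightarrow> (token \<times> token) list \<Rightarrow> istate" where
  "isim c ps = foldl (istep c) (False, 0, False, []) ps"

lemma pt_istep: "pt (\<lambda>z. istep (snd z) (snd (fst z)) (fst (fst z)))"
  unfolding istep_def iskip_def iout_def iaux_def irep_def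
  by (intro pt_intros pt_isf pt_has pt_lookup)

lemma sz_filter: "sz (filter P l) \<le> sz l"
  by (induction l) auto

lemma pt_isim0: "pt (\<lambda>z. isim (snd z) (fst z))"
  unfolding isim_def
proof (rule pt_foldl[where p = "[:20, 3:]"])
  show "pt (\<lambda>z. istep (snd (snd z)) (snd (fst z)) (fst (fst z)))"
    by (intro pt_comp3[OF pt_istep] pt_intros)
  show "sz (istep (snd x) st p) \<le> sz st + poly [:20, 3:] (sz x + sz p)"
    for x :: "(token \<times> token) list \<times> bool list list \<times> nat" and st p
  proof -
    obtain h k b aux where st: "st = (h, k, b, aux)" by (metis surj_pair)
    obtain ps T L where x: "x = (ps, T, L)" by (metis surj_pair)
    obtain f s v where p: "p = (f, s, v)" by (metis surj_pair)
    \<comment> \<open>Owing to the cutoff in \<open>lookup\<close>, the skip count is bounded by the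
      context, although jump lengths are binary; this gives the additive growth that
      \<open>pt_foldl\<close> requires.\<close>
    have 1: "iskip (T, L) st p \<le> Suc L" using lookup_le[of L v] by (auto simp: iskip_def p le_diff_conv)
    have 2: "sz (iaux st p) \<le> sz aux + sz v + 1"
      using sz_filter[of "\<lambda>b. b \<noteq> v" aux] by (auto simp: iaux_def st p)
    show ?thesis
    proof (cases "0 < k")
      case True
      then show ?thesis by (auto simp: istep_def st)
    next
      case False
      have "sz (istep (T, L) st p) \<le> 3 + (2 * iskip (T, L) st p + 1) + 3 + sz (iaux st p) + 3"
        using False by (simp add: istep_def st)
      also have "\<dots> \<le> sz st + poly [:20, 3:] (sz x + sz p)"
        using 1 2 False by (simp add: st x p)
      finally show ?thesis by (simp add: x)
    qed
  qed
qed (intro pt_intros)+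

lemmas pt_isim = pt_comp2[OF pt_isim0]

lemma exec_out_of_range: "exec X i s s' \<Longrightarrow> i < length X"
  by (erule exec.cases) auto

lemma exec_iff:
  assumes "i < length X"
  shows "exec X i s s' \<longleftrightarrow> (case X ! i of
      Halt \<Rightarrow> s' = s
    | Plain a \<Rightarrow> exec X (i + 1) (effect a s) s'
    | PosTest a \<Rightarrow> exec X (if reply a s then i + 1 else i + 2) (effect a s) s'
    | NegTest a \<Rightarrow> exec X (if reply a s then i + 2 else i + 1) (effect a s) s'
    | Jump l \<Rightarrow> l > 0 \<and> exec X (i + l) s s')" (is "_ \<longleftrightarrow> ?R")
proof
  assume "exec X i s s'"
  then show ?R by cases simp_all
qed (use assms in \<open>auto split: instr.splits intro: exec.intros\<close>)

text \<open>A superset of the register numbers in \<open>X\<close>, as it also contains the jump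
  lengths. The value 0 is what \<open>num\<close> yields for the entry -1; it is no valid register
  number.\<close>

definition nums :: "instr list \<Rightarrow> nat set" where
  "nums X = num ` set X - {0}"

text \<open>Registers outside \<open>nums X\<close> are left free, so states that differ only there
  share one simulated run.\<close>

definition matches :: "instr list \<Rightarrow> bool list list \<Rightarrow> bool \<Rightarrow> bool list list \<Rightarrow> reg_state \<Rightarrow> bool" where
  "matches X T b aux s \<longleftrightarrow> s Out = b \<and>
     (\<forall>a \<in> nums X. (s (In a) \<longleftrightarrow> nat_bits a \<in> set T) \<and> (s (Aux a) \<longleftrightarrow> nat_bits a \<in> set aux))"

lemma istep_basic:
  assumes "matches X T b aux s" "u \<in> set X" "valid_instr u" "u = Plain a \<or> u = PosTest a \<or> u = NegTest a"
  defines "st \<equiv> (False, 0, b, aux)"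
  shows "irep (T, L) st (itok u) = reply a s" "matches X T (iout st (itok u)) (iaux st (itok u)) (effect a s)"
proof -
  have n: "num u \<noteq> 0 \<Longrightarrow> num u \<in> nums X" using assms(2) by (auto simp: nums_def)
  have fu: "form u \<in> {nat (basic_form a), nat (basic_form a) + 6, nat (basic_form a) + 12}"
    using assms(4) basic_form_bounds[of a] by (auto simp: form_def)
  show "irep (T, L) st (itok u) = reply a s"
  proof (cases a)
    case (InGet i)
    then have "snd (snd (itok u)) = nat_bits i" "num u = i" "i \<noteq> 0"
      using assms(3,4) by (auto simp: itok_def tok_of_def num_def)
    moreover from this have "s (In i) = (nat_bits i \<in> set T)" using n assms(1) unfolding matches_def by blast
    moreover have "form u \<in> {0, 6, 12}" using fu InGet by simp
    ultimately show ?thesis using InGet by (auto simp: irep_def isf_itok has_iff)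
  next
    case (OutSet v)
    then show ?thesis using fu by (auto simp: irep_def isf_itok split: if_splits)
  next
    case (AuxGet i)
    then have "snd (snd (itok u)) = nat_bits i" "num u = i" "i \<noteq> 0"
      using assms(3,4) by (auto simp: itok_def tok_of_def num_def)
    moreover from this have "s (Aux i) = (nat_bits i \<in> set aux)" using n assms(1) unfolding matches_def by blast
    moreover have "form u \<in> {3, 9, 15}" using fu AuxGet by simp
    ultimately show ?thesis using AuxGet by (auto simp: st_def irep_def isf_itok has_iff)
  next
    case (AuxSet i v)
    then show ?thesis using fu by (auto simp: irep_def isf_itok split: if_splits)
  qed
  show "matches X T (iout st (itok u)) (iaux st (itok u)) (effect a s)"
  proof (cases a)
    case (InGet i)
    then have "form u \<in> {0, 6, 12}" using fu by simp
    then have "iout st (itok u) = b" "iaux st (itok u) = aux"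
      unfolding iout_def iaux_def isf_itok st_def by auto
    then show ?thesis using InGet assms(1) by simp
  next
    case (OutSet v)
    then have "form u \<in> (if v then {2, 8, 14} else {1, 7, 13})" using fu by auto
    then have "iout st (itok u) = v" "iaux st (itok u) = aux"
      unfolding iout_def iaux_def isf_itok st_def by (auto split: if_splits)
    then show ?thesis using OutSet assms(1) by (simp add: matches_def)
  next
    case (AuxGet i)
    then have "form u \<in> {3, 9, 15}" using fu by simp
    then have "iout st (itok u) = b" "iaux st (itok u) = aux"
      unfolding iout_def iaux_def isf_itok st_def by auto
    then show ?thesis using AuxGet assms(1) by simp
  next
    case (AuxSet i v)
    then have d: "snd (snd (itok u)) = nat_bits i" using assms(4) by (auto simp: itok_def tok_of_def)
    have "form u \<in> (if v then {5, 11, 17} else {4, 10, 16})" using fu AuxSet by auto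
    then have "iout st (itok u) = b"
      "iaux st (itok u) = (if v then nat_bits i # aux else filter (\<lambda>b. b \<noteq> nat_bits i) aux)"
      unfolding iout_def iaux_def isf_itok st_def d by (auto split: if_splits)
    then show ?thesis using AuxSet assms(1) by (auto simp: matches_def nat_bits_eq)
  qed
qed

lemma istep_skip: "fst (snd st) \<ge> length ps \<Longrightarrow>
    fst (foldl (istep c) st ps) = fst st \<and> snd (snd (foldl (istep c) st ps)) = snd (snd st)"
proof (induction ps arbitrary: st)
  case (Cons p ps)
  then have "fst (snd (istep c st p)) \<ge> length ps" "fst (istep c st p) = fst st" "snd (snd (istep c st p)) = snd (snd st)"
    by (auto simp: istep_def)
  with Cons.IH[of "istep c st p"] show ?case by simp
qed simp

text \<open>The invariant of the pass: it has reached position \<open>j\<close> with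
  \<open>k\<close> instructions left to skip while execution stands at \<open>j + k\<close>. If the
  latter lies behind the end, execution does not terminate, and the pass ends with the flag
  unset.\<close>

lemma isim_exec_aux:
  assumes "X \<in> IS" "matches X T b aux s" "j \<le> length X"
  shows "(let fin = foldl (istep (T, length X)) (False, k, b, aux) (map itok (drop j X)) in
      fst fin \<and> fst (snd (snd fin)) = v) \<longleftrightarrow> (\<exists>s'. exec X (j + k) s s' \<and> s' Out = v)"
  using assms(2,3)
proof (induction "length X - j" arbitrary: j k b aux s)
  case 0
  then show ?case using exec_out_of_range[of X "j + k" s] by fastforce
next
  case (Suc m)
  then have j: "j < length X" and m: "m = length X - Suc j" by auto
  let ?L = "length X"
  have dr: "drop j X = X ! j # drop (Suc j) X" using j by (simp add: Cons_nth_drop_Suc)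
  note IH = Suc.hyps(1)[OF m, of _ _ _ "k'" for k']
  show ?case
  proof (cases "0 < k")
    case True
    have "istep (T, ?L) (False, k, b, aux) (itok (X ! j)) = (False, k - 1, b, aux)"
      using True by (simp add: istep_def)
    then show ?thesis using IH[OF Suc.prems(1), of "k - 1"] True j by (simp add: dr)
  next
    case False
    then have k: "k = 0" by simp
    let ?u = "X ! j"
    let ?st = "(False, 0, b, aux)"
    have u: "?u \<in> set X" "valid_instr ?u" using j assms(1) by (auto simp: IS_def)
    have stp: "istep (T, ?L) ?st (itok ?u) = (isf (itok ?u) [19], iskip (T, ?L) ?st (itok ?u), iout ?st (itok ?u), iaux ?st (itok ?u))"
      by (simp add: istep_def)
    have basic: ?thesis if a: "?u = Plain a \<or> ?u = PosTest a \<or> ?u = NegTest a"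
      and ex: "\<And>s'. exec X j s s' \<longleftrightarrow> exec X (Suc j + iskip (T, ?L) ?st (itok ?u)) (effect a s) s'" for a
    proof -
      have "\<not> isf (itok ?u) [19]" using a basic_form_bounds[of a] by (auto simp: isf_itok form_def)
      then show ?thesis
        using IH[OF istep_basic(2)[OF Suc.prems(1) u a], of "iskip (T, ?L) ?st (itok ?u)"] j ex
        by (simp add: dr k stp)
    qed
    show ?thesis
    proof (cases ?u)
      case (Plain a)
      have "iskip (T, ?L) ?st (itok ?u) = 0"
        using basic_form_bounds[of a] Plain by (auto simp: iskip_def isf_itok form_def nat_eq_iff)
      then show ?thesis using Plain by (intro basic[of a]) (auto simp: exec_iff[OF j])
    next
      case (PosTest a)
      have "form ?u \<in> {6, 7, 8, 9, 10, 11}"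
        using basic_form_bounds[of a] PosTest by (auto simp: form_def nat_eq_iff)
      then have "iskip (T, ?L) ?st (itok ?u) = (if reply a s then 0 else 1)"
        using istep_basic(1)[OF Suc.prems(1) u, of a ?L] PosTest by (auto simp: iskip_def isf_itok)
      then show ?thesis using PosTest by (intro basic[of a]) (auto simp: exec_iff[OF j])
    next
      case (NegTest a)
      have "form ?u \<in> {12, 13, 14, 15, 16, 17}"
        using basic_form_bounds[of a] NegTest by (auto simp: form_def nat_eq_iff)
      then have "iskip (T, ?L) ?st (itok ?u) = (if reply a s then 1 else 0)"
        using istep_basic(1)[OF Suc.prems(1) u, of a ?L] NegTest by (auto simp: iskip_def isf_itok)
      then show ?thesis using NegTest by (intro basic[of a]) (auto simp: exec_iff[OF j])
    next
      case (Jump l)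
      have form: "form ?u = 18" "snd (snd (itok ?u)) = nat_bits l" using Jump by (auto simp: form_def itok_def tok_of_def)
      let ?k = "iskip (T, ?L) ?st (itok ?u)"
      have kk: "?k = (if l = 0 \<or> l > ?L then Suc ?L else l - 1)"
        by (simp add: iskip_def isf_itok form lookup_nat_bits)
      have ex: "exec X j s s' \<longleftrightarrow> l > 0 \<and> exec X (j + l) s s'" for s'
        by (simp add: exec_iff[OF j] Jump)
      have "exec X j s s' \<longleftrightarrow> exec X (Suc j + ?k) s s'" for s'
      proof (cases "l = 0 \<or> l > ?L")
        case True
        then have "\<not> exec X (Suc j + ?k) s s'" "\<not> (l > 0 \<and> exec X (j + l) s s')"
          using exec_out_of_range[of X "j + l" s s'] exec_out_of_range[of X "Suc j + ?k" s s'] kk by auto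
        then show ?thesis using ex by blast
      next
        case False
        then have "Suc j + ?k = j + l" "l > 0" using kk by auto
        then show ?thesis using ex by metis
      qed
      moreover have "istep (T, ?L) ?st (itok ?u) = (False, ?k, b, aux)"
        by (simp add: istep_def isf_itok form iout_def iaux_def)
      ultimately show ?thesis using IH[OF Suc.prems(1), of ?k] j by (simp add: dr k)
    next
      case Halt
      have form: "form ?u = 19" using Halt by (auto simp: form_def)
      have "istep (T, ?L) ?st (itok ?u) = (True, Suc ?L, b, aux)"
        by (simp add: istep_def isf_itok form iskip_def iout_def iaux_def)
      moreover have "length (map itok (drop (Suc j) X)) \<le> fst (snd (True, Suc ?L, b, aux))" by simp
      note istep_skip[OF this, of "(T, ?L)"]
      ultimately show ?thesis using Suc.prems(1) Halt by (simp add: dr k exec_iff[OF j] matches_def Let_def)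
    qed
  qed
qed

lemma isim_exec:
  assumes "X \<in> IS" "matches X T False [] s"
  shows "fst (isim (T, length X) (map itok X)) \<and> fst (snd (snd (isim (T, length X) (map itok X)))) = v
    \<longleftrightarrow> (\<exists>s'. exec X 0 s s' \<and> s' Out = v)"
  using isim_exec_aux[OF assms, of 0 0 v] by (simp add: isim_def Let_def)

subsection \<open>The verifier\<close>

lemma tstnz_map_upt: "tstnz (map f [0..<n]) \<longleftrightarrow> (\<exists>i<n. f i)"
  unfolding tstnz_def by (simp cong: conj_cong)

text \<open>If no instruction mentions \<open>In i\<close>, then the zero input and the input with
  only \<open>In i\<close> set match the same empty table. They get the same output from
  \<open>isim\<close>, although \<open>tstnz\<close> separates them.\<close>

lemma too_few_instructions:
  assumes "X \<in> IS" "n > length X"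
  shows "\<not> computes X n tstnz"
proof
  assume "computes X n tstnz"
  then obtain k where k: "\<And>bs s. length bs = n \<Longrightarrow> (\<forall>i \<in> {1..n}. s (In i) = bs ! (i - 1)) \<Longrightarrow>
      s Out = False \<Longrightarrow> (\<forall>i \<in> {1..k}. s (Aux i) = False) \<Longrightarrow> \<exists>s'. exec X 0 s s' \<and> s' Out = tstnz bs"
    unfolding computes_def by blast
  have "card (nums X) < n"
    using assms(2) card_image_le[of "set X" num] card_length[of X]
      card_mono[of "num ` set X" "nums X"] by (auto simp: nums_def)
  then have "\<not> {1..n} \<subseteq> nums X"
    using card_mono[of "nums X" "{1..n}"] by (auto simp: nums_def)
  then obtain i where i: "i \<in> {1..n}" "i \<notin> nums X" by blast
  define s0 :: reg_state where "s0 = (\<lambda>r. False)"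
  define s1 :: reg_state where "s1 = (\<lambda>r. r = In i)"
  let ?b1 = "map (\<lambda>j. Suc j = i) [0..<n]"
  have "\<exists>s'. exec X 0 s0 s' \<and> s' Out = tstnz (replicate n False)"
    by (rule k) (auto simp: s0_def)
  moreover have "\<exists>s'. exec X 0 s1 s' \<and> s' Out = tstnz ?b1"
    by (rule k) (auto simp: s1_def)
  moreover have "\<not> tstnz (replicate n False)" by (simp add: tstnz_def)
  moreover have "tstnz ?b1" using i(1) unfolding tstnz_def by (intro exI[of _ "i - 1"]) auto
  moreover have m: "matches X [] False [] s0" "matches X [] False [] s1"
    using i(2) by (auto simp: matches_def s0_def s1_def)
  ultimately show False using isim_exec[OF assms(1) m(1), of False] isim_exec[OF assms(1) m(2), of True] by auto
qed

text \<open>The length condition for \<open>q = a / b\<close> in natural numbers. For positive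
  \<open>n\<close>, the inner sum is \<open>2 * min_len n\<close>, with the parity taken from the
  lowest binary digit. With \<open>D\<close> the excess of \<open>L\<close> over
  \<open>min_len n + m\<close>, the bound on \<open>D\<close> by the ceiling of
  \<open>a * n / b\<close> means \<open>D - 1 < a * n / b\<close>; this is multiplied by
  \<open>2 * b\<close>. For negative \<open>D\<close> the subtraction truncates to 0 and the test
  succeeds.\<close>

definition len_ok :: "nat \<Rightarrow> nat \<Rightarrow> nat \<Rightarrow> nat \<Rightarrow> nat \<Rightarrow> bool" where
  "len_ok a b m n L \<longleftrightarrow> b * (2 * L - (3 * n + 2 + (case nat_bits n of [] \<Rightarrow> 0 | h # _ \<Rightarrow> if h then 1 else 0)) - 2 * m)
     < 2 * a * n + 2 * b"

lemma len_ok_iff: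
  fixes q :: rat
  assumes "q = of_nat a / of_nat b" "b > 0" "n > 0"
  shows "len_ok a b m n L \<longleftrightarrow> int L \<le> int (min_len n) + \<lceil>q * of_nat n\<rceil> + int m"
proof -
  have "(case nat_bits n of [] \<Rightarrow> 0 | h # _ \<Rightarrow> if h then 1 else 0) = (if odd n then 1 else 0 :: nat)"
    using assms(3) by (simp add: nat_bits.simps[of n])
  then have ml: "3 * n + 2 + (case nat_bits n of [] \<Rightarrow> 0 | h # _ \<Rightarrow> if h then 1 else 0) = 2 * min_len n"
    unfolding min_len_def by (auto elim!: evenE oddE)
  define D where "D = int L - int (min_len n) - int m"
  have eq: "2 * L - 2 * min_len n - 2 * m = nat (2 * D)" by (simp add: D_def)
  have "int L \<le> int (min_len n) + \<lceil>q * of_nat n\<rceil> + int m \<longleftrightarrow> D \<le> \<lceil>q * of_nat n\<rceil>"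
    by (auto simp: D_def)
  also have "\<dots> \<longleftrightarrow> of_int D - 1 < q * of_nat n" by (rule le_ceiling_iff)
  also have "\<dots> \<longleftrightarrow> of_nat b * (of_int D - 1) < (of_nat a * of_nat n :: rat)"
    using pos_less_divide_eq[of "of_nat b" "of_int D - 1" "of_nat a * of_nat n :: rat"] assms(1,2)
    by (simp add: mult.commute)
  also have "\<dots> \<longleftrightarrow> (of_int (int b * (D - 1)) :: rat) < of_int (int a * int n)" by simp
  also have "\<dots> \<longleftrightarrow> int b * (D - 1) < int a * int n" by (rule of_int_less_iff)
  also have "\<dots> \<longleftrightarrow> b * nat (2 * D) < 2 * a * n + 2 * b"
  proof (cases "D \<ge> 0")
    case True
    have c: "b * nat (2 * D) < 2 * a * n + 2 * b \<longleftrightarrow> int (b * nat (2 * D)) < int (2 * a * n + 2 * b)"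
      by (simp only: of_nat_less_iff)
    have d: "int (b * nat (2 * D)) = 2 * (int b * D)" using True by simp
    have e: "int (2 * a * n + 2 * b) = 2 * (int a * int n + int b)" by simp
    have f: "int b * (D - 1) = int b * D - int b" by (simp add: algebra_simps)
    have "x - y < z \<longleftrightarrow> 2 * x < 2 * (z + y)" for x y z :: int by auto
    then show ?thesis unfolding c d e f .
  next
    case False
    then have "int b * (D - 1) < 0" using assms(2) by (simp add: mult_pos_neg)
    moreover have "0 \<le> int a * int n" by simp
    ultimately have "int b * (D - 1) < int a * int n" by linarith
    then show ?thesis using False assms(2) by simp
  qed
  finally show ?thesis unfolding len_ok_def ml eq by simp
qed

text \<open>For well-formed \<open>x\<close>, the test for 0 catches \<open>n > length X\<close>,
  where \<open>lookup\<close> falls back to 0. No condition is put on \<open>y\<close>: any token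
  list describes possible contents of the input registers, and digit strings that denote no number
  simply match no register.\<close>

definition verify :: "nat \<Rightarrow> nat \<Rightarrow> nat \<Rightarrow> bool list \<Rightarrow> bool list \<Rightarrow> bool" where
  "verify a b m x y \<longleftrightarrow> \<not> wf_input x \<or> lookup (length (input_X x)) (input_n x) = 0 \<or>
     \<not> len_ok a b m (lookup (length (input_X x)) (input_n x)) (length (input_X x)) \<or>
     \<not> (fst (isim (map snd (tokens y), length (input_X x)) (input_X x)) \<and>
        fst (snd (snd (isim (map snd (tokens y), length (input_X x)) (input_X x)))) =
        list_ex (\<lambda>i. has (map snd (tokens y)) (nat_bits (Suc i))) [0..<lookup (length (input_X x)) (input_n x)])"

lemma pt_verify: "pt (\<lambda>z. verify a b m (fst z) (snd z))"
  unfolding verify_def len_ok_def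
  by (intro pt_intros pt_comp[OF pt_wf_input] pt_comp[OF pt_input_n] pt_comp[OF pt_input_X] pt_comp[OF pt_tokens]
      pt_lookup pt_isim pt_has)

lemma verify_in_P: "{z. verify a b m (fst (unpair z)) (snd (unpair z))} \<in> class_P"
proof -
  have "pt (\<lambda>z. [verify a b m (fst (unpair z)) (snd (unpair z))])"
    by (intro pt_Cons pt_const pt_comp[OF pt_verify, of unpair] pt_unpair)
  then show ?thesis unfolding class_P_def using pt_polytime by simp
qed

lemma length_nat_bits: "length (nat_bits n) \<le> n"
proof (induction n rule: less_induct)
  case (less n)
  show ?case
  proof (cases "n = 0")
    case False
    then have "length (nat_bits (n div 2)) \<le> n div 2" by (intro less.IH) simp
    moreover have "Suc (n div 2) \<le> n" using False by simp
    ultimately show ?thesis using False by (simp add: nat_bits.simps[of n])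
  qed (simp add: nat_bits_0)
qed

lemma length_mark_bits: "length (mark_bits b) = 2 * length b"
  by (induction b) (auto simp: mark_bits_def)

lemma length_encode_num: "u \<in> set X \<Longrightarrow> length (encode_int (int (num u))) \<le> 2 * length (encode_instance (n, X)) + 2"
proof -
  assume u: "u \<in> set X"
  show ?thesis
  proof (cases "instr_code u ! 1 \<ge> 0")
    case True
    then have "int (num u) \<in> set (instr_code u)"
      using length_instr_code[of u] by (auto simp: num_def in_set_conv_nth intro!: exI[of _ 1])
    then have "int (num u) \<in> set (int n # concat (map instr_code X))" using u by auto
    then have "encode_int (int (num u)) \<in> set (map encode_int (int n # concat (map instr_code X)))"
      unfolding set_map by (rule imageI)
    then have "length (encode_int (int (num u))) \<le> length (encode_instance (n, X))"
      unfolding encode_instance_def prod.case length_concat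
      by (intro member_le_sum_list) auto
    then show ?thesis by simp
  next
    case False
    then show ?thesis by (simp add: num_def encode_int_def mark_bits_def nat_bits_0)
  qed
qed

lemma length_encode_instance: "length X \<le> length (encode_instance (n, X))"
proof -
  have "length zs \<le> length (concat (map encode_int zs))" for zs
  proof (induction zs)
    case (Cons z zs)
    have "length (encode_int z) > 0" using encode_int_nonempty by simp
    then have "Suc (length zs) \<le> length (encode_int z) + length (concat (map encode_int zs))"
      using Cons.IH by linarith
    then show ?case by simp
  qed simp
  from this[of "int n # concat (map instr_code X)"] have "Suc (length (concat (map instr_code X))) \<le> length (encode_instance (n, X))"
    by (simp add: encode_instance_def)
  moreover have "length X \<le> length (concat (map instr_code X))"
    using length_instr_code by (induction X) (auto simp: Suc_le_eq)
  ultimately show ?thesis by simp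
qed

lemma verify_sound:
  assumes q: "q = of_nat a / of_nat b" "b > 0" and v: "verify a b m x y"
  shows "x \<notin> tstnz_problem q m"
proof
  assume "x \<in> tstnz_problem q m"
  then obtain n X where X: "x = encode_instance (n, X)" "n \<ge> 1" "X \<in> IS" "computes X n tstnz"
     "int (length X) \<le> int (min_len n) + \<lceil>q * of_nat n\<rceil> + int m"
    unfolding tstnz_problem_def tstnz_instances_def by auto
  have nL: "n \<le> length X" using too_few_instructions[of X n] X(3,4) by fastforce
  let ?T = "map snd (tokens y)"
  have wf: "wf_input x" using X wf_input_iff by blast
  have lk: "lookup (length (input_X x)) (input_n x) = n" "length (input_X x) = length X" "input_X x = map itok X"
    using nL by (simp_all add: X(1) input_encode_instance lookup_nat_bits)
  have "len_ok a b m n (length X)" using len_ok_iff[OF q, of n m "length X"] X(2,5) by simp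
  with v wf X(2) have bad: "\<not> (fst (isim (?T, length X) (map itok X)) \<and>
        fst (snd (snd (isim (?T, length X) (map itok X)))) = list_ex (\<lambda>i. has ?T (nat_bits (Suc i))) [0..<n])"
    unfolding verify_def lk(1) unfolding lk(2,3) by auto
  \<comment> \<open>All auxiliary registers are 0, so \<open>s\<close> is an admissible initial
    state whatever \<open>k\<close> is.\<close>
  define s :: reg_state where "s = (\<lambda>r. case r of In a \<Rightarrow> nat_bits a \<in> set ?T | _ \<Rightarrow> False)"
  let ?bs = "map (\<lambda>i. nat_bits (Suc i) \<in> set ?T) [0..<n]"
  have "matches X ?T False [] s" by (auto simp: matches_def s_def)
  moreover have "tstnz ?bs = list_ex (\<lambda>i. has ?T (nat_bits (Suc i))) [0..<n]"
    unfolding tstnz_map_upt by (auto simp: list_ex_iff has_iff simp del: set_map)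
  moreover have "\<exists>s'. exec X 0 s s' \<and> s' Out = tstnz ?bs"
  proof -
    have "length ?bs = n \<and> (\<forall>i \<in> {1..n}. s (In i) = ?bs ! (i - 1)) \<and> s Out = False \<and> (\<forall>i \<in> {1..k}. s (Aux i) = False)" for k
      by (auto simp: s_def simp del: set_map)
    then show ?thesis using X(4) unfolding computes_def by blast
  qed
  ultimately show False using bad isim_exec[OF X(3), of ?T s] by metis
qed

lemma verify_complete:
  assumes q: "q = of_nat a / of_nat b" "b > 0" and x: "x \<notin> tstnz_problem q m"
  shows "\<exists>y. length y \<le> poly [:4, 8, 4:] (length x) \<and> verify a b m x y"
proof (cases "wf_input x \<and> lookup (length (input_X x)) (input_n x) \<noteq> 0 \<and>
     len_ok a b m (lookup (length (input_X x)) (input_n x)) (length (input_X x))")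
  case False
  then show ?thesis by (intro exI[of _ "[]"]) (auto simp: verify_def)
next
  case True
  then obtain n X where X: "x = encode_instance (n, X)" "n \<ge> 1" "X \<in> IS" using wf_input_iff by blast
  have len: "length (input_X x) = length X" and iX: "input_X x = map itok X" by (simp_all add: X(1) input_encode_instance)
  have nL: "n \<le> length X" and lk: "lookup (length (input_X x)) (input_n x) = n"
    using True by (auto simp: X(1) input_encode_instance lookup_nat_bits split: if_splits)
  have "len_ok a b m n (length X)" using True lk len by simp
  then have inst: "(n, X) \<in> tstnz_instances q m"
    using len_ok_iff[OF q, of n m "length X"] X by (simp add: tstnz_instances_def)
  then have nc: "\<not> computes X n tstnz" using x X(1) by (auto simp: tstnz_problem_def)
  \<comment> \<open>Failure to compute means failure for every \<open>k\<close>. With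
    \<open>k\<close> above all numbers in \<open>X\<close>, the failing state has 0 in each
    auxiliary register that \<open>X\<close> mentions.\<close>
  obtain k where k: "\<forall>i \<in> nums X. i \<le> k" 
    using finite_nat_set_iff_bounded_le[of "nums X"] by (metis List.finite_set finite_Diff finite_imageI nums_def)
  from nc obtain bs s where s: "length bs = n" "\<And>i. i \<in> {1..n} \<Longrightarrow> s (In i) = bs ! (i - 1)"
    "s Out = False" "\<And>i. i \<in> {1..k} \<Longrightarrow> s (Aux i) = False" "\<not> (\<exists>s'. exec X 0 s s' \<and> s' Out = tstnz bs)"
    unfolding computes_def by (metis (no_types, lifting))
  \<comment> \<open>Besides the \<open>n\<close> inputs, the witness has to cover input registers
    beyond \<open>n\<close> that \<open>X\<close> reads, as their contents are arbitrary.\<close>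
  define as where "as = filter (\<lambda>i. s (In i)) (map num X @ [1..<Suc n])"
  define y where "y = concat (map encode_int (map int as))"
  have tok: "map snd (tokens y) = map nat_bits as"
  proof -
    have "y = concat (map enc_tok (map (tok_of \<circ> int) as))" by (simp add: y_def enc_tok_of comp_def)
    then have "tokens y = map (tok_of \<circ> int) as" using tokens_enc by metis
    then show ?thesis by (simp add: tok_of_def)
  qed
  let ?T = "map snd (tokens y)"
  have T: "nat_bits i \<in> set ?T \<longleftrightarrow> i \<in> set as" for i
    unfolding tok by (auto simp: nat_bits_eq)
  have "matches X ?T False [] s"
    unfolding matches_def T
  proof (intro conjI ballI)
    show "s Out = False" using s(3) by simp
    fix i assume i: "i \<in> nums X"
    then show "s (In i) \<longleftrightarrow> i \<in> set as" by (auto simp: as_def nums_def)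
    show "s (Aux i) \<longleftrightarrow> nat_bits i \<in> set []" using s(4)[of i] k i by (auto simp: nums_def Suc_le_eq)
  qed
  from isim_exec[OF X(3) this, of "tstnz bs"] s(5)
  have "\<not> (fst (isim (?T, length X) (map itok X)) \<and> fst (snd (snd (isim (?T, length X) (map itok X)))) = tstnz bs)"
    by blast
  moreover have "tstnz bs = list_ex (\<lambda>i. has ?T (nat_bits (Suc i))) [0..<n]"
  proof -
    have "Suc i \<in> set as \<longleftrightarrow> bs ! i" if "i < n" for i
      using s(2)[of "Suc i"] that by (auto simp: as_def simp del: upt_Suc)
    then show ?thesis unfolding list_ex_iff has_iff T tstnz_def by (auto simp: s(1))
  qed
  ultimately have "verify a b m x y" unfolding verify_def lk unfolding iX by simp
  \<comment> \<open>The polynomial is the square of \<open>2 * length x + 2\<close>, which bounds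
    both how many numbers are listed and how long each code is.\<close>
  moreover have "length y \<le> poly [:4, 8, 4:] (length x)"
  proof -
    have e: "length (encode_int (int i)) \<le> 2 * length x + 2" if "i \<in> set as" for i
    proof -
      from that consider u where "u \<in> set X" "i = num u" | "i \<le> n" by (auto simp: as_def)
      then show ?thesis
      proof cases
        case 1
        then show ?thesis using length_encode_num[of u X n] X(1) by simp
      next
        case 2
        have "length (encode_int (int i)) = 2 * length (nat_bits i) + 2"
          by (simp add: encode_int_def length_mark_bits)
        then show ?thesis using 2 nL length_nat_bits[of i] length_encode_instance[of X n] X(1) by simp
      qed
    qed
    have "length y = (\<Sum>i\<leftarrow>as. length (encode_int (int i)))" by (simp add: y_def length_concat comp_def)
    also have "\<dots> \<le> (\<Sum>i\<leftarrow>as. 2 * length x + 2)" by (rule sum_list_mono) (use e in auto)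
    also have "\<dots> = length as * (2 * length x + 2)" by (simp add: sum_list_triv)
    also have "\<dots> \<le> (2 * length x + 2) * (2 * length x + 2)"
    proof (rule mult_le_mono1)
      have "length as \<le> length X + n" unfolding as_def by (rule order_trans[OF length_filter_le]) simp
      then show "length as \<le> 2 * length x + 2" using nL length_encode_instance[of X n] X(1) by simp
    qed
    finally show ?thesis by (simp add: algebra_simps)
  qed
  ultimately show ?thesis by blast
qed

lemma tstnz_problem_in_coNP:
  assumes "q > 0"
  shows "tstnz_problem q m \<in> class_coNP"
proof -
  obtain c d where cd: "quotient_of q = (c, d)" by fastforce
  have "d > 0" using quotient_of_denom_pos[OF cd] .
  moreover have qcd: "q = of_int c / of_int d" using quotient_of_div[OF cd] .
  moreover have "c > 0" using assms \<open>d > 0\<close> unfolding qcd by (simp add: zero_less_divide_iff)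
  ultimately have q: "q = of_nat (nat c) / of_nat (nat d)" "nat d > 0" by simp_all
  let ?V = "{z. verify (nat c) (nat d) m (fst (unpair z)) (snd (unpair z))}"
  have "x \<in> - tstnz_problem q m \<longleftrightarrow> (\<exists>y. length y \<le> poly [:4, 8, 4:] (length x) \<and> encode_pair x y \<in> ?V)" for x
    using verify_sound[OF q] verify_complete[OF q] by (auto simp: unpair_encode_pair)
  then show ?thesis unfolding class_coNP_def class_NP_def using verify_in_P by blast
qed

section \<open>Compiling the verifier of an arbitrary co-NP language into an instruction
  sequence\<close>

section \<open>co-NP-hardness\<close>

subsection \<open>Straight-line code\<close>

text \<open>A configuration is stored one-hot: a register for each state, each head position, and
  each symbol in each cell. The \<open>KNew\<close> kinds hold the successor configuration,
  \<open>KRead\<close> the symbols under the heads, \<open>KSel\<close> the table entry that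
  applies; \<open>KDead\<close> at position \<open>i\<close> says that the witness has no bit
  \<open>i\<close>.\<close>

datatype kind =
    KCell nat nat  \<comment> \<open>tape and symbol; the position is the first component of the register\<close>
  | KHd nat
  | KSt nat
  | KNewCell nat nat
  | KNewHd nat
  | KNewSt nat
  | KRead nat nat
  | KSel nat "nat list"
  | KDead

instance kind :: countable by countable_datatype

type_synonym reg = "nat \<times> kind"

text \<open>Injective, and linear in the position for a fixed kind, hence easy to generate.\<close>

definition rnum :: "reg \<Rightarrow> nat" where
  "rnum r = 2 ^ to_nat (snd r) * (2 * fst r + 1)"

lemma odd_part_unique:
  assumes "2 ^ a * (2 * x + 1) = 2 ^ b * (2 * y + 1 :: nat)"
  shows "a = b \<and> x = y"
  using assms
proof (induction a arbitrary: b)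
  case 0
  then show ?case by (cases b) (auto, presburger)
next
  case (Suc a)
  show ?case
  proof (cases b)
    case 0
    with Suc.prems have "2 * (2 ^ a * (2 * x + 1)) = 2 * y + 1" by simp
    then show ?thesis by presburger
  next
    case (Suc b')
    with Suc.prems have "2 ^ a * (2 * x + 1) = 2 ^ b' * (2 * y + 1)" by simp
    with Suc.IH[of b'] Suc show ?thesis by simp
  qed
qed

lemma rnum_inject [simp]: "rnum r = rnum r' \<longleftrightarrow> r = r'"
proof
  assume "rnum r = rnum r'"
  then have "to_nat (snd r) = to_nat (snd r') \<and> fst r = fst r'"
    unfolding rnum_def by (rule odd_part_unique)
  then show "r = r'" by (simp add: prod_eq_iff)
qed simp

lemma rnum_pos: "rnum r \<ge> 1"
  by (simp add: rnum_def Suc_le_eq)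

datatype lit = LAux reg bool | LIn nat bool

fun holds :: "reg_state \<Rightarrow> lit \<Rightarrow> bool" where
  "holds s (LAux r p) \<longleftrightarrow> s (Aux (rnum r)) = p"
| "holds s (LIn i p) \<longleftrightarrow> s (In i) = p"

text \<open>The polarity is such that a literal that holds skips the next instruction, which is the
  jump.\<close>

fun lit_instr :: "lit \<Rightarrow> instr" where
  "lit_instr (LAux r p) = (if p then NegTest else PosTest) (AuxGet (rnum r))"
| "lit_instr (LIn i p) = (if p then NegTest else PosTest) (InGet i)"

text \<open>A guarded assignment to \<open>r\<close>: each literal that fails jumps behind the assignment.\<close>

fun gcode :: "bool \<Rightarrow> lit list \<Rightarrow> reg \<Rightarrow> instr list" where
  "gcode b [] r = [Plain (AuxSet (rnum r) b)]"
| "gcode b (g # gs) r = lit_instr g # Jump (2 * length gs + 2) # gcode b gs r"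

definition gdo :: "bool \<Rightarrow> lit list \<Rightarrow> reg \<Rightarrow> reg_state \<Rightarrow> reg_state" where
  "gdo b gs r s = (if \<forall>g \<in> set gs. holds s g then s(Aux (rnum r) := b) else s)"

text \<open>Stated as an equivalence in all surroundings \<open>P\<close> and \<open>R\<close>, so
  that fragments compose and inaction later on is carried over too.\<close>

definition straight :: "instr list \<Rightarrow> (reg_state \<Rightarrow> reg_state) \<Rightarrow> bool" where
  "straight X f \<longleftrightarrow> (\<forall>P R s s'. exec (P @ X @ R) (length P) s s' \<longleftrightarrow>
     exec (P @ X @ R) (length P + length X) (f s) s')"

lemma straight_Nil: "straight [] (\<lambda>s. s)"
  by (simp add: straight_def)

lemma straight_append:
  assumes "straight X f" "straight Y g"
  shows "straight (X @ Y) (\<lambda>s. g (f s))"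
  unfolding straight_def
proof (intro allI)
  fix P R s s'
  have "exec (P @ X @ (Y @ R)) (length P) s s' \<longleftrightarrow> exec (P @ X @ (Y @ R)) (length P + length X) (f s) s'"
    using assms(1) unfolding straight_def by blast
  moreover have "exec ((P @ X) @ Y @ R) (length (P @ X)) (f s) s' \<longleftrightarrow>
     exec ((P @ X) @ Y @ R) (length (P @ X) + length Y) (g (f s)) s'"
    using assms(2) unfolding straight_def by blast
  ultimately show "exec (P @ (X @ Y) @ R) (length P) s s' \<longleftrightarrow>
     exec (P @ (X @ Y) @ R) (length P + length (X @ Y)) (g (f s)) s'"
    by (simp add: add.assoc)
qed

lemma length_gcode: "length (gcode b gs r) = 2 * length gs + 1"
  by (induction gs) auto

lemma straight_gcode: "straight (gcode b gs r) (gdo b gs r)"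
proof (induction gs)
  case Nil
  show ?case unfolding straight_def
    by (intro allI) (subst exec_iff, simp, simp add: gdo_def nth_append)
next
  case (Cons g gs)
  show ?case unfolding straight_def
  proof (intro allI)
    fix P R s s'
    let ?G = "gcode b gs r" and ?J = "Jump (2 * length gs + 2)"
    let ?X = "P @ gcode b (g # gs) r @ R"
    have X: "?X = (P @ [lit_instr g, ?J]) @ ?G @ R" by simp
    have 0: "?X ! length P = lit_instr g" "?X ! (Suc (length P)) = ?J" "length ?X > Suc (length P)"
      by (simp_all add: nth_append)
    have eff: "exec ?X (length P) s s' \<longleftrightarrow> exec ?X (if holds s g then length P + 2 else length P + 1) s s'"
      using 0 by (subst exec_iff) (cases g; auto)+
    have jmp: "exec ?X (Suc (length P)) s s' \<longleftrightarrow> exec ?X (length P + length (gcode b (g # gs) r)) s s'"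
      using 0 by (subst exec_iff) (auto simp: length_gcode)
    have body: "exec ?X (length P + 2) s s' \<longleftrightarrow> exec ?X (length P + length (gcode b (g # gs) r)) (gdo b gs r s) s'"
      using Cons.IH[unfolded straight_def, rule_format, of "P @ [lit_instr g, ?J]" R s s']
      unfolding X[symmetric] by (simp add: length_gcode)
    show "exec ?X (length P) s s' \<longleftrightarrow> exec ?X (length P + length (gcode b (g # gs) r)) (gdo b (g # gs) r s) s'"
      unfolding eff using jmp body by (auto simp: gdo_def)
  qed
qed

type_synonym gset = "lit list \<times> reg"

definition phase :: "bool \<Rightarrow> gset list \<Rightarrow> instr list" where
  "phase b G = concat (map (\<lambda>(gs, r). gcode b gs r) G)"

definition pdo :: "bool \<Rightarrow> gset list \<Rightarrow> reg_state \<Rightarrow> reg_state" where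
  "pdo b G s = foldl (\<lambda>s (gs, r). gdo b gs r s) s G"

lemma straight_phase: "straight (phase b G) (pdo b G)"
proof (induction G)
  case Nil
  then show ?case by (simp add: phase_def pdo_def straight_Nil)
next
  case (Cons x G)
  obtain gs r where x: "x = (gs, r)" by (metis surj_pair)
  from straight_append[OF straight_gcode[of b gs r] Cons.IH] show ?case
    by (simp add: phase_def pdo_def x)
qed

definition val :: "reg_state \<Rightarrow> reg \<Rightarrow> bool" where
  "val s r = s (Aux (rnum r))"

text \<open>All assignments of a phase write the same value and none changes a guard, so their order is irrelevant.\<close>

definition indep :: "gset list \<Rightarrow> bool" where
  "indep G \<longleftrightarrow> (\<forall>x \<in> set G. \<forall>y \<in> set G. \<forall>p. LAux (snd x) p \<notin> set (fst y))"

definition fires :: "gset list \<Rightarrow> reg_state \<Rightarrow> reg \<Rightarrow> bool" where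
  "fires G s r \<longleftrightarrow> (\<exists>x \<in> set G. snd x = r \<and> (\<forall>g \<in> set (fst x). holds s g))"

text \<open>Since no guard changes along the way, all firing conditions can be evaluated in the
  initial state \<open>s\<close>: the phase acts as a simultaneous assignment.\<close>

lemma pdo_val:
  assumes "indep G"
  shows "val (pdo b G s) r = (if fires G s r then b else val s r)"
  using assms
proof (induction G arbitrary: s)
  case Nil
  then show ?case by (simp add: pdo_def fires_def)
next
  case (Cons x G)
  obtain gs1 r1 where x: "x = (gs1, r1)" by (metis surj_pair)
  let ?s = "gdo b gs1 r1 s"
  have "indep G" using Cons.prems by (auto simp: indep_def)
  note IH = Cons.IH[OF this, of ?s]
  have h: "holds ?s g = holds s g" if "y \<in> set G" "g \<in> set (fst y)" for y g
  proof -
    have "LAux r1 p \<noteq> g" for p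
      using Cons.prems that x unfolding indep_def by fastforce
    then show ?thesis by (cases g) (auto simp: gdo_def)
  qed
  then have "fires G ?s r = fires G s r" unfolding fires_def by blast
  moreover have "val ?s r = (if r = r1 \<and> (\<forall>g \<in> set gs1. holds s g) then b else val s r)"
    by (auto simp: val_def gdo_def)
  moreover have "fires (x # G) s r \<longleftrightarrow> fires G s r \<or> (r = r1 \<and> (\<forall>g \<in> set gs1. holds s g))"
    by (auto simp: fires_def x)
  moreover have "pdo b (x # G) s = pdo b G ?s" by (simp add: pdo_def x)
  ultimately show ?case using IH by (simp only:) presburger
qed

lemma pdo_other: "pdo b G s (In i) = s (In i) \<and> pdo b G s Out = s Out"
proof (induction G arbitrary: s)
  case Nil
  then show ?case by (simp add: pdo_def)
next
  case (Cons x G)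
  obtain gs r where x: "x = (gs, r)" by (metis surj_pair)
  have "pdo b (x # G) s = pdo b G (gdo b gs r s)" by (simp add: pdo_def x)
  moreover have "gdo b gs r s (In i) = s (In i)" "gdo b gs r s Out = s Out" by (simp_all add: gdo_def)
  ultimately show ?case using Cons.IH by simp
qed

lemma holds_simps: "holds s (LAux r p) \<longleftrightarrow> val s r = p"
  by (simp add: val_def)

lemma phase_append: "phase b (G @ H) = phase b G @ phase b H"
  by (simp add: phase_def)

lemma phase_concat: "phase b (concat Gs) = concat (map (phase b) Gs)"
  by (induction Gs) (auto simp: phase_def)

subsection \<open>Reading the witness from the input registers\<close>

text \<open>Iterated tail in place of \<open>!\<close>: the intermediate lists never grow, so
  \<open>pt_funpow\<close> applies.\<close>

definition nth_bit :: "bool list \<Rightarrow> nat \<Rightarrow> bool" where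
  "nth_bit l n = (case ((\<lambda>l. case l of [] \<Rightarrow> [] | h # t \<Rightarrow> t) ^^ n) l of [] \<Rightarrow> False | h # t \<Rightarrow> h)"

lemma nth_bit: "n < length l \<Longrightarrow> nth_bit l n = l ! n"
proof -
  have "((\<lambda>l. case l of [] \<Rightarrow> [] | h # t \<Rightarrow> t) ^^ n) l = drop n l"
  proof (induction n)
    case (Suc n)
    then show ?case by (simp add: drop_Suc tl_drop[symmetric] split: list.split)
  qed simp
  then show "n < length l \<Longrightarrow> ?thesis" by (simp add: nth_bit_def Cons_nth_drop_Suc[symmetric])
qed

definition init2 :: "nat \<Rightarrow> gset list" where
  "init2 p = concat (map (\<lambda>i. concat (map (\<lambda>i'. [([LIn (2 * i' + 1) False], (i, KDead))]) [0..<Suc i])) [0..<p])"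

text \<open>Witnesses may have any length up to \<open>p\<close>. Register \<open>2 * i + 1\<close>
  tells whether bit \<open>i\<close> is present and register \<open>2 * i + 2\<close> holds it; the
  first absence ends the witness.\<close>

definition used_len :: "nat \<Rightarrow> (nat \<Rightarrow> bool) \<Rightarrow> nat" where
  "used_len p \<alpha> = (LEAST i. i = p \<or> \<not> \<alpha> (2 * i + 1))"

definition witness :: "nat \<Rightarrow> (nat \<Rightarrow> bool) \<Rightarrow> bool list" where
  "witness p \<alpha> = map (\<lambda>i. \<alpha> (2 * i + 2)) [0..<used_len p \<alpha>]"

lemma used_len_le: "used_len p \<alpha> \<le> p"
  unfolding used_len_def by (rule Least_le) simp

lemma used_len_iff: "i < p \<Longrightarrow> used_len p \<alpha> \<le> i \<longleftrightarrow> (\<exists>i' \<le> i. \<not> \<alpha> (2 * i' + 1))"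
proof
  assume i: "i < p" "used_len p \<alpha> \<le> i"
  have "used_len p \<alpha> = p \<or> \<not> \<alpha> (2 * used_len p \<alpha> + 1)"
    unfolding used_len_def by (rule LeastI[of _ p]) simp
  with i show "\<exists>i' \<le> i. \<not> \<alpha> (2 * i' + 1)" by auto
next
  assume "\<exists>i' \<le> i. \<not> \<alpha> (2 * i' + 1)"
  then obtain i' where "i' \<le> i" "\<not> \<alpha> (2 * i' + 1)" by blast
  then have "used_len p \<alpha> \<le> i'" unfolding used_len_def by (intro Least_le) simp
  then show "used_len p \<alpha> \<le> i" using \<open>i' \<le> i\<close> by simp
qed

lemma witness_surj:
  assumes "length y \<le> p"
  shows "witness p (\<lambda>i. if odd i then i div 2 < length y else y ! ((i - 2) div 2)) = y"
proof -
  have "used_len p (\<lambda>i. if odd i then i div 2 < length y else y ! ((i - 2) div 2)) = length y"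
    unfolding used_len_def using assms by (intro Least_equality) auto
  then show ?thesis by (auto simp: witness_def intro: nth_equalityI)
qed

subsection \<open>Simulating one step of a Turing machine\<close>

fun moved :: "move \<Rightarrow> nat \<Rightarrow> nat" where
  "moved MoveLeft j = j - 1"
| "moved Stay j = j"
| "moved MoveRight j = j + 1"

context
  fixes M :: tm
  assumes wf: "wf_tm M"
begin

definition words :: "nat list list" where
  "words = List.n_lists (tm_tapes M) [0..<tm_syms M]"

lemma set_words: "set words = {ss. length ss = tm_tapes M \<and> set ss \<subseteq> {..<tm_syms M}}"
  by (auto simp: words_def set_n_lists)

text \<open>A halted configuration idles, as in \<open>tm_step\<close>, so that a fixed number of
  steps can be unrolled.\<close>

definition delta :: "nat \<Rightarrow> nat list \<Rightarrow> nat \<times> (nat \<times> move) list" where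
  "delta q ss = (if q < tm_states M then tm_delta M q ss else (q, map (\<lambda>s. (s, Stay)) ss))"

text \<open>A phase writes a single value and may not change its own guards, which dictates six
  phases: clear the scratch registers, read under the heads, select the table entry, build the
  successor configuration, clear the old one, copy the new one back. States and words range over
  sets fixed by \<open>M\<close>, so the code is polynomial in \<open>N\<close>.\<close>

definition step1 :: "nat \<Rightarrow> gset list" where
  "step1 N = concat (map (\<lambda>t. map (\<lambda>s. ([], (0, KRead t s))) [0..<tm_syms M]) [0..<tm_tapes M]) @
     concat (map (\<lambda>q. map (\<lambda>ss. ([], (0, KSel q ss))) words) [0..<Suc (tm_states M)]) @
     map (\<lambda>q. ([], (0, KNewSt q))) [0..<Suc (tm_states M)] @
     concat (map (\<lambda>j. concat (map (\<lambda>t. ([], (j, KNewHd t)) # map (\<lambda>s. ([], (j, KNewCell t s))) [0..<tm_syms M]) [0..<tm_tapes M])) [0..<N])"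

definition step2 :: "nat \<Rightarrow> gset list" where
  "step2 N = concat (map (\<lambda>j. concat (map (\<lambda>t. map (\<lambda>s.
     ([LAux (j, KHd t) True, LAux (j, KCell t s) True], (0, KRead t s))) [0..<tm_syms M]) [0..<tm_tapes M])) [0..<N])"

definition step3 :: "gset list" where
  "step3 = concat (map (\<lambda>q. map (\<lambda>ss.
     (LAux (0, KSt q) True # map (\<lambda>t. LAux (0, KRead t (ss ! t)) True) [0..<tm_tapes M], (0, KSel q ss))) words) [0..<Suc (tm_states M)])"

definition step4 :: "nat \<Rightarrow> gset list" where
  "step4 N = concat (map (\<lambda>q. map (\<lambda>ss. ([LAux (0, KSel q ss) True], (0, KNewSt (fst (delta q ss))))) words) [0..<Suc (tm_states M)]) @
     concat (map (\<lambda>j. concat (map (\<lambda>t.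
       map (\<lambda>s. ([LAux (j, KCell t s) True, LAux (j, KHd t) False], (j, KNewCell t s))) [0..<tm_syms M] @
       concat (map (\<lambda>q. concat (map (\<lambda>ss.
         [([LAux (0, KSel q ss) True, LAux (j, KHd t) True], (j, KNewCell t (fst (snd (delta q ss) ! t)))),
          ([LAux (0, KSel q ss) True, LAux (j, KHd t) True], (moved (snd (snd (delta q ss) ! t)) j, KNewHd t))])
         words)) [0..<Suc (tm_states M)])) [0..<tm_tapes M])) [0..<N])"

definition step5 :: "nat \<Rightarrow> gset list" where
  "step5 N = map (\<lambda>q. ([], (0, KSt q))) [0..<Suc (tm_states M)] @
     concat (map (\<lambda>j. concat (map (\<lambda>t. ([], (j, KHd t)) # map (\<lambda>s. ([], (j, KCell t s))) [0..<tm_syms M]) [0..<tm_tapes M])) [0..<N])"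

definition step6 :: "nat \<Rightarrow> gset list" where
  "step6 N = map (\<lambda>q. ([LAux (0, KNewSt q) True], (0, KSt q))) [0..<Suc (tm_states M)] @
     concat (map (\<lambda>j. concat (map (\<lambda>t. ([LAux (j, KNewHd t) True], (j, KHd t)) #
       map (\<lambda>s. ([LAux (j, KNewCell t s) True], (j, KCell t s))) [0..<tm_syms M]) [0..<tm_tapes M])) [0..<N])"

definition step_code :: "nat \<Rightarrow> instr list" where
  "step_code N = phase False (step1 N) @ phase True (step2 N) @ phase True step3 @
     phase True (step4 N) @ phase False (step5 N) @ phase True (step6 N)"

definition step_fun :: "nat \<Rightarrow> reg_state \<Rightarrow> reg_state" where
  "step_fun N s = pdo True (step6 N) (pdo False (step5 N) (pdo True (step4 N) (pdo True step3
     (pdo True (step2 N) (pdo False (step1 N) s)))))"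

lemma straight_step: "straight (step_code N) (step_fun N)"
proof -
  have "straight (step_code N) (\<lambda>s. pdo True (step6 N) (pdo False (step5 N) (pdo True (step4 N) (pdo True step3
     (pdo True (step2 N) (pdo False (step1 N) s))))))"
    unfolding step_code_def by (intro straight_append straight_phase)
  then show ?thesis by (simp add: step_fun_def[abs_def])
qed

lemma indep_steps: "indep (step1 N)" "indep (step2 N)" "indep step3" "indep (step4 N)" "indep (step5 N)" "indep (step6 N)"
  by (auto simp: indep_def step1_def step2_def step3_def step4_def step5_def step6_def simp del: upt_Suc)

text \<open>Position \<open>j\<close> of the window is cell \<open>j - W\<close> of the tape.\<close>

definition cfg :: "nat \<Rightarrow> nat \<Rightarrow> reg_state \<Rightarrow> tm_config \<Rightarrow> bool" where
  "cfg W N s c \<longleftrightarrow> (\<forall>q \<le> tm_states M. val s (0, KSt q) \<longleftrightarrow> q = fst c) \<and>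
     (\<forall>t < tm_tapes M. \<forall>j < N. (val s (j, KHd t) \<longleftrightarrow> int j = snd (snd c ! t) + int W) \<and>
        (\<forall>a < tm_syms M. val s (j, KCell t a) \<longleftrightarrow> fst (snd c ! t) (int j - int W) = a))"

definition wf_cfg :: "nat \<Rightarrow> tm_config \<Rightarrow> bool" where
  "wf_cfg h c \<longleftrightarrow> fst c \<le> tm_states M \<and> length (snd c) = tm_tapes M \<and>
     (\<forall>t < tm_tapes M. \<bar>snd (snd c ! t)\<bar> \<le> int h \<and> (\<forall>i. fst (snd c ! t) i < tm_syms M))"

lemma tm_step_delta:
  assumes "fst c \<le> tm_states M" "length (snd c) = tm_tapes M"
  shows "tm_step M c = (fst (delta (fst c) (map read_tape (snd c))),
    map2 act_tape (snd (delta (fst c) (map read_tape (snd c)))) (snd c))"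
proof (cases "fst c < tm_states M")
  case True
  then show ?thesis by (cases c) (auto simp: delta_def split: prod.splits)
next
  case False
  moreover have "map2 act_tape (map (\<lambda>s. (s, Stay)) (map read_tape ts)) ts = ts" for ts
    by (induction ts) (auto simp: act_tape_Stay)
  ultimately show ?thesis by (cases c) (auto simp: delta_def)
qed

lemma delta_wf:
  assumes "q \<le> tm_states M" "ss \<in> set words"
  shows "fst (delta q ss) \<le> tm_states M" "length (snd (delta q ss)) = tm_tapes M" "t < tm_tapes M \<Longrightarrow> fst (snd (delta q ss) ! t) < tm_syms M"
proof -
  have "fst (delta q ss) \<le> tm_states M \<and> length (snd (delta q ss)) = tm_tapes M \<and> fst ` set (snd (delta q ss)) \<subseteq> {..<tm_syms M}"
  proof (cases "q < tm_states M")
    case True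
    have "case tm_delta M q ss of (st', as) \<Rightarrow> st' \<le> tm_states M \<and> length as = tm_tapes M \<and> fst ` set as \<subseteq> {..<tm_syms M}"
      using wf[unfolded wf_tm_def, THEN conjunct2, THEN conjunct2, rule_format, of q ss] assms True
      by (simp add: set_words)
    then show ?thesis using True by (auto simp: delta_def split: prod.splits)
  next
    case False
    then show ?thesis using assms by (auto simp: delta_def set_words)
  qed
  then show "fst (delta q ss) \<le> tm_states M" "length (snd (delta q ss)) = tm_tapes M" "t < tm_tapes M \<Longrightarrow> fst (snd (delta q ss) ! t) < tm_syms M"
    by (auto dest!: subsetD[of _ _ "fst (snd (delta q ss) ! t)"])
qed

lemma reads_in_words: "wf_cfg h c \<Longrightarrow> map read_tape (snd c) \<in> set words"
  unfolding set_words by (auto simp: wf_cfg_def read_tape_def in_set_conv_nth) (metis fst_conv)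

lemma wf_cfg_step: "wf_cfg h c \<Longrightarrow> wf_cfg (Suc h) (tm_step M c)"
proof -
  assume c: "wf_cfg h c"
  let ?d = "delta (fst c) (map read_tape (snd c))"
  have c': "fst c \<le> tm_states M" "length (snd c) = tm_tapes M" using c by (auto simp: wf_cfg_def)
  note d = delta_wf[OF c'(1) reads_in_words[OF c]]
  have "\<bar>snd (act_tape (snd ?d ! t) (snd c ! t))\<bar> \<le> int (Suc h) \<and> (\<forall>i. fst (act_tape (snd ?d ! t) (snd c ! t)) i < tm_syms M)"
    if "t < tm_tapes M" for t
  proof -
    obtain w m where wm: "snd ?d ! t = (w, m)" by fastforce
    obtain f p where fp: "snd c ! t = (f, p)" by fastforce
    have "w < tm_syms M" using d(3)[OF that] wm by simp
    moreover have "\<bar>p\<bar> \<le> int h" "\<forall>i. f i < tm_syms M" using c that fp unfolding wf_cfg_def by fastforce+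
    ultimately show ?thesis by (auto simp: wm fp split: move.split)
  qed
  then show ?thesis unfolding tm_step_delta[OF c'] wf_cfg_def using d c' by simp
qed

text \<open>The two inequalities keep every head and both neighbours of its cell inside the window.
  In particular the subtraction in \<open>moved\<close> never truncates, and no new head position
  falls outside.\<close>

lemma cfg_step:
  assumes c: "cfg W N s c" "wf_cfg h c" and hW: "h < W" "W + h + 1 < N"
  shows "cfg W N (step_fun N s) (tm_step M c)"
proof -
  let ?rd = "map read_tape (snd c)"
  let ?d = "delta (fst c) ?rd"
  define hp where "hp t = nat (snd (snd c ! t) + int W)" for t
  have c': "fst c \<le> tm_states M" "length (snd c) = tm_tapes M" using c(2) by (auto simp: wf_cfg_def)
  have rd: "?rd \<in> set words" by (rule reads_in_words[OF c(2)])
  note d = delta_wf[OF c'(1) rd]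
  have hb: "\<bar>snd (snd c ! t)\<bar> \<le> int h" if "t < tm_tapes M" for t using c(2) that by (auto simp: wf_cfg_def)
  have hp: "int (hp t) = snd (snd c ! t) + int W" "hp t < N" "1 \<le> hp t" "hp t + 1 < N" if "t < tm_tapes M" for t
    using hb[OF that] hW by (auto simp: hp_def)
  have rS: "read_tape (snd c ! t) < tm_syms M" if "t < tm_tapes M" for t
    using c(2) that by (auto simp: wf_cfg_def read_tape_def)
  define s1 where "s1 = pdo False (step1 N) s"
  define s2 where "s2 = pdo True (step2 N) s1"
  define s3 where "s3 = pdo True step3 s2"
  define s4 where "s4 = pdo True (step4 N) s3"
  define s5 where "s5 = pdo False (step5 N) s4"
  define s6 where "s6 = pdo True (step6 N) s5"
  have old0: "val s (0, KSt q) \<longleftrightarrow> q = fst c" if "q \<le> tm_states M" for q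
    using c(1) that by (auto simp: cfg_def)
  have old1: "val s (j, KHd t) \<longleftrightarrow> j = hp t" if "t < tm_tapes M" "j < N" for t j
    using c(1) that hp(1)[OF that(1)] by (auto simp: cfg_def)
  have old2: "val s (j, KCell t a) \<longleftrightarrow> fst (snd c ! t) (int j - int W) = a" if "t < tm_tapes M" "j < N" "a < tm_syms M" for t j a
    using c(1) that by (auto simp: cfg_def)
  have kept1: "val s1 (i, KSt q) = val s (i, KSt q)" "val s1 (j, KHd t) = val s (j, KHd t)"
    "val s1 (j, KCell t a) = val s (j, KCell t a)" for i q j t a
    by (simp_all add: s1_def pdo_val indep_steps) (auto simp: fires_def bex_Un ball_Un step1_def simp del: upt_Suc)
  have zero1: "\<not> val s1 (0, KRead t a)" if "t < tm_tapes M" "a < tm_syms M" for t a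
    using that unfolding s1_def pdo_val[OF indep_steps(1)] by (auto simp: fires_def bex_Un ball_Un step1_def simp del: upt_Suc)
  have zero2: "\<not> val s1 (0, KSel q ss)" if "q \<le> tm_states M" "ss \<in> set words" for q ss
    using that unfolding s1_def pdo_val[OF indep_steps(1)] by (auto simp: fires_def bex_Un ball_Un step1_def less_Suc_eq_le simp del: upt_Suc)
  have zero3: "\<not> val s1 (0, KNewSt q)" if "q \<le> tm_states M" for q
    using that unfolding s1_def pdo_val[OF indep_steps(1)] by (auto simp: fires_def bex_Un ball_Un step1_def less_Suc_eq_le simp del: upt_Suc)
  have zero4: "\<not> val s1 (j, KNewHd t)" if "t < tm_tapes M" "j < N" for t j
    using that unfolding s1_def pdo_val[OF indep_steps(1)] by (auto simp: fires_def bex_Un ball_Un step1_def simp del: upt_Suc)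
  have zero5: "\<not> val s1 (j, KNewCell t a)" if "t < tm_tapes M" "j < N" "a < tm_syms M" for t j a
    using that unfolding s1_def pdo_val[OF indep_steps(1)] by (auto simp: fires_def bex_Un ball_Un step1_def simp del: upt_Suc)
  have kept2: "val s2 (i, KSt q) = val s1 (i, KSt q)" "val s2 (j, KHd t) = val s1 (j, KHd t)"
    "val s2 (j, KCell t a) = val s1 (j, KCell t a)" "val s2 (i, KSel q ss) = val s1 (i, KSel q ss)"
    "val s2 (i, KNewSt q) = val s1 (i, KNewSt q)" "val s2 (j, KNewHd t) = val s1 (j, KNewHd t)"
    "val s2 (j, KNewCell t a) = val s1 (j, KNewCell t a)" for i q j t a ss
    by (simp_all add: s2_def pdo_val indep_steps) (auto simp: fires_def bex_Un ball_Un step2_def)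
  have rd2: "val s2 (0, KRead t a) \<longleftrightarrow> read_tape (snd c ! t) = a" if "t < tm_tapes M" "a < tm_syms M" for t a
  proof -
    have "fires (step2 N) s1 (0, KRead t a) \<longleftrightarrow> (\<exists>j<N. val s1 (j, KHd t) \<and> val s1 (j, KCell t a))"
      using that by (auto simp: fires_def bex_Un ball_Un step2_def holds_simps simp del: holds.simps)
    also have "\<dots> \<longleftrightarrow> (\<exists>j<N. j = hp t \<and> fst (snd c ! t) (int j - int W) = a)"
      using old1[OF that(1)] old2[OF that(1) _ that(2)] by (auto simp: kept1)
    also have "\<dots> \<longleftrightarrow> read_tape (snd c ! t) = a" using hp[OF that(1)] by (auto simp: read_tape_def)
    finally show ?thesis using zero1[OF that] by (simp add: s2_def pdo_val indep_steps)
  qed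
  have kept3: "val s3 (i, KSt q) = val s2 (i, KSt q)" "val s3 (j, KHd t) = val s2 (j, KHd t)"
    "val s3 (j, KCell t a) = val s2 (j, KCell t a)"
    "val s3 (i, KNewSt q) = val s2 (i, KNewSt q)" "val s3 (j, KNewHd t) = val s2 (j, KNewHd t)"
    "val s3 (j, KNewCell t a) = val s2 (j, KNewCell t a)" for i q j t a
    by (simp_all add: s3_def pdo_val indep_steps) (auto simp: fires_def bex_Un ball_Un step3_def simp del: upt_Suc)
  have sel3: "val s3 (0, KSel q ss) \<longleftrightarrow> q = fst c \<and> ss = ?rd" if "q \<le> tm_states M" "ss \<in> set words" for q ss
  proof -
    have ss: "length ss = tm_tapes M" "\<And>t. t < tm_tapes M \<Longrightarrow> ss ! t < tm_syms M"
      using that(2) by (auto simp: set_words subset_iff dest: nth_mem)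
    have "fires step3 s2 (0, KSel q ss) \<longleftrightarrow> val s2 (0, KSt q) \<and> (\<forall>t<tm_tapes M. val s2 (0, KRead t (ss ! t)))"
      using that by (auto simp: fires_def bex_Un ball_Un step3_def holds_simps less_Suc_eq_le simp del: holds.simps upt_Suc)
    also have "\<dots> \<longleftrightarrow> q = fst c \<and> (\<forall>t<tm_tapes M. read_tape (snd c ! t) = ss ! t)"
      using old0[OF that(1)] rd2 ss(2) by (auto simp: kept1 kept2)
    also have "\<dots> \<longleftrightarrow> q = fst c \<and> ss = ?rd" using ss(1) c'(2) by (auto simp: list_eq_iff_nth_eq)
    finally show ?thesis using zero2[OF that] by (simp add: s3_def pdo_val indep_steps kept2)
  qed
  note kept = kept1 kept2 kept3
  have st4: "val s4 (0, KNewSt q) \<longleftrightarrow> q = fst ?d" if "q \<le> tm_states M" for q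
  proof -
    have "fires (step4 N) s3 (0, KNewSt q) \<longleftrightarrow> (\<exists>q' \<le> tm_states M. \<exists>ss \<in> set words. val s3 (0, KSel q' ss) \<and> q = fst (delta q' ss))"
      by (auto simp: fires_def bex_Un ball_Un step4_def holds_simps less_Suc_eq_le simp del: holds.simps upt_Suc)
    also have "\<dots> \<longleftrightarrow> q = fst ?d" using sel3 c'(1) rd by auto
    finally show ?thesis using zero3[OF that] by (simp add: s4_def pdo_val indep_steps kept)
  qed
  have cell4: "val s4 (j, KNewCell t a) \<longleftrightarrow> (if j = hp t then a = fst (snd ?d ! t) else fst (snd c ! t) (int j - int W) = a)"
    if "t < tm_tapes M" "j < N" "a < tm_syms M" for t j a
  proof -
    have "fires (step4 N) s3 (j, KNewCell t a) \<longleftrightarrow> val s3 (j, KCell t a) \<and> \<not> val s3 (j, KHd t) \<or>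
       (\<exists>q \<le> tm_states M. \<exists>ss \<in> set words. val s3 (0, KSel q ss) \<and> val s3 (j, KHd t) \<and> a = fst (snd (delta q ss) ! t))"
      using that by (auto simp: fires_def bex_Un ball_Un step4_def holds_simps less_Suc_eq_le simp del: holds.simps upt_Suc)
        (rule bexI[of _ j], rule bexI[of _ t], auto simp: less_Suc_eq_le)+
    also have "\<dots> \<longleftrightarrow> (if j = hp t then a = fst (snd ?d ! t) else fst (snd c ! t) (int j - int W) = a)"
      using sel3 c'(1) rd old1[OF that(1,2)] old2[OF that] by (auto simp: kept)
    finally show ?thesis using zero5[OF that]
      unfolding s4_def pdo_val[OF indep_steps(4)] by (simp only: kept) simp
  qed
  have hd4: "val s4 (j, KNewHd t) \<longleftrightarrow> j = moved (snd (snd ?d ! t)) (hp t)" if "t < tm_tapes M" "j < N" for t j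
  proof -
    have "fires (step4 N) s3 (j, KNewHd t) \<longleftrightarrow>
       (\<exists>i < N. \<exists>q \<le> tm_states M. \<exists>ss \<in> set words. val s3 (0, KSel q ss) \<and> val s3 (i, KHd t) \<and> j = moved (snd (snd (delta q ss) ! t)) i)"
      using that
      apply (auto simp: fires_def bex_Un ball_Un step4_def holds_simps less_Suc_eq_le simp del: holds.simps upt_Suc)
      subgoal by blast
      subgoal for i q ss
        by (rule bexI[of _ i], rule bexI[of _ t], rule bexI[of _ q], rule bexI[of _ ss]) auto
      done
    also have "\<dots> \<longleftrightarrow> j = moved (snd (snd ?d ! t)) (hp t)"
      using sel3 c'(1) rd old1[OF that(1)] hp(2)[OF that(1)] unfolding kept
      apply (intro iffI)
      subgoal by auto
      subgoal by (rule exI[of _ "hp t"], rule conjI, assumption, rule exI[of _ "fst c"], rule conjI,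
            assumption, rule bexI[of _ ?rd]) auto
      done
    finally show ?thesis using zero4[OF that] by (simp add: s4_def pdo_val indep_steps kept)
  qed
  have kept5: "val s5 (i, KNewSt q) = val s4 (i, KNewSt q)" "val s5 (j, KNewHd t) = val s4 (j, KNewHd t)"
    "val s5 (j, KNewCell t a) = val s4 (j, KNewCell t a)" for i q j t a
    by (simp_all add: s5_def pdo_val indep_steps) (auto simp: fires_def bex_Un ball_Un step5_def simp del: upt_Suc)
  have zero5: "\<not> val s5 (0, KSt q)" if "q \<le> tm_states M" for q
    using that unfolding s5_def pdo_val[OF indep_steps(5)] by (auto simp: fires_def bex_Un ball_Un step5_def less_Suc_eq_le simp del: upt_Suc)
  have zero6: "\<not> val s5 (j, KHd t)" if "t < tm_tapes M" "j < N" for t j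
    using that unfolding s5_def pdo_val[OF indep_steps(5)] by (auto simp: fires_def bex_Un ball_Un step5_def simp del: upt_Suc)
  have zero7: "\<not> val s5 (j, KCell t a)" if "t < tm_tapes M" "j < N" "a < tm_syms M" for t j a
    using that unfolding s5_def pdo_val[OF indep_steps(5)] by (auto simp: fires_def bex_Un ball_Un step5_def simp del: upt_Suc)
  have st6: "val s6 (0, KSt q) \<longleftrightarrow> val s5 (0, KNewSt q)" if "q \<le> tm_states M" for q
    using that zero5[OF that] unfolding s6_def pdo_val[OF indep_steps(6)]
    by (auto simp: fires_def bex_Un ball_Un step6_def holds_simps less_Suc_eq_le simp del: holds.simps upt_Suc)
  have hd6: "val s6 (j, KHd t) \<longleftrightarrow> val s5 (j, KNewHd t)" if "t < tm_tapes M" "j < N" for t j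
    using that zero6[OF that] unfolding s6_def pdo_val[OF indep_steps(6)]
    by (auto simp: fires_def bex_Un ball_Un step6_def holds_simps simp del: holds.simps upt_Suc)
  have cell6: "val s6 (j, KCell t a) \<longleftrightarrow> val s5 (j, KNewCell t a)" if "t < tm_tapes M" "j < N" "a < tm_syms M" for t j a
    using that zero7[OF that] unfolding s6_def pdo_val[OF indep_steps(6)]
    by (auto simp: fires_def bex_Un ball_Un step6_def holds_simps simp del: holds.simps upt_Suc)
  have "step_fun N s = s6"
    by (simp add: step_fun_def s1_def s2_def s3_def s4_def s5_def s6_def)
  moreover have "cfg W N s6 (tm_step M c)"
    unfolding cfg_def
  proof (intro conjI allI impI)
    show "val s6 (0, KSt q) \<longleftrightarrow> q = fst (tm_step M c)" if "q \<le> tm_states M" for q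
      using that by (simp add: st6 kept5 st4 tm_step_delta[OF c'])
    fix t j assume t: "t < tm_tapes M" and j: "j < N"
    obtain w m where wm: "snd ?d ! t = (w, m)" by fastforce
    obtain f p where fp: "snd c ! t = (f, p)" by fastforce
    have new: "snd (tm_step M c) ! t = act_tape (w, m) (f, p)"
      using t c' d(2) by (simp add: tm_step_delta[OF c'] wm fp)
    have hpp: "int (hp t) = p + int W" "1 \<le> hp t" using hp[OF t] fp by simp_all
    show "val s6 (j, KHd t) \<longleftrightarrow> int j = snd (snd (tm_step M c) ! t) + int W"
      unfolding new using hpp by (cases m) (auto simp: hd6[OF t j] kept5 hd4[OF t j] wm)
    show "val s6 (j, KCell t a) \<longleftrightarrow> fst (snd (tm_step M c) ! t) (int j - int W) = a" if "a < tm_syms M" for a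
      unfolding new using hpp by (auto simp: cell6[OF t j that] kept5 cell4[OF t j that] wm fp)
  qed
  ultimately show ?thesis by simp
qed

lemma cfg_steps:
  assumes "cfg W N s c" "wf_cfg 0 c" "T < W" "W + T + 1 < N"
  shows "cfg W N ((step_fun N ^^ T) s) ((tm_step M ^^ T) c) \<and> wf_cfg T ((tm_step M ^^ T) c)"
  using assms(3,4)
proof (induction T)
  case (Suc T)
  then have "cfg W N ((step_fun N ^^ T) s) ((tm_step M ^^ T) c)" "wf_cfg T ((tm_step M ^^ T) c)" by auto
  from cfg_step[OF this] wf_cfg_step[OF this(2)] Suc.prems show ?case by simp
qed (use assms in simp)

subsection \<open>Simulating a whole run\<close>

text \<open>Clears the configuration and the \<open>KDead\<close> registers, while
  \<open>step1\<close> clears the scratch registers in every step. Thus the simulation does not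
  depend on the initial contents of the auxiliary registers.\<close>

definition init1 :: "nat \<Rightarrow> nat \<Rightarrow> gset list" where
  "init1 N p = step5 N @ concat (map (\<lambda>i. [([], (i, KDead))]) [0..<p])"

text \<open>On tape 0 the window consists of \<open>W\<close> blanks, the fixed part
  \<open>z\<close>, \<open>p\<close> cells for the witness, and blanks. Witness cells with
  \<open>KDead\<close> set become blank, so shorter witnesses end properly. Each region is indexed
  from 0 so that a loop can generate it.\<close>

definition init3 :: "nat \<Rightarrow> nat \<Rightarrow> nat \<Rightarrow> bool list \<Rightarrow> gset list" where
  "init3 W N p z = [([], (0, KSt 0))] @ map (\<lambda>t. ([], (W, KHd t))) [0..<tm_tapes M] @
     concat (map (\<lambda>j. map (\<lambda>t. ([], (j, KCell t 0))) [1..<tm_tapes M]) [0..<N]) @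
     concat (map (\<lambda>j. [([], (j, KCell 0 0))]) [0..<W]) @
     concat (map (\<lambda>e. if nth_bit z e then [([], (W + e, KCell 0 2))] else [([], (W + e, KCell 0 1))]) [0..<length z]) @
     concat (map (\<lambda>i. [([LAux (i, KDead) True], (W + length z + i, KCell 0 0)),
       ([LAux (i, KDead) False, LIn (2 * i + 2) True], (W + length z + i, KCell 0 2)),
       ([LAux (i, KDead) False, LIn (2 * i + 2) False], (W + length z + i, KCell 0 1))]) [0..<p]) @
     concat (map (\<lambda>j. [([], (W + length z + p + j, KCell 0 0))]) [0..<N - (W + length z + p)])"

lemma indep_inits: "indep (init1 N p)" "indep (init2 p)" "indep (init3 W N p z)"
  by (auto simp: indep_def init1_def step5_def init2_def init3_def simp del: upt_Suc)

lemma cfg_init: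
  fixes s W N p z
  assumes N: "W + length z + p \<le> N"
  defines "s' \<equiv> pdo True (init3 W N p z) (pdo True (init2 p) (pdo False (init1 N p) s))"
  shows "cfg W N s' (tm_init M (z @ witness p (\<lambda>i. s (In i))))"
proof -
  let ?\<alpha> = "\<lambda>i. s (In i)"
  let ?y = "witness p ?\<alpha>"
  define s1 where "s1 = pdo False (init1 N p) s"
  define s2 where "s2 = pdo True (init2 p) s1"
  have s': "s' = pdo True (init3 W N p z) s2" by (simp add: s'_def s1_def s2_def)
  have KS: "tm_tapes M \<ge> 1" "tm_syms M \<ge> 3" using wf by (auto simp: wf_tm_def)
  have In1: "s1 (In i) = s (In i)" "s2 (In i) = s (In i)" for i by (simp_all add: s1_def s2_def pdo_other)
  have zero: "\<not> val s2 (0, KSt q)" if "q \<le> tm_states M" for q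
    using that unfolding s2_def pdo_val[OF indep_inits(2)] s1_def pdo_val[OF indep_inits(1)]
    by (auto simp: fires_def bex_Un ball_Un init1_def init2_def step5_def less_Suc_eq_le simp del: upt_Suc)
  have zero2: "\<not> val s2 (j, KHd t)" if "t < tm_tapes M" "j < N" for t j
    using that unfolding s2_def pdo_val[OF indep_inits(2)] s1_def pdo_val[OF indep_inits(1)]
    by (auto simp: fires_def bex_Un ball_Un init1_def init2_def step5_def less_Suc_eq_le simp del: upt_Suc)
  have zero3: "\<not> val s2 (j, KCell t a)" if "t < tm_tapes M" "j < N" "a < tm_syms M" for t j a
    using that unfolding s2_def pdo_val[OF indep_inits(2)] s1_def pdo_val[OF indep_inits(1)]
    by (auto simp: fires_def bex_Un ball_Un init1_def init2_def step5_def less_Suc_eq_le simp del: upt_Suc)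
  have dead: "val s2 (i, KDead) \<longleftrightarrow> used_len p ?\<alpha> \<le> i" if "i < p" for i
  proof -
    have "\<not> val s1 (i, KDead)" using that unfolding s1_def pdo_val[OF indep_inits(1)]
      by (auto simp: fires_def bex_Un ball_Un init1_def step5_def simp del: upt_Suc)
    moreover have "fires (init2 p) s1 (i, KDead) \<longleftrightarrow> (\<exists>i' \<le> i. \<not> s (In (2 * i' + 1)))"
      using that by (auto simp: fires_def bex_Un ball_Un init2_def less_Suc_eq_le In1 simp del: upt_Suc)
    ultimately show ?thesis using used_len_iff[OF that, of ?\<alpha>] by (simp add: s2_def pdo_val indep_inits)
  qed
  have st: "val s' (0, KSt q) \<longleftrightarrow> q = 0" if "q \<le> tm_states M" for q
    using zero[OF that] unfolding s' pdo_val[OF indep_inits(3)]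
    by (auto simp: fires_def bex_Un ball_Un init3_def split: if_splits)
  have hd: "val s' (j, KHd t) \<longleftrightarrow> j = W" if "t < tm_tapes M" "j < N" for t j
    using zero2[OF that] that unfolding s' pdo_val[OF indep_inits(3)]
    by (auto simp: fires_def bex_Un ball_Un init3_def split: if_splits)
  have cellt: "val s' (j, KCell t a) \<longleftrightarrow> a = 0" if "0 < t" "t < tm_tapes M" "j < N" "a < tm_syms M" for t j a
    using zero3[OF that(2-)] that unfolding s' pdo_val[OF indep_inits(3)]
    by (auto simp: fires_def bex_Un ball_Un init3_def split: if_splits)
  have cell0: "val s' (j, KCell 0 a) \<longleftrightarrow>
      (if 0 \<le> int j - int W \<and> int j - int W < int (length (z @ ?y)) then bit_sym ((z @ ?y) ! nat (int j - int W)) else 0) = a"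
    if jN: "j < N" and aS: "a < tm_syms M" for j a
  proof -
    have "fires (init3 W N p z) s2 (j, KCell 0 a) \<longleftrightarrow>
      j < W \<and> a = 0 \<or> (\<exists>e < length z. j = W + e \<and> a = bit_sym (nth_bit z e)) \<or>
      (\<exists>i < p. j = W + length z + i \<and> (if val s2 (i, KDead) then a = 0 else a = bit_sym (s2 (In (2 * i + 2))))) \<or>
      (\<exists>i < N - (W + length z + p). j = W + length z + p + i \<and> a = 0)"
      by (auto simp: fires_def bex_Un ball_Un init3_def bit_sym_def holds_simps simp del: holds.simps(1) split: if_splits)
    also have "\<dots> \<longleftrightarrow> (if 0 \<le> int j - int W \<and> int j - int W < int (length (z @ ?y))
        then bit_sym ((z @ ?y) ! nat (int j - int W)) else 0) = a"
    proof -
      consider "j < W" | e where "e < length z" "j = W + e" | i where "i < p" "j = W + length z + i"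
        | i where "j = W + length z + p + i" "i < N - (W + length z + p)"
      proof -
        assume a: "j < W \<Longrightarrow> thesis" "\<And>e. e < length z \<Longrightarrow> j = W + e \<Longrightarrow> thesis"
          "\<And>i. i < p \<Longrightarrow> j = W + length z + i \<Longrightarrow> thesis"
          "\<And>i. j = W + length z + p + i \<Longrightarrow> i < N - (W + length z + p) \<Longrightarrow> thesis"
        consider "j < W" | "W \<le> j" "j < W + length z" | "W + length z \<le> j" "j < W + length z + p"
          | "W + length z + p \<le> j" by linarith
        then show thesis
        proof cases
          case 1
          then show ?thesis by (rule a(1))
        next
          case 2
          then show ?thesis by (intro a(2)[of "j - W"]) simp_all
        next
          case 3
          then show ?thesis by (intro a(3)[of "j - W - length z"]) simp_all
        next
          case 4
          then show ?thesis using jN by (intro a(4)[of "j - W - length z - p"]) simp_all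
        qed
      qed
      then show ?thesis
      proof cases
        case 1
        then show ?thesis by auto
      next
        case (2 e)
        then show ?thesis by (auto simp: nth_append nth_bit)
      next
        case (3 i)
        have len: "length ?y = used_len p ?\<alpha>" by (simp add: witness_def)
        show ?thesis
        proof (cases "used_len p ?\<alpha> \<le> i")
          case True
          then show ?thesis using 3 dead[OF 3(1)] len by auto
        next
          case False
          then have "nat (int j - int W) = length z + i" "i < length ?y" using 3 len by auto
          moreover have "?y ! i = s (In (2 * i + 2))" using False by (simp add: witness_def)
          ultimately show ?thesis using 3 dead[OF 3(1)] len False by (auto simp: nth_append In1)
        qed
      next
        case (4 i)
        then show ?thesis using used_len_le[of p ?\<alpha>] by (auto simp: witness_def)
      qed
    qed
    finally show ?thesis using zero3[of 0 j a] jN aS KS unfolding s' pdo_val[OF indep_inits(3)] by auto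
  qed
  show ?thesis
    unfolding cfg_def
  proof (intro conjI allI impI)
    show "val s' (0, KSt q) \<longleftrightarrow> q = fst (tm_init M (z @ ?y))" if "q \<le> tm_states M" for q
      using st[OF that] by (simp add: tm_init_def)
    fix t j assume t: "t < tm_tapes M" and j: "j < N"
    show "val s' (j, KHd t) \<longleftrightarrow> int j = snd (snd (tm_init M (z @ ?y)) ! t) + int W"
      using hd[OF t j] t by (cases t) (auto simp: tm_init_def input_tape_def blank_tape_def)
    show "val s' (j, KCell t a) \<longleftrightarrow> fst (snd (tm_init M (z @ ?y)) ! t) (int j - int W) = a" if "a < tm_syms M" for a
    proof (cases "t = 0")
      case True
      then show ?thesis using cell0[OF j that] by (simp add: tm_init_def input_tape_def)
    next
      case False
      then show ?thesis using cellt[OF _ t j that] t by (cases t) (auto simp: tm_init_def blank_tape_def)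
    qed
  qed
qed

lemma wf_cfg_init: "wf_cfg 0 (tm_init M x)"
  using wf by (auto simp: wf_cfg_def tm_init_def wf_tm_def input_tape_def blank_tape_def bit_sym_def nth_Cons split: nat.split)

text \<open>Cell 0 of the last tape is at window position \<open>W\<close>, and symbol 2 there
  represents the answer \<open>True\<close>. The output is set to 1 and reset to 0 exactly on
  acceptance.\<close>

definition final_code :: "nat \<Rightarrow> instr list" where
  "final_code W = [Plain (OutSet True), PosTest (AuxGet (rnum (W, KCell (tm_tapes M - 1) 2))), Plain (OutSet False), Halt]"

definition sim_code :: "nat \<Rightarrow> nat \<Rightarrow> nat \<Rightarrow> nat \<Rightarrow> bool list \<Rightarrow> instr list" where
  "sim_code W N p T z = (phase False (init1 N p) @ phase True (init2 p) @ phase True (init3 W N p z) @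
     concat (replicate T (step_code N))) @ final_code W"

lemma straight_replicate: "straight X f \<Longrightarrow> straight (concat (replicate T X)) (f ^^ T)"
proof (induction T)
  case 0
  then show ?case using straight_Nil by (simp add: id_def)
next
  case (Suc T)
  from straight_append[OF Suc.prems Suc.IH[OF Suc.prems]] show ?case by (simp add: funpow_swap1 comp_def)
qed

lemma exec_final:
  "exec (P @ final_code W) (length P) s s' \<longleftrightarrow> s' = s(Out := \<not> val s (W, KCell (tm_tapes M - 1) 2))"
proof -
  let ?X = "P @ final_code W"
  have n: "?X ! length P = Plain (OutSet True)" "?X ! (Suc (length P)) = PosTest (AuxGet (rnum (W, KCell (tm_tapes M - 1) 2)))"
    "?X ! (Suc (Suc (length P))) = Plain (OutSet False)" "?X ! (Suc (Suc (Suc (length P)))) = Halt"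
    "length (final_code W) = 4"
    by (simp_all add: final_code_def nth_append)
  have 4: "exec ?X (Suc (Suc (Suc (length P)))) s s' \<longleftrightarrow> s' = s" for s
    by (subst exec_iff) (simp_all add: n)
  have 3: "exec ?X (Suc (Suc (length P))) s s' \<longleftrightarrow> s' = s(Out := False)" for s
    by (subst exec_iff) (simp_all add: n 4)
  have 2: "exec ?X (Suc (length P)) s s' \<longleftrightarrow> s' = (if val s (W, KCell (tm_tapes M - 1) 2) then s(Out := False) else s)" for s
    by (subst exec_iff) (simp_all add: n 3 4 val_def)
  show ?thesis
    by (subst exec_iff) (auto simp: n 2 val_def)
qed

lemma exec_sim:
  assumes "T < W" "W + T + 1 < N" "W + length z + p \<le> N"
  shows "(\<exists>s'. exec (P @ sim_code W N p T z) (length P) s s' \<and> s' Out = v) \<longleftrightarrow>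
    v = (fst (last (snd ((tm_step M ^^ T) (tm_init M (z @ witness p (\<lambda>i. s (In i))))))) 0 \<noteq> 2)"
proof -
  let ?A = "phase False (init1 N p) @ phase True (init2 p) @ phase True (init3 W N p z) @ concat (replicate T (step_code N))"
  let ?s1 = "pdo True (init3 W N p z) (pdo True (init2 p) (pdo False (init1 N p) s))"
  let ?f = "\<lambda>s. (step_fun N ^^ T) (pdo True (init3 W N p z) (pdo True (init2 p) (pdo False (init1 N p) s)))"
  let ?c = "(tm_step M ^^ T) (tm_init M (z @ witness p (\<lambda>i. s (In i))))"
  have KS: "tm_tapes M \<ge> 1" "tm_syms M \<ge> 3" using wf by (auto simp: wf_tm_def)
  have "straight ?A ?f"
    by (intro straight_append straight_phase straight_replicate straight_step)
  then have "exec (P @ ?A @ final_code W) (length P) s s' \<longleftrightarrow>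
      exec (P @ ?A @ final_code W) (length P + length ?A) (?f s) s'" for s'
    unfolding straight_def by blast
  moreover have "exec ((P @ ?A) @ final_code W) (length (P @ ?A)) (?f s) s' \<longleftrightarrow>
      s' = (?f s)(Out := \<not> val (?f s) (W, KCell (tm_tapes M - 1) 2))" for s'
    by (rule exec_final)
  ultimately have ex: "exec (P @ sim_code W N p T z) (length P) s s' \<longleftrightarrow>
      s' = (?f s)(Out := \<not> val (?f s) (W, KCell (tm_tapes M - 1) 2))" for s'
    by (simp add: sim_code_def)
  have c: "cfg W N (?f s) ?c" "wf_cfg T ?c"
    using cfg_steps[OF cfg_init[OF assms(3)] wf_cfg_init assms(1,2)] by auto
  have "length (snd ?c) = tm_tapes M" using c(2) by (auto simp: wf_cfg_def)
  then have "last (snd ?c) = snd ?c ! (tm_tapes M - 1)" using KS by (subst last_conv_nth) auto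
  moreover have "val (?f s) (W, KCell (tm_tapes M - 1) 2) \<longleftrightarrow> fst (snd ?c ! (tm_tapes M - 1)) (int W - int W) = 2"
    using c(1) KS assms(2) unfolding cfg_def by auto
  ultimately show ?thesis unfolding ex by auto
qed

end

subsection \<open>Generating the code in polynomial time\<close>

definition EI :: "instr list \<Rightarrow> bool list" where
  "EI X = concat (map encode_int (concat (map instr_code X)))"

lemma EI_append: "EI (X @ Y) = EI X @ EI Y"
  by (simp add: EI_def)

lemma EI_Cons: "EI (u # X) = concat (map encode_int (instr_code u)) @ EI X"
  by (simp add: EI_def)

lemma EI_Nil: "EI [] = []"
  by (simp add: EI_def)

lemma EI_concat: "EI (concat Xs) = concat (map EI Xs)"
  by (induction Xs) (simp_all add: EI_Nil EI_append)

lemma encode_instance_EI: "encode_instance (n, X) = encode_int (int n) @ EI X"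
  by (simp add: encode_instance_def EI_def)

lemma length_EI: "length X \<le> length (EI X)"
proof (induction X)
  case (Cons u X)
  obtain c d where "instr_code u = [c, d]" by (cases u) auto
  then have "length (EI (u # X)) = length (encode_int c) + length (encode_int d) + length (EI X)"
    by (simp add: EI_Cons)
  moreover have "length (encode_int c) > 0" using encode_int_nonempty by simp
  ultimately show ?case using Cons.IH unfolding list.size by linarith
qed simp

definition pg :: "('a::enc \<Rightarrow> gset list) \<Rightarrow> bool" where
  "pg G \<longleftrightarrow> (\<forall>b. pt (\<lambda>x. EI (phase b (G x))))"

text \<open>The number of guards must not depend on \<open>x\<close>: then the length of each jump
  over an assignment is a constant of the generator.\<close>

definition pgs :: "('a::enc \<Rightarrow> lit list) \<Rightarrow> ('a \<Rightarrow> reg) \<Rightarrow> bool" where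
  "pgs gs r \<longleftrightarrow> (\<exists>n. \<forall>x. length (gs x) = n) \<and> (\<forall>b. pt (\<lambda>x. EI (gcode b (gs x) (r x))))"

lemma pt_rnum: "pt j \<Longrightarrow> pt (\<lambda>x. encode_int (int (rnum (j x, \<kappa>))))"
  unfolding rnum_def fst_conv snd_conv by (intro pt_intros)

lemma pgs_Nil: "pt j \<Longrightarrow> pgs (\<lambda>x. []) (\<lambda>x. (j x, \<kappa>))"
  unfolding pgs_def by (auto simp: EI_Cons EI_Nil intro!: pt_append pt_rnum pt_const)

lemma pgs_Cons:
  assumes "pgs gs r" "\<And>x. instr_code (lit_instr (g x)) = [k, int (n x)]" "pt (\<lambda>x. encode_int (int (n x)))"
  shows "pgs (\<lambda>x. g x # gs x) r"
proof -
  obtain l where l: "\<And>x. length (gs x) = l" using assms(1) unfolding pgs_def by blast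
  have "pt (\<lambda>x. EI (gcode b (g x # gs x) (r x)))" for b
  proof -
    have "pt (\<lambda>x. EI (gcode b (gs x) (r x)))" using assms(1) unfolding pgs_def by blast
    then have "pt (\<lambda>x. encode_int k @ encode_int (int (n x)) @ (encode_int 18 @ encode_int (int (2 * l + 2))) @
        EI (gcode b (gs x) (r x)))"
      by (intro pt_append assms(3) pt_const)
    then show ?thesis by (simp add: EI_Cons assms(2) l)
  qed
  then show ?thesis unfolding pgs_def using l by auto
qed

lemma pgs_Aux: "pt j \<Longrightarrow> pgs gs r \<Longrightarrow> pgs (\<lambda>x. LAux (j x, \<kappa>) p # gs x) r"
  by (rule pgs_Cons[where k = "if p then 15 else 9" and n = "\<lambda>x. rnum (j x, \<kappa>)"]) (auto intro: pt_rnum)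

lemma pgs_In: "pt j \<Longrightarrow> pgs gs r \<Longrightarrow> pgs (\<lambda>x. LIn (j x) p # gs x) r"
  by (rule pgs_Cons[where k = "if p then 12 else 6" and n = j]) (auto intro: pt_encode_nat)

lemma pg_const: "pg (\<lambda>x. G)"
  unfolding pg_def by (auto intro: pt_const)

lemma pg_append: "pg G \<Longrightarrow> pg H \<Longrightarrow> pg (\<lambda>x. G x @ H x)"
  unfolding pg_def phase_append EI_append by (auto intro: pt_append)

lemma pg_single: "pgs gs r \<Longrightarrow> pg (\<lambda>x. [(gs x, r x)])"
  unfolding pg_def pgs_def by (simp add: phase_def)

lemma pg_Cons: "pg (\<lambda>x. [a x]) \<Longrightarrow> pg G \<Longrightarrow> pg (\<lambda>x. a x # G x)"
  using pg_append[of "\<lambda>x. [a x]" G] by simp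

lemma pg_concat: "(\<And>c. pg (\<lambda>x. G c x)) \<Longrightarrow> pg (\<lambda>x. concat (map (\<lambda>c. G c x) cs))"
  by (induction cs) (auto intro: pg_const pg_append)

lemma pg_map: "(\<And>c. pg (\<lambda>x. [f c x])) \<Longrightarrow> pg (\<lambda>x. map (\<lambda>c. f c x) cs)"
  using pg_concat[of "\<lambda>c x. [f c x]" cs] by simp

text \<open>For ranges that depend on the argument, namely positions; ranges fixed by
  \<open>M\<close> are unrolled into the generating program by \<open>pg_concat\<close> and
  \<open>pg_map\<close>.\<close>

lemma pg_loop:
  assumes "pt n" "pg (\<lambda>z. G (snd z) (fst z))"
  shows "pg (\<lambda>x. concat (map (\<lambda>j. G x j) [0..<n x]))"
  unfolding pg_def
proof
  fix b
  have "pt (\<lambda>x. concat (map (\<lambda>j. EI (phase b (G x j))) [0..<n x]))"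
    using assms(2) unfolding pg_def by (intro pt_concat pt_map pt_upt assms(1)) simp
  then show "pt (\<lambda>x. EI (phase b (concat (map (\<lambda>j. G x j) [0..<n x]))))"
    by (simp add: phase_concat EI_concat comp_def)
qed

lemma pg_if: "pt c \<Longrightarrow> pg G \<Longrightarrow> pg H \<Longrightarrow> pg (\<lambda>x. if c x then G x else H x)"
  unfolding pg_def by (auto simp: if_distrib[of "phase _"] if_distrib[of EI] intro: pt_if)

lemma pt_moved: "pt j \<Longrightarrow> pt (\<lambda>x. moved d (j x))"
  by (cases d) (auto intro!: pt_intros)

lemma pt_nth_bit0: "pt (\<lambda>z. nth_bit (snd z) (fst z))"
proof -
  have "pt (\<lambda>z :: nat \<times> bool list. ((\<lambda>l. case l of [] \<Rightarrow> [] | h # t \<Rightarrow> t) ^^ fst z) (snd z))"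
    by (rule pt_funpow[where p = 0]) (auto intro!: pt_intros split: list.split)
  then show ?thesis unfolding nth_bit_def by (intro pt_case_list pt_intros)
qed

lemmas pg_intros = pg_const pg_append pg_single pg_Cons pg_concat pg_map pg_loop pg_if pgs_Nil pgs_Aux pgs_In

lemma pt_phase: "pg G \<Longrightarrow> pt (\<lambda>x. EI (phase b (G x)))"
  by (simp add: pg_def)

lemma pt_step_code:
  assumes "wf_tm M"
  shows "pt (\<lambda>N. EI (step_code M N))"
  unfolding step_code_def[OF assms] EI_append step1_def[OF assms] step2_def[OF assms] step3_def[OF assms]
    step4_def[OF assms] step5_def[OF assms] step6_def[OF assms]
  by (intro pt_append pt_phase pg_intros pt_moved pt_intros)

lemma pt_sim_code0:
  assumes "wf_tm M"
  shows "pt (\<lambda>x. EI (sim_code M (fst x) (fst (snd x)) (fst (snd (snd x))) (fst (snd (snd (snd x)))) (snd (snd (snd (snd x))))))"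
proof -
  have fin: "pt (\<lambda>W. EI (final_code M W))"
    unfolding final_code_def[OF assms] EI_Cons EI_Nil
    by simp (intro pt_append pt_rnum pt_intros)
  have rep: "EI (concat (replicate T X)) = concat (replicate T (EI X))" for T X
    by (simp add: EI_concat map_replicate_const)
  show ?thesis
    unfolding sim_code_def[OF assms] EI_append rep init1_def[OF assms] init2_def init3_def[OF assms] step5_def[OF assms]
    by (intro pt_append pt_phase pg_intros pt_comp[OF fin] pt_comp[OF pt_step_code[OF assms]] pt_comp2[OF pt_nth_bit0] pt_intros)
qed

lemma pt_sim_code:
  assumes "wf_tm M" "pt W" "pt N" "pt p" "pt T" "pt z"
  shows "pt (\<lambda>x. EI (sim_code M (W x) (N x) (p x) (T x) (z x)))"
  using pt_comp[OF pt_sim_code0[OF assms(1)] pt_Pair[OF assms(2) pt_Pair[OF assms(3) pt_Pair[OF assms(4) pt_Pair[OF assms(5,6)]]]]]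
  by simp

lemma valid_gcode: "list_all (\<lambda>g. case g of LIn i p \<Rightarrow> i \<ge> 1 | _ \<Rightarrow> True) gs \<Longrightarrow> list_all valid_instr (gcode b gs r)"
  by (induction gs) (use rnum_pos in \<open>auto split: lit.splits\<close>)

lemma valid_phase:
  assumes "\<And>x i p. x \<in> set G \<Longrightarrow> LIn i p \<in> set (fst x) \<Longrightarrow> i \<ge> 1"
  shows "list_all valid_instr (phase b G)"
proof -
  have "list_all valid_instr (gcode b (fst x) (snd x))" if "x \<in> set G" for x
    using assms[OF that] by (intro valid_gcode) (auto simp: list_all_iff split: lit.splits)
  then show ?thesis by (auto simp: phase_def list_all_iff split_def)
qed

lemma valid_sim_code:
  assumes "wf_tm M"
  shows "list_all valid_instr (sim_code M W N p T z)"
proof -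
  have "list_all valid_instr (step_code M N)"
    unfolding step_code_def[OF assms] list_all_append
    by (intro conjI valid_phase)
      (auto simp: step1_def[OF assms] step2_def[OF assms] step3_def[OF assms] step4_def[OF assms]
        step5_def[OF assms] step6_def[OF assms] simp del: upt_Suc)
  then have "list_all valid_instr (concat (replicate T (step_code M N)))"
    by (induction T) auto
  moreover have "list_all valid_instr (final_code M W)"
    using rnum_pos by (simp add: final_code_def[OF assms])
  ultimately show ?thesis
    unfolding sim_code_def[OF assms] list_all_append
    by (intro conjI valid_phase)
      (auto simp: init1_def[OF assms] init2_def init3_def[OF assms] step5_def[OF assms] simp del: upt_Suc split: if_splits)
qed

subsection \<open>The reduction\<close>

text \<open>If the first input of a block is 1, the negative test skips to the jump; if only the
  second is 1, the positive test proceeds to it; if both are 0, the jump is skipped and the next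
  block begins. \<open>Jump 3\<close> leads to the jump of the next block, so a single 1 carries
  execution to the end.\<close>

definition or_code :: "nat \<Rightarrow> instr list" where
  "or_code h = concat (map (\<lambda>i. [NegTest (InGet (2 * i + 1)), PosTest (InGet (2 * i + 2)), Jump 3]) [0..<h])"

lemma or_code_Suc: "or_code (Suc h) = or_code h @ [NegTest (InGet (2 * h + 1)), PosTest (InGet (2 * h + 2)), Jump 3]"
  by (simp add: or_code_def)

lemma length_or_code: "length (or_code h) = 3 * h"
  by (induction h) (simp_all add: or_code_Suc, simp add: or_code_def)

lemma nth_or_code:
  "i < h \<Longrightarrow> or_code h ! (3 * i) = NegTest (InGet (2 * i + 1)) \<and>
     or_code h ! (3 * i + 1) = PosTest (InGet (2 * i + 2)) \<and> or_code h ! (3 * i + 2) = Jump 3"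
proof (induction h)
  case (Suc h)
  show ?case
  proof (cases "i = h")
    case True
    then show ?thesis by (simp add: or_code_Suc nth_append length_or_code)
  next
    case False
    then have "i < h" using Suc.prems by simp
    then show ?thesis using Suc.IH by (simp add: or_code_Suc nth_append length_or_code)
  qed
qed simp

text \<open>The jumps form a chain: each leads to the next one, and the last one skips the two instructions
  \<open>Halt\<close>.\<close>

lemma exec_or_code:
  fixes h Y s s'
  defines "X \<equiv> or_code h @ [Halt, Halt] @ Y"
  shows "exec X 0 s s' \<longleftrightarrow>
    (if \<exists>i \<in> {1..2 * h}. s (In i) then exec X (3 * h + 2) s s' else s' = s)"
proof -
  have nth: "X ! (3 * i) = NegTest (InGet (2 * i + 1))" "X ! (3 * i + 1) = PosTest (InGet (2 * i + 2))"
      "X ! (3 * i + 2) = Jump 3" if "i < h" for i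
    using that nth_or_code[OF that] by (simp_all add: X_def nth_append length_or_code)
  have len: "length X \<ge> 3 * h + 2" by (simp add: X_def length_or_code)
  have chain: "exec X (3 * i + 2) s s' \<longleftrightarrow> exec X (3 * h + 2) s s'" if "i \<le> h" for i
    using that
  proof (induction rule: inc_induct)
    case (step i)
    have "exec X (3 * i + 2) s s' \<longleftrightarrow> exec X (3 * i + 2 + 3) s s'"
      using step.hyps len nth(3)[of i] by (subst exec_iff) auto
    then show ?case using step.IH by (simp add: algebra_simps)
  qed simp
  have "exec X (3 * i) s s' \<longleftrightarrow> (if \<exists>j. i \<le> j \<and> j < h \<and> (s (In (2 * j + 1)) \<or> s (In (2 * j + 2)))
      then exec X (3 * h + 2) s s' else s' = s)" if "i \<le> h" for i
    using that
  proof (induction rule: inc_induct)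
    case base
    have "X ! (3 * h) = Halt" by (simp add: X_def nth_append length_or_code)
    then show ?case using len by (subst exec_iff) auto
  next
    case (step i)
    have 1: "exec X (3 * i) s s' \<longleftrightarrow> exec X (if s (In (2 * i + 1)) then 3 * i + 2 else 3 * i + 1) s s'"
      using step.hyps len nth(1)[of i] by (subst exec_iff) auto
    have e: "3 * i + 1 + 2 = 3 * Suc i" by simp
    have "exec X (3 * i + 1) s s' \<longleftrightarrow> exec X (if s (In (2 * i + 2)) then 3 * i + 2 else 3 * i + 1 + 2) s s'"
      using step.hyps len nth(2)[of i] by (subst exec_iff) auto
    note 2 = this[unfolded e]
    have 3: "(\<exists>j. i \<le> j \<and> j < h \<and> (s (In (2 * j + 1)) \<or> s (In (2 * j + 2)))) \<longleftrightarrow>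
      s (In (2 * i + 1)) \<or> s (In (2 * i + 2)) \<or> (\<exists>j. Suc i \<le> j \<and> j < h \<and> (s (In (2 * j + 1)) \<or> s (In (2 * j + 2))))"
      using step.hyps by (metis Suc_leD Suc_leI le_eq_less_or_eq)
    show ?case unfolding 1 3 using 2 step.IH chain[of i] step.hyps by auto
  qed
  from this[of 0] have "exec X 0 s s' \<longleftrightarrow> (if \<exists>j<h. s (In (2 * j + 1)) \<or> s (In (2 * j + 2))
      then exec X (3 * h + 2) s s' else s' = s)" by simp
  moreover have "(\<exists>j<h. s (In (2 * j + 1)) \<or> s (In (2 * j + 2))) \<longleftrightarrow> (\<exists>i \<in> {1..2 * h}. s (In i))"
  proof
    assume "\<exists>j<h. s (In (2 * j + 1)) \<or> s (In (2 * j + 2))"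
    then obtain j where j: "j < h" "s (In (2 * j + 1)) \<or> s (In (2 * j + 2))" by blast
    then have "2 * j + 1 \<in> {1..2 * h}" "2 * j + 2 \<in> {1..2 * h}" by auto
    with j(2) show "\<exists>i \<in> {1..2 * h}. s (In i)" by blast
  next
    assume "\<exists>i \<in> {1..2 * h}. s (In i)"
    then obtain i where i: "1 \<le> i" "i \<le> 2 * h" "s (In i)" by auto
    then have "(i - 1) div 2 < h" "i = 2 * ((i - 1) div 2) + 1 \<or> i = 2 * ((i - 1) div 2) + 2" by presburger+
    with i(3) show "\<exists>j<h. s (In (2 * j + 1)) \<or> s (In (2 * j + 2))" by metis
  qed
  ultimately show ?thesis by simp
qed

lemma halted_stays:
  "(tm_step M ^^ t) c = (tm_states M, ts) \<Longrightarrow> t \<le> T \<Longrightarrow> (tm_step M ^^ T) c = (tm_states M, ts)"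
proof (induction T)
  case (Suc T)
  show ?case
  proof (cases "t = Suc T")
    case False
    with Suc show ?thesis by simp
  qed (use Suc.prems in simp)
qed simp

text \<open>The zero input is answered by the first \<open>Halt\<close>, any other by the
  simulation. So correctness means that no witness offered by a non-zero input is accepted, and
  \<open>p < h\<close> makes these all the witnesses of length at most \<open>p\<close>.\<close>

lemma sim_computes:
  assumes wf: "wf_tm M" and TW: "T < W" "W + T + 1 < N" "W + length z + p \<le> N" and h: "p < h"
    and acc: "\<And>y. length y \<le> p \<Longrightarrow>
      fst (last (snd ((tm_step M ^^ T) (tm_init M (z @ y))))) 0 = 2 \<longleftrightarrow> z @ y \<in> V"
  shows "computes (or_code h @ [Halt, Halt] @ sim_code M W N p T z) (2 * h) tstnz \<longleftrightarrow>
    \<not> (\<exists>y. length y \<le> p \<and> z @ y \<in> V)"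
proof -
  let ?Y = "sim_code M W N p T z"
  let ?P = "or_code h @ [Halt, Halt]"
  let ?X = "or_code h @ [Halt, Halt] @ ?Y"
  have wlen: "length (witness p \<alpha>) \<le> p" for \<alpha> by (simp add: witness_def used_len_le)
  have run: "(\<exists>s'. exec ?X 0 s s' \<and> s' Out = v) \<longleftrightarrow>
      (if \<exists>i \<in> {1..2 * h}. s (In i) then v = (z @ witness p (\<lambda>i. s (In i)) \<notin> V) else v = s Out)" for s v
  proof -
    have "(\<exists>s'. exec (?P @ ?Y) (length ?P) s s' \<and> s' Out = v) \<longleftrightarrow> v = (z @ witness p (\<lambda>i. s (In i)) \<notin> V)"
      unfolding exec_sim[OF wf TW] using acc[OF wlen] by simp
    then show ?thesis unfolding exec_or_code by (auto simp: length_or_code)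
  qed
  have tst: "tstnz bs \<longleftrightarrow> (\<exists>i \<in> {1..2 * h}. s (In i))"
    if lb: "length bs = 2 * h" and sb: "\<forall>i \<in> {1..2 * h}. s (In i) = bs ! (i - 1)" for bs and s :: reg_state
  proof
    assume "tstnz bs"
    then obtain i where "i < 2 * h" "bs ! i" using lb by (auto simp: tstnz_def)
    then show "\<exists>i \<in> {1..2 * h}. s (In i)" using sb by (intro bexI[of _ "Suc i"]) auto
  next
    assume "\<exists>i \<in> {1..2 * h}. s (In i)"
    then obtain i where "i \<in> {1..2 * h}" "s (In i)" by blast
    then show "tstnz bs" using lb sb unfolding tstnz_def by (intro exI[of _ "i - 1"]) auto
  qed
  show ?thesis
  proof
    assume c: "computes ?X (2 * h) tstnz"
    show "\<not> (\<exists>y. length y \<le> p \<and> z @ y \<in> V)"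
    proof
      assume "\<exists>y. length y \<le> p \<and> z @ y \<in> V"
      then obtain y where y: "length y \<le> p" "z @ y \<in> V" by blast
      let ?\<alpha> = "\<lambda>i. if odd i then i div 2 < length y else y ! ((i - 2) div 2)"
      \<comment> \<open>The last input register is not used by the simulation; setting it makes the input non-zero.\<close>
      define s :: reg_state where "s = (\<lambda>r. case r of In i \<Rightarrow> i = 2 * h \<or> ?\<alpha> i | _ \<Rightarrow> False)"
      have "used_len p (\<lambda>i. s (In i)) = used_len p ?\<alpha>"
      proof -
        have "s (In (2 * i + 1)) = ?\<alpha> (2 * i + 1)" for i
          unfolding s_def by (simp del: mult_Suc_right) presburger
        then show ?thesis unfolding used_len_def by presburger
      qed
      moreover have "s (In (2 * i + 2)) = ?\<alpha> (2 * i + 2)" if "i < p" for i using that h by (simp add: s_def)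
      ultimately have "witness p (\<lambda>i. s (In i)) = witness p ?\<alpha>"
        using used_len_le[of p ?\<alpha>] unfolding witness_def by (auto simp del: mult_2 intro!: map_cong)
      then have w: "witness p (\<lambda>i. s (In i)) = y" using witness_surj[OF y(1)] by simp
      let ?bs = "map (\<lambda>i. s (In (Suc i))) [0..<2 * h]"
      have bs: "length ?bs = 2 * h" "\<forall>i \<in> {1..2 * h}. s (In i) = ?bs ! (i - 1)" by auto
      have nz: "\<exists>i \<in> {1..2 * h}. s (In i)" using h by (intro bexI[of _ "2 * h"]) (auto simp: s_def)
      have "s Out = False" "\<forall>i \<in> {1..k}. s (Aux i) = False" for k by (auto simp: s_def)
      then have "\<exists>s'. exec ?X 0 s s' \<and> s' Out = tstnz ?bs"
        using c bs unfolding computes_def by blast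
      then show False using run[of s "tstnz ?bs"] tst[OF bs] nz w y(2) by simp
    qed
  next
    assume n: "\<not> (\<exists>y. length y \<le> p \<and> z @ y \<in> V)"
    show "computes ?X (2 * h) tstnz"
      unfolding computes_def
    \<comment> \<open>\<open>k = 0\<close> will do, as the simulation clears every auxiliary
      register before reading it.\<close>
    proof (intro exI[of _ 0] allI impI)
      fix bs s
      assume a: "length bs = 2 * h \<and> (\<forall>i \<in> {1..2 * h}. s (In i) = bs ! (i - 1)) \<and> s Out = False \<and>
        (\<forall>i \<in> {1..0}. s (Aux i) = False)"
      then show "\<exists>s'. exec ?X 0 s s' \<and> s' Out = tstnz bs"
        unfolding run using tst[of bs s] n wlen[of "\<lambda>i. s (In i)"] by auto
    qed
  qed
qed

text \<open>With \<open>l\<close> the length of the simulation, the length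
  \<open>3 * h + 2 + l\<close> is compared with \<open>min_len (2 * h) = 3 * h + 1\<close>. One of
  the surplus instructions is charged to \<open>m\<close>, and the other \<open>l\<close> to
  \<open>q * (2 * h)\<close>, because \<open>h \<ge> b * l\<close> and
  \<open>b * q \<ge> 1\<close>.\<close>

lemma sim_instance:
  assumes wf: "wf_tm M" and q: "q > 0" "of_nat b * q \<ge> 1" and b: "h \<ge> b * length (sim_code M W N p T z)" "h \<ge> 1" and m: "m \<ge> 1"
  shows "(2 * h, or_code h @ [Halt, Halt] @ sim_code M W N p T z) \<in> tstnz_instances q m"
proof -
  let ?l = "length (sim_code M W N p T z)"
  have "list_all valid_instr (or_code h)" by (induction h) (auto simp: or_code_Suc, simp add: or_code_def)
  then have IS: "or_code h @ [Halt, Halt] @ sim_code M W N p T z \<in> IS"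
    using valid_sim_code[OF wf, of W N p T z] by (auto simp: IS_def list_all_iff)
  have "of_nat ?l * 1 \<le> of_nat ?l * (of_nat b * q)" using q(2) by (intro mult_left_mono) auto
  also have "\<dots> = q * of_nat (b * ?l)" by simp
  also have "\<dots> \<le> q * of_nat (2 * h)"
  proof (rule mult_left_mono)
    have "b * ?l \<le> 2 * h" using b(1) by simp
    then show "rat_of_nat (b * ?l) \<le> rat_of_nat (2 * h)" by (simp only: of_nat_le_iff)
  qed (use q(1) in simp)
  finally have "of_nat ?l \<le> q * of_nat (2 * h)" by simp
  then have "int ?l \<le> \<lceil>q * of_nat (2 * h)\<rceil>" by (metis ceiling_mono ceiling_of_nat)
  moreover have "min_len (2 * h) = 3 * h + 1" by (simp add: min_len_def)
  ultimately show ?thesis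
    unfolding tstnz_instances_def using IS b(2) m by (simp add: length_or_code)
qed

lemma tstnz_problem_hard:
  assumes q: "q > 0" and m: "m > 3" and A: "A \<in> class_coNP"
  shows "poly_reducible A (tstnz_problem q m)"
proof -
  from A obtain V and pp :: "nat poly" where V: "V \<in> class_P"
    and NP: "\<And>x. x \<notin> A \<longleftrightarrow> (\<exists>y. length y \<le> poly pp (length x) \<and> encode_pair x y \<in> V)"
    unfolding class_coNP_def class_NP_def by auto
  from V obtain M and r :: "nat poly" where wf: "wf_tm M"
    and M: "\<And>x. tm_computes_within M (poly r (length x)) x [x \<in> V]"
    unfolding class_P_def polytime_def by blast
  obtain b :: nat where "1 / q < of_nat b" using reals_Archimedean2 by blast
  then have b: "of_nat b * q \<ge> 1" using q by (simp add: field_simps)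
  define p where "p x = poly pp (length x)" for x :: "bool list"
  \<comment> \<open>The part of \<open>encode_pair x y\<close> in front of the witness, so that the
    verifier runs on \<open>z x @ y\<close>.\<close>
  define z where "z x = mark_bits x @ [False]" for x
  \<comment> \<open>One time bound for all witnesses of length at most \<open>p x\<close>, by
    monotonicity of \<open>poly r\<close>; shorter runs idle after halting.\<close>
  define T where "T x = poly r (length (z x) + p x)" for x
  define W where "W x = Suc (T x)" for x
  \<comment> \<open>Chosen to satisfy both \<open>W + T + 1 < N\<close>, the room for the heads, and
    \<open>W + length z + p \<le> N\<close>, the room for the input.\<close>
  define N where "N x = W x + length (z x) + p x + T x + 2" for x
  define sim where "sim x = sim_code M (W x) (N x) (p x) (T x) (z x)" for x
  \<comment> \<open>The length of the encoded simulation is at hand as a polynomial-time function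
    and bounds the number of its instructions. The summand \<open>p x + 1\<close> ensures
    \<open>p x < h x\<close>, which leaves the last input register free.\<close>
  define h where "h x = b * length (EI (sim x)) + p x + 1" for x
  define f where "f x = encode_instance (2 * h x, or_code (h x) @ [Halt, Halt] @ sim x)" for x
  have pts: "pt p" "pt z" unfolding p_def z_def by (intro pt_intros)+
  have ptT: "pt T" unfolding T_def by (intro pt_intros pt_comp[OF pts(1)] pt_comp[OF pts(2)])
  have ptW: "pt W" unfolding W_def by (intro pt_intros pt_comp[OF ptT])
  have ptN: "pt N" unfolding N_def by (intro pt_intros pt_comp[OF ptT] pt_comp[OF ptW] pt_comp[OF pts(1)] pt_comp[OF pts(2)])
  have sim: "pt (\<lambda>x. EI (sim x))" unfolding sim_def by (intro pt_sim_code wf ptW ptN pts ptT)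
  have pth: "pt h" unfolding h_def by (intro pt_intros sim pt_comp[OF pts(1)])
  have "pt (\<lambda>x. encode_int (int (2 * h x)) @ concat (map (\<lambda>i. (encode_int 12 @ encode_int (int (2 * i + 1)) @
      encode_int 6 @ encode_int (int (2 * i + 2)) @ encode_int 18 @ encode_int 3)) [0..<h x]) @ EI [Halt, Halt] @ EI (sim x))"
    by (intro pt_intros sim pt_comp[OF pth])
  then have "pt f"
    by (rule pt_cong) (simp add: f_def encode_instance_EI EI_append or_code_def EI_concat comp_def EI_Cons EI_Nil)
  then have "polytime f" by (rule pt_polytime)
  moreover have "x \<in> A \<longleftrightarrow> f x \<in> tstnz_problem q m" for x
  proof -
    have acc: "fst (last (snd ((tm_step M ^^ T x) (tm_init M (z x @ y))))) 0 = 2 \<longleftrightarrow> z x @ y \<in> V" if "length y \<le> p x" for y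
    proof -
      let ?w = "z x @ y"
      obtain t where t0: "t \<le> poly r (length ?w)" "case (tm_step M ^^ t) (tm_init M ?w) of (st, ts) \<Rightarrow>
          st = tm_states M \<and> tape_output (last ts) [?w \<in> V]"
        using M[of ?w] unfolding tm_computes_within_def by (elim exE conjE) (rule that)
      obtain st ts where "(tm_step M ^^ t) (tm_init M ?w) = (st, ts)" by (metis surj_pair)
      with t0 have t: "t \<le> poly r (length ?w)" "(tm_step M ^^ t) (tm_init M ?w) = (tm_states M, ts)"
        "tape_output (last ts) [?w \<in> V]" by simp_all
      have "poly r (length ?w) \<le> T x" unfolding T_def using that by (intro poly_nat_mono) simp
      then have "(tm_step M ^^ T x) (tm_init M ?w) = (tm_states M, ts)"
        using halted_stays[OF t(2)] t(1) by simp
      moreover have "fst (last ts) 0 = bit_sym (?w \<in> V)" using t(3) by (simp add: tape_output_def)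
      ultimately show ?thesis by (simp add: bit_sym_def)
    qed
    have "length (sim x) \<le> length (EI (sim x))" by (rule length_EI)
    then have hb: "h x \<ge> b * length (sim x)" unfolding h_def by (metis add.assoc mult_le_mono2 trans_le_add1)
    have inst: "(2 * h x, or_code (h x) @ [Halt, Halt] @ sim x) \<in> tstnz_instances q m"
      using sim_instance[OF wf q b hb[unfolded sim_def]] m unfolding sim_def h_def by simp
    have "computes (or_code (h x) @ [Halt, Halt] @ sim x) (2 * h x) tstnz \<longleftrightarrow> \<not> (\<exists>y. length y \<le> p x \<and> z x @ y \<in> V)"
      unfolding sim_def by (rule sim_computes[OF wf _ _ _ _ acc]) (auto simp: W_def N_def h_def)
    also have "\<dots> \<longleftrightarrow> x \<in> A" using NP[of x] by (simp add: p_def z_def encode_pair_def) blast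
    finally have c: "computes (or_code (h x) @ [Halt, Halt] @ sim x) (2 * h x) tstnz \<longleftrightarrow> x \<in> A" .
    have "f x \<in> tstnz_problem q m \<longleftrightarrow> computes (or_code (h x) @ [Halt, Halt] @ sim x) (2 * h x) tstnz"
      unfolding tstnz_problem_def f_def inj_image_mem_iff[OF inj_encode_instance] using inst by simp
    with c show ?thesis by simp
  qed
  ultimately show ?thesis unfolding poly_reducible_def by blast
qed

theorem theorem7:
  fixes q :: rat and m :: nat
  assumes "q > 0" and "m > 3"
  shows "coNP_complete (tstnz_problem q m)"
  unfolding coNP_complete_def
  using tstnz_problem_in_coNP[OF assms(1)] tstnz_problem_hard[OF assms] by blast

end
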